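(* Let $1<p<\infty$, let $X$ be a complete, doubling metric measure space supporting a $(1,p)$-Poincaré inequality, and let $\Omega\subsetneq X$ be an open set. Suppose that $\Omega$ admits the pointwise $p$-Hardy inequality, i.e. there exist constants $c_H>0$ and $L\ge1$ such that for all $u\in N_0^{1,p}(\Omega)$ $$|u(x)|\le c_H\,d_\Omega(x)\bigl(\mathcal{M}_{L d_\Omega(x)}g_u^p(x)\bigr)^{1/p}$$ holds at almost every $x\in\Omega$. Then $\Omega$ admits the $p$-Hardy inequality, that is, there exists $C>0$ such that $$\int_\Omega\frac{|u(x)|^p}{d_\Omega(x)^p}\,d\mu\le C\int_\Omega g_u(x)^p\,d\mu$$ for every $u\in N_0^{1,p}(\Omega)$.
   Context: $X=(X,d,\mu)$ is a complete metric space with a Borel regular outer measure $\mu$ such that $0<\mu(B)<\infty$ for all balls $B=B(x,r)=\{y:d(x,y)<r\}$; $tB=B(x,tr)$. $\mu$ is doubling: $\mu(2B)\le c_D\,\mu(B)$ for all balls $B$, with a constant $c_D\ge1$. For a ball $B$, $u_B=\frac1{\mu(B)}\int_B u\,d\mu$. A curve is a nonconstant, rectifiable, continuous mapping from a compact interval to $X$. The $p$-modulus of a curve family $\Gamma$ is $\inf\int_X\rho^p\,d\mu$ over Borel $\rho\ge0$ with $\int_\gamma\rho\,ds\ge1$ for all $\gamma\in\Gamma$. A measurable $g\ge0$ is a $p$-weak upper gradient of $u$ if, for all curves $\gamma$ (with endpoints $x,y$) outside a family of zero $p$-modulus, $|u(x)-u(y)|\le\int_\gamma g\,ds$ whenever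 $u(x),u(y)$ are both finite, and $\int_\gamma g\,ds=\infty$ otherwise. $g_u$ denotes a $p$-weak upper gradient of $u$; inequalities involving $g_u$ are meant for every $p$-weak upper gradient of $u$. $X$ supports a (weak) $(1,p)$-Poincaré inequality: there are $c_P>0$, $\tau\ge1$ such that for all balls $B$ of radius $r$, all locally integrable $u$ and all $p$-weak upper gradients $g_u$ of $u$, $\frac1{\mu(B)}\int_B|u-u_B|\,d\mu\le c_P\,r\bigl(\frac1{\mu(\tau B)}\int_{\tau B}g_u^p\,d\mu\bigr)^{1/p}$. $N^{1,p}(X)$ is the space of $u\in L^p(X)$ having a $p$-weak upper gradient in $L^p(X)$. $N_0^{1,p}(\Omega)=\{u|_\Omega:u\in N^{1,p}(X),\ u=0\text{ in }X\setminus\Omega\}$; functions in it are regarded as extended by zero to $X$. $d_\Omega(x)=d(x,X\setminus\Omega)$. $\mathcal{M}_R f(x)=\sup_{0<r\le R}\frac1{\mu(B(x,r))}\int_{B(x,r)}|f|\,d\mu$. *)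

theory Defs
  imports "HOL-Analysis.Analysis"
begin

text \<open>The ambient space is the universe of a type of class \<open>metric_space\<close>. Functions \<open>u\<close> are
  defined at every point and take values in the extended reals (\<open>ereal\<close>); densities and weak upper
  gradients take values in the extended half-line (\<open>ennreal\<close>).\<close>

definition eabs :: "ereal \<Rightarrow> ennreal" where
  "eabs x = e2ennreal \<bar>x\<bar>"

text \<open>Used only for exponents \<open>p > 0\<close>.\<close>
definition epowr :: "ennreal \<Rightarrow> real \<Rightarrow> ennreal" where
  "epowr x p = (if x = \<infinity> then \<infinity> else ennreal (enn2real x powr p))"

text \<open>A Borel regular outer measure: Borel sets are Caratheodory measurable, and every set has a
  Borel hull of the same measure.\<close>
definition borel_regular_outer_measure :: "('a::topological_space set \<Rightarrow> ennreal) \<Rightarrow> bool" where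
  "borel_regular_outer_measure \<mu> \<longleftrightarrow>
     outer_measure_space UNIV \<mu> \<and>
     sets borel \<subseteq> lambda_system UNIV UNIV \<mu> \<and>
     (\<forall>A. \<exists>B\<in>sets borel. A \<subseteq> B \<and> \<mu> B = \<mu> A)"

text \<open>The measure given by \<open>\<mu>\<close> on its Caratheodory measurable sets. All integrals, "almost
  everywhere" and "measurable" refer to it.\<close>
definition caratheodory :: "('a set \<Rightarrow> ennreal) \<Rightarrow> 'a measure" where
  "caratheodory \<mu> = measure_of UNIV (lambda_system UNIV UNIV \<mu>) \<mu>"

lemma caratheodory_measure_space:
  assumes "outer_measure_space UNIV \<mu>"
  shows "measure_space UNIV (lambda_system UNIV UNIV \<mu>) \<mu>"
  using sigma_algebra.caratheodory_lemma[of UNIV UNIV \<mu>] assms sigma_algebra_Pow[of UNIV] by simp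

lemma
  assumes "outer_measure_space UNIV \<mu>"
  shows space_caratheodory: "space (caratheodory \<mu>) = UNIV"
    and sets_caratheodory: "sets (caratheodory \<mu>) = lambda_system UNIV UNIV \<mu>"
    and emeasure_caratheodory:
      "A \<in> lambda_system UNIV UNIV \<mu> \<Longrightarrow> emeasure (caratheodory \<mu>) A = \<mu> A"
proof -
  have ms: "measure_space UNIV (lambda_system UNIV UNIV \<mu>) \<mu>"
    by (rule caratheodory_measure_space[OF assms])
  then have sa: "sigma_algebra UNIV (lambda_system UNIV UNIV \<mu>)"
    by (simp add: measure_space_def)
  show "space (caratheodory \<mu>) = UNIV"
    unfolding caratheodory_def by (simp add: space_measure_of_conv)
  show s: "sets (caratheodory \<mu>) = lambda_system UNIV UNIV \<mu>"
    unfolding caratheodory_def by (rule sigma_algebra.sets_measure_of_eq[OF sa])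
  show "emeasure (caratheodory \<mu>) A = \<mu> A" if "A \<in> lambda_system UNIV UNIV \<mu>"
    using ms that s
    by (intro emeasure_measure_of[OF caratheodory_def]) (auto simp: measure_space_def)
qed

text \<open>The condition on the measure of balls refers to the outer measure.\<close>
definition metric_measure_space :: "('a::metric_space set \<Rightarrow> ennreal) \<Rightarrow> bool" where
  "metric_measure_space \<mu> \<longleftrightarrow>
     borel_regular_outer_measure \<mu> \<and> (\<forall>x. \<forall>r>0. 0 < \<mu> (ball x r) \<and> \<mu> (ball x r) < \<infinity>)"

definition doubling :: "('a::metric_space set \<Rightarrow> ennreal) \<Rightarrow> bool" where
  "doubling \<mu> \<longleftrightarrow> (\<exists>c\<^sub>D\<ge>1. \<forall>x. \<forall>r>0. \<mu> (ball x (2 * r)) \<le> ennreal c\<^sub>D * \<mu> (ball x r))"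

text \<open>Length of \<open>\<gamma>\<close> restricted to \<open>[a, b]\<close>: supremum over all partitions.\<close>
definition curve_length :: "(real \<Rightarrow> 'a::metric_space) \<Rightarrow> real \<Rightarrow> real \<Rightarrow> ennreal" where
  "curve_length \<gamma> a b =
     Sup {\<Sum>i<n. ennreal (dist (\<gamma> (t i)) (\<gamma> (t (Suc i)))) | (n::nat) (t::nat \<Rightarrow> real).
            t 0 = a \<and> t n = b \<and> (\<forall>i<n. t i \<le> t (Suc i))}"

text \<open>The triple \<open>(\<gamma>, a, b)\<close> stands for the map \<open>\<gamma>\<close> restricted to \<open>[a, b]\<close>.\<close>
type_synonym 'a curve = "(real \<Rightarrow> 'a) \<times> real \<times> real"

definition curves :: "'a::metric_space curve set" where
  "curves = {(\<gamma>, a, b). a \<le> b \<and> continuous_on {a..b} \<gamma> \<and> curve_length \<gamma> a b < \<infinity> \<and>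
               \<not> \<gamma> constant_on {a..b}}"

text \<open>Parametrization by arc length, defined on \<open>[0, curve_length \<gamma> a b]\<close>. For a curve such a
  parameter \<open>t\<close> exists, and \<open>\<gamma> t\<close> does not depend on its choice.\<close>
definition arc_length_param :: "(real \<Rightarrow> 'a::metric_space) \<Rightarrow> real \<Rightarrow> real \<Rightarrow> real \<Rightarrow> 'a" where
  "arc_length_param \<gamma> a b s = \<gamma> (SOME t. t \<in> {a..b} \<and> curve_length \<gamma> a t = ennreal s)"

text \<open>If \<open>g\<close> is measurable, but not Borel, then the integrand may fail to be Lebesgue measurable for
  some curves, and \<open>nn_integral\<close> is then a lower integral. This happens only for a curve family of
  zero modulus, so it does not affect the notion of weak upper gradient.\<close>
definition curve_integral :: "('a::metric_space \<Rightarrow> ennreal) \<Rightarrow> 'a curve \<Rightarrow> ennreal" where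
  "curve_integral g = (\<lambda>(\<gamma>, a, b).
     \<integral>\<^sup>+s\<in>{0..enn2real (curve_length \<gamma> a b)}. g (arc_length_param \<gamma> a b s) \<partial>lebesgue)"

definition modulus :: "'a::metric_space measure \<Rightarrow> real \<Rightarrow> 'a curve set \<Rightarrow> ennreal" where
  "modulus M p \<Gamma> =
     Inf {\<integral>\<^sup>+x. epowr (\<rho> x) p \<partial>M | \<rho>.
            \<rho> \<in> borel_measurable borel \<and> (\<forall>c\<in>\<Gamma>. curve_integral \<rho> c \<ge> 1)}"

definition weak_upper_gradient ::
  "'a::metric_space measure \<Rightarrow> real \<Rightarrow> ('a \<Rightarrow> ereal) \<Rightarrow> ('a \<Rightarrow> ennreal) \<Rightarrow> bool" where
  "weak_upper_gradient M p u g \<longleftrightarrow>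
     g \<in> borel_measurable M \<and>
     (\<exists>\<Gamma> \<subseteq> curves. modulus M p \<Gamma> = 0 \<and>
        (\<forall>(\<gamma>, a, b) \<in> curves - \<Gamma>.
           if \<bar>u (\<gamma> a)\<bar> \<noteq> \<infinity> \<and> \<bar>u (\<gamma> b)\<bar> \<noteq> \<infinity>
           then eabs (u (\<gamma> a) - u (\<gamma> b)) \<le> curve_integral g (\<gamma>, a, b)
           else curve_integral g (\<gamma>, a, b) = \<infinity>))"

definition locally_integrable :: "'a::metric_space measure \<Rightarrow> ('a \<Rightarrow> ereal) \<Rightarrow> bool" where
  "locally_integrable M u \<longleftrightarrow>
     u \<in> borel_measurable M \<and> (\<forall>x. \<exists>r>0. (\<integral>\<^sup>+y\<in>ball x r. eabs (u y) \<partial>M) < \<infinity>)"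

text \<open>An integrable \<open>u\<close> is finite almost everywhere, so passing to \<open>real_of_ereal\<close> does not change
  its integral.\<close>
definition mean_value :: "'a measure \<Rightarrow> 'a set \<Rightarrow> ('a \<Rightarrow> ereal) \<Rightarrow> real" where
  "mean_value M B u = (LINT x:B|M. real_of_ereal (u x)) / measure M B"

definition supports_poincare :: "'a::metric_space measure \<Rightarrow> real \<Rightarrow> bool" where
  "supports_poincare M p \<longleftrightarrow>
     (\<exists>c\<^sub>P>0. \<exists>\<tau>\<ge>1. \<forall>x. \<forall>r>0. \<forall>u g.
        locally_integrable M u \<and> weak_upper_gradient M p u g \<longrightarrow>
        (\<integral>\<^sup>+y\<in>ball x r. eabs (u y - ereal (mean_value M (ball x r) u)) \<partial>M)
            / emeasure M (ball x r)
        \<le> ennreal (c\<^sub>P * r) *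
          epowr ((\<integral>\<^sup>+y\<in>ball x (\<tau> * r). epowr (g y) p \<partial>M) / emeasure M (ball x (\<tau> * r))) (1 / p))"

definition Lp_space :: "'a measure \<Rightarrow> real \<Rightarrow> ('a \<Rightarrow> ereal) set" where
  "Lp_space M p = {u \<in> borel_measurable M. (\<integral>\<^sup>+x. epowr (eabs (u x)) p \<partial>M) < \<infinity>}"

definition newtonian :: "'a::metric_space measure \<Rightarrow> real \<Rightarrow> ('a \<Rightarrow> ereal) set" where
  "newtonian M p =
     {u \<in> Lp_space M p. \<exists>g. weak_upper_gradient M p u g \<and> (\<integral>\<^sup>+x. epowr (g x) p \<partial>M) < \<infinity>}"

text \<open>A function on \<open>\<Omega>\<close> with zero boundary values is represented by its extension by zero to the
  whole space.\<close>
definition newtonian0 :: "'a::metric_space measure \<Rightarrow> real \<Rightarrow> 'a set \<Rightarrow> ('a \<Rightarrow> ereal) set" where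
  "newtonian0 M p \<Omega> = {u \<in> newtonian M p. \<forall>x. x \<notin> \<Omega> \<longrightarrow> u x = 0}"

definition dist_compl :: "'a::metric_space set \<Rightarrow> 'a \<Rightarrow> real" where
  "dist_compl \<Omega> x = infdist x (- \<Omega>)"

definition restricted_maximal ::
  "'a::metric_space measure \<Rightarrow> real \<Rightarrow> ('a \<Rightarrow> ennreal) \<Rightarrow> 'a \<Rightarrow> ennreal" where
  "restricted_maximal M R f x =
     (SUP r\<in>{0<..R}. (\<integral>\<^sup>+y\<in>ball x r. f y \<partial>M) / emeasure M (ball x r))"

definition pointwise_hardy :: "'a::metric_space measure \<Rightarrow> real \<Rightarrow> 'a set \<Rightarrow> bool" where
  "pointwise_hardy M p \<Omega> \<longleftrightarrow>
     (\<exists>c\<^sub>H>0. \<exists>L\<ge>1. \<forall>u\<in>newtonian0 M p \<Omega>. \<forall>g. weak_upper_gradient M p u g \<longrightarrow>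
        (AE x in M. x \<in> \<Omega> \<longrightarrow>
           eabs (u x) \<le> ennreal (c\<^sub>H * dist_compl \<Omega> x) *
             epowr (restricted_maximal M (L * dist_compl \<Omega> x) (\<lambda>y. epowr (g y) p) x) (1 / p)))"

definition hardy :: "'a::metric_space measure \<Rightarrow> real \<Rightarrow> 'a set \<Rightarrow> bool" where
  "hardy M p \<Omega> \<longleftrightarrow>
     (\<exists>C>0. \<forall>u\<in>newtonian0 M p \<Omega>. \<forall>g. weak_upper_gradient M p u g \<longrightarrow>
        (\<integral>\<^sup>+x\<in>\<Omega>. epowr (eabs (u x)) p / ennreal (dist_compl \<Omega> x powr p) \<partial>M)
        \<le> ennreal C * (\<integral>\<^sup>+x\<in>\<Omega>. epowr (g x) p \<partial>M))"

end

theory Submission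
  imports Defs
begin

text \<open>The weak type estimate for the maximal function turns the pointwise inequality into a weak type
  estimate on each layer \<open>{t / 2 \<le> d < t}\<close>, with \<open>d\<close> the distance to the complement. Applied to the
  truncations of \<open>u\<close> to the dyadic bands \<open>{2^k < u < 2^(k+1)}\<close>, which carry disjoint parts of the
  gradient, it improves to a strong type estimate (Maz'ya). Summing it over the layers naively loses
  a logarithm, since a layer sees the gradient everywhere below it. Therefore \<open>u\<close> is cut off \<open>N\<close>
  layers further down by a function with gradient at most \<open>2 / (N d)\<close>. This leaves
  \<open>X \<le> C N \<integral> g^p + C N^(1-p) X\<close> for the Hardy integral \<open>X\<close> over finitely many layers, and for
  large \<open>N\<close> the last term is absorbed because \<open>p > 1\<close> (Wannebo). The cutoff enters through a minimum,
  so only truncations of weak upper gradients are needed and no product rule.\<close>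

section \<open>Lower integrals and the length of curves\<close>

text \<open>Raising the pointwise inequality to the power \<open>p\<close> leaves the maximal
  function of \<open>g^p\<close>, and \<open>g^p\<close> is merely integrable. The maximal operator
  is not bounded on integrable functions, so integrating directly fails exactly at this endpoint.
  The way out is that the hypothesis concerns every admissible function: it may be applied to
  functions built from \<open>u\<close>, one for each dyadic band and each layer. In the error term,
  \<open>N^(-p)\<close> is the \<open>p\<close>-th power of the gradient of the cutoff, and the
  remaining factor \<open>N\<close> counts how many layers use a given layer for their descent. A
  finite range of layers is needed because absorption requires \<open>X\<close> to be finite
  beforehand. A second obstacle shapes the preliminaries. Weak upper gradients are only measurable,
  and functions may take infinite values. A curve integral can then be a lower integral, which is
  not additive. The calculus of upper gradients is therefore based on monotonicity, superadditivity
  and multiplication by constants in one direction, all of which survive for lower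
  integrals.\<close>

lemma ennreal_SUP_add_SUP:
  fixes f :: "'a \<Rightarrow> ennreal" and g :: "'b \<Rightarrow> ennreal"
  assumes "I \<noteq> {}" "J \<noteq> {}"
  shows "(SUP i\<in>I. f i) + (SUP j\<in>J. g j) = (SUP i\<in>I. SUP j\<in>J. f i + g j)"
proof -
  have "(SUP i\<in>I. f i) + (SUP j\<in>J. g j) = (SUP i\<in>I. f i + (SUP j\<in>J. g j))"
    using ennreal_SUP_add_left[OF assms(1), of f "SUP j\<in>J. g j"] by (rule sym)
  also have "\<dots> = (SUP i\<in>I. SUP j\<in>J. f i + g j)"
    by (intro SUP_cong refl ennreal_SUP_add_right[OF assms(2)])
  finally show ?thesis .
qed

text \<open>A simple function below \<open>f\<close> plus one below \<open>g\<close> is a simple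
  function below the sum, so measurability does not enter. This is the direction in which upper
  gradient inequalities are added.\<close>

lemma nn_integral_superadd:
  fixes f g :: "'a \<Rightarrow> ennreal"
  shows "(\<integral>\<^sup>+x. f x \<partial>M) + (\<integral>\<^sup>+x. g x \<partial>M) \<le> (\<integral>\<^sup>+x. f x + g x \<partial>M)"
proof -
  let ?S = "\<lambda>f :: 'a \<Rightarrow> ennreal. {s. simple_function M s \<and> s \<le> f}"
  have ne: "?S h \<noteq> {}" for h
  proof -
    have "(\<lambda>_. 0) \<in> ?S h" by (auto simp: le_fun_def)
    then show ?thesis by blast
  qed
  have st: "integral\<^sup>S M s + integral\<^sup>S M t \<le> (\<integral>\<^sup>+x. f x + g x \<partial>M)"
    if "s \<in> ?S f" "t \<in> ?S g" for s t
  proof -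
    have "integral\<^sup>S M s + integral\<^sup>S M t = integral\<^sup>S M (\<lambda>x. s x + t x)"
      using that by (simp add: simple_integral_add)
    also have "\<dots> \<le> (\<integral>\<^sup>+x. f x + g x \<partial>M)"
      unfolding nn_integral_def using that
      by (intro SUP_upper) (auto simp: le_fun_def intro!: simple_function_add add_mono)
    finally show ?thesis .
  qed
  have "integral\<^sup>N M f + integral\<^sup>N M g = (SUP s\<in>?S f. SUP t\<in>?S g. integral\<^sup>S M s + integral\<^sup>S M t)"
    unfolding nn_integral_def
    by (rule ennreal_SUP_add_SUP[OF ne ne])
  also have "\<dots> \<le> (\<integral>\<^sup>+x. f x + g x \<partial>M)"
    using st by (intro SUP_least) blast
  finally show ?thesis .
qed

text \<open>Checked on simple functions, hence valid for lower integrals; with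
  \<open>nn_integral_superadd\<close> it gives nonnegative linear combinations of upper
  gradients.\<close>

lemma nn_integral_cmult_ge:
  "ennreal c * (\<integral>\<^sup>+x. f x \<partial>M) \<le> (\<integral>\<^sup>+x. ennreal c * f x \<partial>M)"
proof -
  have "ennreal c * integral\<^sup>S M s \<le> (\<integral>\<^sup>+x. ennreal c * f x \<partial>M)"
    if "simple_function M s" "s \<le> f" for s
  proof -
    have "ennreal c * integral\<^sup>S M s = integral\<^sup>S M (\<lambda>x. ennreal c * s x)"
      using that by simp
    also have "\<dots> \<le> (\<integral>\<^sup>+x. ennreal c * f x \<partial>M)"
      unfolding nn_integral_def using that
      by (intro SUP_upper) (auto simp: le_fun_def intro!: mult_left_mono)
    finally show ?thesis .
  qed
  then show ?thesis
    unfolding nn_integral_def[of M f] SUP_mult_left_ennreal by (intro SUP_least) auto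
qed

lemma set_nn_integral_superadd:
  assumes "A \<inter> B = {}" "A \<union> B \<subseteq> C"
  shows "(\<integral>\<^sup>+x\<in>A. f x \<partial>M) + (\<integral>\<^sup>+x\<in>B. f x \<partial>M) \<le> (\<integral>\<^sup>+x\<in>C. f x \<partial>M)"
proof -
  have "(\<integral>\<^sup>+x\<in>A. f x \<partial>M) + (\<integral>\<^sup>+x\<in>B. f x \<partial>M)
      \<le> (\<integral>\<^sup>+x. f x * indicator A x + f x * indicator B x \<partial>M)"
    by (rule nn_integral_superadd)
  also have "\<dots> \<le> (\<integral>\<^sup>+x\<in>C. f x \<partial>M)"
    using assms by (intro nn_integral_mono) (auto simp: indicator_def)
  finally show ?thesis .
qed

text \<open>Absolute continuity; the truncation level is the maximum of a simple function below \<open>f\<close>, so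
  \<open>f\<close> itself need not be measurable.\<close>
lemma set_nn_integral_absolutely_continuous:
  fixes f :: "'a \<Rightarrow> ennreal" and e :: real
  assumes fin: "(\<integral>\<^sup>+x\<in>C. f x \<partial>M) < \<infinity>" and "0 < e" and C: "C \<in> sets M"
  obtains K where "K \<ge> 0" "\<And>A. A \<in> sets M \<Longrightarrow> A \<subseteq> C \<Longrightarrow>
     (\<integral>\<^sup>+x\<in>A. f x \<partial>M) \<le> ennreal K * emeasure M A + ennreal e"
proof -
  let ?F = "\<lambda>x. f x * indicator C x"
  let ?I = "integral\<^sup>N M ?F"
  have "\<exists>s. simple_function M s \<and> s \<le> ?F \<and> (\<forall>x. s x < top) \<and> ?I \<le> integral\<^sup>S M s + ennreal e"
  proof (cases "?I = 0")
    case True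
    then show ?thesis by (intro exI[of _ "\<lambda>_. 0"]) (auto simp: le_fun_def)
  next
    case False
    then have "?I - ennreal e < ?I"
      using fin \<open>0 < e\<close> by (intro ennreal_between) (auto simp: ennreal_zero_less_divide zero_less_iff_neq_zero)
    then obtain s where "simple_function M s" "s \<le> ?F" "\<forall>x. s x < top" "?I - ennreal e < integral\<^sup>S M s"
      unfolding nn_integral_def_finite[of M ?F] by (auto simp: less_SUP_iff)
    then show ?thesis
      by (intro exI[of _ s]) (auto simp: ennreal_minus_le_iff add.commute dest!: less_imp_le)
  qed
  then obtain s where s: "simple_function M s" "s \<le> ?F" "\<And>x. s x < top"
    and I: "?I \<le> integral\<^sup>S M s + ennreal e" by blast
  define K where "K = Max (insert 0 (enn2real ` s ` space M))"
  have finS: "finite (insert 0 (enn2real ` s ` space M))" using s(1) by (simp add: simple_functionD)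
  have sK: "s x \<le> ennreal K" if "x \<in> space M" for x
  proof -
    have "enn2real (s x) \<le> K" unfolding K_def using that finS by (intro Max_ge) auto
    then show ?thesis using s(3)[of x] by (metis ennreal_enn2real ennreal_leI)
  qed
  have K0: "K \<ge> 0" unfolding K_def using finS by (intro Max_ge) auto
  have s0: "s x = 0" if "x \<notin> C" for x using le_funD[OF s(2), of x] that by simp
  have sf: "s x \<le> f x" for x
    using le_funD[OF s(2), of x] by (cases "x \<in> C") auto
  have ms: "s \<in> borel_measurable M" using s(1) by (rule borel_measurable_simple_function)
  show ?thesis
  proof (rule that[OF K0])
    fix A assume A: "A \<in> sets M" "A \<subseteq> C"
    let ?R = "\<integral>\<^sup>+x\<in>(C - A). f x \<partial>M"
    have R: "?R < \<infinity>"
      using fin by (rule le_less_trans[rotated]) (auto intro!: nn_integral_mono simp: indicator_def)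
    \<comment> \<open>Superadditivity replaces the additivity that lower integrals lack. The
      remainder over \<open>C - A\<close> reappears on the right and cancels because it is
      finite.\<close>
    have "(\<integral>\<^sup>+x\<in>A. f x \<partial>M) + ?R \<le> ?I"
      using A by (intro set_nn_integral_superadd) auto
    also have "\<dots> \<le> (\<integral>\<^sup>+x. s x \<partial>M) + ennreal e"
      using I s(1) by (simp add: nn_integral_eq_simple_integral)
    also have "(\<integral>\<^sup>+x. s x \<partial>M) \<le> (\<integral>\<^sup>+x. s x * indicator A x + s x * indicator (C - A) x \<partial>M)"
      using s0 A by (intro nn_integral_mono) (auto simp: indicator_def)
    also have "\<dots> = (\<integral>\<^sup>+x\<in>A. s x \<partial>M) + (\<integral>\<^sup>+x\<in>C - A. s x \<partial>M)"
      using A C ms by (intro nn_integral_add) auto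
    also have "(\<integral>\<^sup>+x\<in>A. s x \<partial>M) \<le> (\<integral>\<^sup>+x\<in>A. ennreal K \<partial>M)"
      using sK by (intro nn_integral_mono) (auto simp: indicator_def)
    also have "\<dots> = ennreal K * emeasure M A" using A by (simp add: nn_integral_cmult_indicator)
    also have "(\<integral>\<^sup>+x\<in>C - A. s x \<partial>M) \<le> ?R"
      using sf by (intro nn_integral_mono) (auto simp: indicator_def)
    finally have "(\<integral>\<^sup>+x\<in>A. f x \<partial>M) + ?R \<le> (ennreal K * emeasure M A + ennreal e) + ?R"
      by (simp add: ac_simps add_mono)
    then show "(\<integral>\<^sup>+x\<in>A. f x \<partial>M) \<le> ennreal K * emeasure M A + ennreal e"
      using R by (auto simp: ennreal_add_left_cancel_le add.commute[of _ ?R])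
  qed
qed

text \<open>The affine substitution rule asks for a measurable integrand, so it is applied to the
  simple functions below the shifted \<open>f\<close>. Shifting back then yields equality.\<close>

lemma nn_integral_lebesgue_shift_le:
  fixes f :: "real \<Rightarrow> ennreal"
  shows "(\<integral>\<^sup>+x. f (c + x) \<partial>lebesgue) \<le> (\<integral>\<^sup>+x. f x \<partial>lebesgue)"
  unfolding nn_integral_def[of lebesgue "\<lambda>x. f (c + x)"]
proof (rule SUP_least)
  fix s :: "real \<Rightarrow> ennreal"
  assume "s \<in> {s. simple_function lebesgue s \<and> s \<le> (\<lambda>x. f (c + x))}"
  then have s: "simple_function lebesgue s" and le: "\<And>x. s x \<le> f (c + x)" by (auto simp: le_fun_def)
  have m: "s \<in> borel_measurable lebesgue" using s by (rule borel_measurable_simple_function)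
  have "integral\<^sup>S lebesgue s = (\<integral>\<^sup>+x. s x \<partial>lebesgue)"
    using s by (simp add: nn_integral_eq_simple_integral)
  also have "\<dots> = (\<integral>\<^sup>+x. s (-c + x) \<partial>lebesgue)"
    using nn_integral_real_affine_lebesgue[OF m, of 1 "-c"] by simp
  also have "\<dots> \<le> (\<integral>\<^sup>+x. f x \<partial>lebesgue)"
    using le[of "- c + _"] by (intro nn_integral_mono) simp
  finally show "integral\<^sup>S lebesgue s \<le> (\<integral>\<^sup>+x. f x \<partial>lebesgue)" .
qed

lemma nn_integral_lebesgue_shift:
  fixes f :: "real \<Rightarrow> ennreal"
  shows "(\<integral>\<^sup>+x. f (c + x) \<partial>lebesgue) = (\<integral>\<^sup>+x. f x \<partial>lebesgue)"
  using nn_integral_lebesgue_shift_le[of f c] nn_integral_lebesgue_shift_le[of "\<lambda>x. f (c + x)" "-c"]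
  by simp

section \<open>Partitions and the length of a curve\<close>

definition partition_sum :: "(real \<Rightarrow> 'a::metric_space) \<Rightarrow> nat \<Rightarrow> (nat \<Rightarrow> real) \<Rightarrow> ennreal" where
  "partition_sum \<gamma> n t = (\<Sum>i<n. ennreal (dist (\<gamma> (t i)) (\<gamma> (t (Suc i)))))"

definition is_partition :: "real \<Rightarrow> real \<Rightarrow> nat \<Rightarrow> (nat \<Rightarrow> real) \<Rightarrow> bool" where
  "is_partition a b n t \<longleftrightarrow> t 0 = a \<and> t n = b \<and> (\<forall>i<n. t i \<le> t (Suc i))"

lemma curve_length_eq_SUP:
  "curve_length \<gamma> a b = (SUP (n, t)\<in>{(n, t). is_partition a b n t}. partition_sum \<gamma> n t)"
  unfolding curve_length_def is_partition_def partition_sum_def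
  by (rule arg_cong[where f = Sup]) (auto simp: image_def)

lemma partition_sum_le_curve_length:
  "is_partition a b n t \<Longrightarrow> partition_sum \<gamma> n t \<le> curve_length \<gamma> a b"
  unfolding curve_length_eq_SUP by (rule SUP_upper2[of "(n, t)"]) auto

lemma dist_le_curve_length:
  assumes "a \<le> b"
  shows "ennreal (dist (\<gamma> a) (\<gamma> b)) \<le> curve_length \<gamma> a b"
proof -
  have "is_partition a b 1 (\<lambda>i. if i = 0 then a else b)"
    using assms by (auto simp: is_partition_def)
  from partition_sum_le_curve_length[OF this, of \<gamma>] show ?thesis by (simp add: partition_sum_def)
qed

text \<open>Points outside \<open>[c, d]\<close> collapse to its ends. Partitions may repeat points,
  so their number is unchanged and sums over different subintervals can be compared index by
  index.\<close>

lemma is_partition_clamp: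
  assumes "is_partition a b n t" "a \<le> c" "c \<le> d" "d \<le> b"
  shows "is_partition c d n (\<lambda>i. max c (min d (t i)))"
  using assms unfolding is_partition_def by (auto intro!: max.mono min.mono)

lemma partition_mono:
  assumes "is_partition a b n t" "i \<le> j" "j \<le> n"
  shows "t i \<le> t j"
  using assms(2,3)
proof (induction j rule: dec_induct)
  case (step m)
  then show ?case using assms(1) by (auto simp: is_partition_def intro: order_trans)
qed simp

lemma partition_in:
  assumes "is_partition a b n t" "i \<le> n"
  shows "t i \<in> {a..b}"
  using partition_mono[OF assms(1), of 0 i] partition_mono[OF assms(1), of i n] assms
  by (auto simp: is_partition_def)

text \<open>Term by term: an interval on one side of \<open>c\<close> contributes to only one of the
  clamped sums, and an interval containing \<open>c\<close> is split there by the triangle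
  inequality.\<close>

lemma partition_sum_split:
  assumes "is_partition a b n t" "a \<le> c" "c \<le> b"
  shows "partition_sum \<gamma> n t
    \<le> partition_sum \<gamma> n (\<lambda>i. max a (min c (t i))) + partition_sum \<gamma> n (\<lambda>i. max c (min b (t i)))"
  unfolding partition_sum_def sum.distrib[symmetric]
proof (rule sum_mono)
  fix i assume "i \<in> {..<n}"
  then have i: "i < n" by simp
  have 1: "a \<le> t i" "t i \<le> t (Suc i)" "t (Suc i) \<le> b"
    using partition_in[OF assms(1), of i] partition_in[OF assms(1), of "Suc i"] assms(1) i
    by (auto simp: is_partition_def)
  let ?d = "\<lambda>s t. dist (\<gamma> s) (\<gamma> t)"
  have eq: "max a (min c (t i)) = min c (t i)" "max a (min c (t (Suc i))) = min c (t (Suc i))"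
    "max c (min b (t i)) = max c (t i)" "max c (min b (t (Suc i))) = max c (t (Suc i))"
    using 1 assms(2,3) by auto
  have "?d (t i) (t (Suc i)) \<le> ?d (max a (min c (t i))) (max a (min c (t (Suc i))))
     + ?d (max c (min b (t i))) (max c (min b (t (Suc i))))"
    unfolding eq
  proof -
    consider "t (Suc i) \<le> c" | "c \<le> t i" | "t i \<le> c" "c \<le> t (Suc i)" by linarith
    then show "?d (t i) (t (Suc i)) \<le> ?d (min c (t i)) (min c (t (Suc i)))
      + ?d (max c (t i)) (max c (t (Suc i)))"
    proof cases
      case 1
      then show ?thesis using \<open>t i \<le> t (Suc i)\<close> by (simp add: min.absorb2)
    next
      case 2
      then show ?thesis using \<open>t i \<le> t (Suc i)\<close> by (simp add: max.absorb2)
    next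
      case 3
      then show ?thesis using dist_triangle[of "\<gamma> (t i)" "\<gamma> (t (Suc i))" "\<gamma> c"]
        by (simp add: min.absorb2 min.absorb1 max.absorb1 max.absorb2)
    qed
  qed
  from ennreal_leI[OF this] show "ennreal (?d (t i) (t (Suc i)))
    \<le> ennreal (?d (max a (min c (t i))) (max a (min c (t (Suc i)))))
     + ennreal (?d (max c (min b (t i))) (max c (min b (t (Suc i)))))"
    by (simp only: ennreal_plus[OF zero_le_dist zero_le_dist])
qed

lemma is_partition_join:
  assumes "is_partition a c n t" "is_partition c b m s"
  defines "r \<equiv> \<lambda>i. if i \<le> n then t i else s (i - n)"
  shows "is_partition a b (n + m) r"
    and "partition_sum \<gamma> (n + m) r = partition_sum \<gamma> n t + partition_sum \<gamma> m s"
proof -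
  have r: "r (n + i) = s i" for i
    using assms by (auto simp: r_def is_partition_def)
  show "is_partition a b (n + m) r"
    unfolding is_partition_def
  proof (intro conjI allI impI)
    show "r 0 = a" using assms(1) by (simp add: r_def is_partition_def)
    show "r (n + m) = b" using r[of m] assms(2) by (simp add: is_partition_def)
    fix i assume i: "i < n + m"
    show "r i \<le> r (Suc i)"
    proof (cases "i < n")
      case True
      then show ?thesis using assms(1) by (simp add: r_def is_partition_def)
    next
      case False
      then obtain j where "i = n + j" by (metis add_diff_inverse_nat)
      then show ?thesis using r[of j] r[of "Suc j"] i assms(2) by (simp add: is_partition_def)
    qed
  qed
  have "(\<Sum>i<n + m. ennreal (dist (\<gamma> (r i)) (\<gamma> (r (Suc i)))))
      = (\<Sum>i<n. ennreal (dist (\<gamma> (r i)) (\<gamma> (r (Suc i)))))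
      + (\<Sum>i<m. ennreal (dist (\<gamma> (r (n + i))) (\<gamma> (r (Suc (n + i))))))"
    by (induction m) (auto simp: ac_simps)
  also have "\<dots> = partition_sum \<gamma> n t + partition_sum \<gamma> m s"
    using r[of "Suc _"] unfolding partition_sum_def r by (simp add: r_def)
  finally show "partition_sum \<gamma> (n + m) r = partition_sum \<gamma> n t + partition_sum \<gamma> m s"
    unfolding partition_sum_def .
qed

text \<open>Clamping a partition of the whole interval at \<open>c\<close> gives one inequality,
  joining partitions of the two halves the other.\<close>

lemma curve_length_add:
  assumes "a \<le> c" "c \<le> b"
  shows "curve_length \<gamma> a b = curve_length \<gamma> a c + curve_length \<gamma> c b"
proof (rule antisym)
  show "curve_length \<gamma> a b \<le> curve_length \<gamma> a c + curve_length \<gamma> c b"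
    unfolding curve_length_eq_SUP[of \<gamma> a b]
  proof (intro SUP_least, clarify)
    fix n t assume t: "is_partition a b n t"
    have "partition_sum \<gamma> n t
      \<le> partition_sum \<gamma> n (\<lambda>i. max a (min c (t i))) + partition_sum \<gamma> n (\<lambda>i. max c (min b (t i)))"
      using t assms by (rule partition_sum_split)
    also have "\<dots> \<le> curve_length \<gamma> a c + curve_length \<gamma> c b"
      using t assms by (intro add_mono partition_sum_le_curve_length is_partition_clamp) auto
    finally show "partition_sum \<gamma> n t \<le> curve_length \<gamma> a c + curve_length \<gamma> c b" .
  qed
  have ne: "{(n, t). is_partition a b n t} \<noteq> {}" if "a \<le> b" for a b
  proof -
    have "is_partition a b 1 (\<lambda>i. if i = 0 then a else b)"
      using that by (auto simp: is_partition_def)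
    then show ?thesis by blast
  qed
  have "curve_length \<gamma> a c + curve_length \<gamma> c b
     = (SUP x\<in>{(n, t). is_partition a c n t}. SUP y\<in>{(n, t). is_partition c b n t}.
          (case x of (n, t) \<Rightarrow> partition_sum \<gamma> n t) + (case y of (n, t) \<Rightarrow> partition_sum \<gamma> n t))"
    unfolding curve_length_eq_SUP[of \<gamma> a c] curve_length_eq_SUP[of \<gamma> c b]
    by (rule ennreal_SUP_add_SUP[OF ne[OF assms(1)] ne[OF assms(2)]])
  also have "\<dots> \<le> curve_length \<gamma> a b"
  proof (intro SUP_least, clarify)
    fix n t m s assume p: "is_partition a c n t" "is_partition c b m s"
    show "partition_sum \<gamma> n t + partition_sum \<gamma> m s \<le> curve_length \<gamma> a b"
      using partition_sum_le_curve_length[OF is_partition_join(1)[OF p], of \<gamma>]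
      unfolding is_partition_join(2)[OF p] .
  qed
  finally show "curve_length \<gamma> a c + curve_length \<gamma> c b \<le> curve_length \<gamma> a b" .
qed

lemma curve_length_refl [simp]: "curve_length \<gamma> a a = 0"
proof -
  have "partition_sum \<gamma> n t = 0" if "is_partition a a n t" for n t
    using partition_in[OF that] by (auto simp: partition_sum_def)
  then show ?thesis by (auto simp: curve_length_eq_SUP intro!: antisym SUP_least)
qed

lemma curve_length_mono:
  assumes "a \<le> s" "s \<le> t" "t \<le> b"
  shows "curve_length \<gamma> s t \<le> curve_length \<gamma> a b"
  using curve_length_add[of a s b \<gamma>] curve_length_add[of s t b \<gamma>] assms by simp

text \<open>Take a partition whose sum misses the length by at most \<open>e / 2\<close>. The defect
  on any subarc is no larger, and on a short subarc the clamped sum consists of a fixed number of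
  terms that are small by uniform continuity.\<close>

lemma curve_length_small:
  assumes cont: "continuous_on {a..b} \<gamma>" and fin: "curve_length \<gamma> a b < \<infinity>" and "a \<le> b" and "0 < e"
  obtains d where "d > 0"
    "\<And>s t. a \<le> s \<Longrightarrow> s \<le> t \<Longrightarrow> t \<le> b \<Longrightarrow> t - s < d \<Longrightarrow> curve_length \<gamma> s t \<le> ennreal e"
proof -
  have "\<exists>n t. is_partition a b n t \<and> curve_length \<gamma> a b \<le> partition_sum \<gamma> n t + ennreal (e / 2)"
  proof (cases "curve_length \<gamma> a b = 0")
    case True
    then show ?thesis using \<open>a \<le> b\<close>
      by (intro exI[of _ 1] exI[of _ "\<lambda>i. if i = 0 then a else b"]) (auto simp: is_partition_def)
  next
    case False
    then have "curve_length \<gamma> a b - ennreal (e / 2) < curve_length \<gamma> a b"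
      using fin \<open>0 < e\<close> by (intro ennreal_between) (auto simp: zero_less_iff_neq_zero)
    then obtain n t where "is_partition a b n t" "curve_length \<gamma> a b - ennreal (e / 2) < partition_sum \<gamma> n t"
      by (subst (asm) (2) curve_length_eq_SUP) (auto simp: less_SUP_iff)
    then show ?thesis
      by (intro exI[of _ n] exI[of _ t]) (auto simp: ennreal_minus_le_iff add.commute dest!: less_imp_le)
  qed
  then obtain n p where p: "is_partition a b n p"
    and L: "curve_length \<gamma> a b \<le> partition_sum \<gamma> n p + ennreal (e / 2)" by blast
  have "uniformly_continuous_on {a..b} \<gamma>" using cont by (intro compact_uniformly_continuous) auto
  \<comment> \<open>The denominator uses \<open>n + 1\<close> because \<open>n\<close> may be
    \<open>0\<close>; the \<open>n\<close> terms still add up to at most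
    \<open>e / 2\<close>.\<close>
  moreover have "e / (2 * (n + 1)) > 0" using \<open>0 < e\<close> by simp
  ultimately obtain d where d: "d > 0" and
    small: "\<And>x y. x \<in> {a..b} \<Longrightarrow> y \<in> {a..b} \<Longrightarrow> dist y x < d \<Longrightarrow> dist (\<gamma> y) (\<gamma> x) < e / (2 * (n + 1))"
    unfolding uniformly_continuous_on_def by metis
  show ?thesis
  proof (rule that[OF d])
    fix s t assume st: "a \<le> s" "s \<le> t" "t \<le> b" "t - s < d"
    define q where "q = (\<lambda>i. max s (min t (p i)))"
    define l where "l = (\<lambda>i. max a (min s (p i)))"
    define m where "m = (\<lambda>i. max s (min b (p i)))"
    define r where "r = (\<lambda>i. max t (min b (p i)))"
    have parts: "is_partition s t n q" "is_partition a s n l" "is_partition s b n m" "is_partition t b n r"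
      unfolding q_def l_def m_def r_def using p st by (auto intro!: is_partition_clamp)
    \<comment> \<open>The clamping is done in two stages, first at \<open>s\<close> and then at
      \<open>t\<close>; the second stage agrees with clamping \<open>p\<close> directly.\<close>
    have q': "(\<lambda>i. max s (min t (m i))) = q" and r': "(\<lambda>i. max t (min b (m i))) = r"
      using st by (auto simp: fun_eq_iff m_def q_def r_def)
    have "curve_length \<gamma> a s + (curve_length \<gamma> s t + curve_length \<gamma> t b) = curve_length \<gamma> a b"
      using curve_length_add[of a s b \<gamma>] curve_length_add[of s t b \<gamma>] st by simp
    also have "\<dots> \<le> partition_sum \<gamma> n p + ennreal (e / 2)" by (rule L)
    also have "partition_sum \<gamma> n p \<le> partition_sum \<gamma> n l + partition_sum \<gamma> n m"
      unfolding l_def m_def using p st by (intro partition_sum_split) auto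
    also have "partition_sum \<gamma> n m \<le> partition_sum \<gamma> n q + partition_sum \<gamma> n r"
      using partition_sum_split[OF parts(3) st(2,3), of \<gamma>] unfolding q' r' .
    also have "partition_sum \<gamma> n l \<le> curve_length \<gamma> a s"
      by (intro partition_sum_le_curve_length parts)
    also have "partition_sum \<gamma> n r \<le> curve_length \<gamma> t b"
      by (intro partition_sum_le_curve_length parts)
    finally have *: "(curve_length \<gamma> a s + curve_length \<gamma> t b) + curve_length \<gamma> s t
        \<le> (curve_length \<gamma> a s + curve_length \<gamma> t b) + (partition_sum \<gamma> n q + ennreal (e / 2))"
      by (simp add: ac_simps add_mono)
    \<comment> \<open>The lengths of the two outer arcs stand on both sides; being finite, they
      cancel.\<close>
    have "curve_length \<gamma> a s + curve_length \<gamma> t b < \<infinity>"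
      using curve_length_mono[of a a s b \<gamma>] curve_length_mono[of a t b b \<gamma>] st fin
      by (auto intro: le_less_trans)
    then have "curve_length \<gamma> s t \<le> partition_sum \<gamma> n q + ennreal (e / 2)"
      using * by (auto simp: ennreal_add_left_cancel_le)
    also have "partition_sum \<gamma> n q \<le> (\<Sum>i<n. ennreal (e / (2 * (n + 1))))"
      unfolding partition_sum_def
    proof (intro sum_mono ennreal_leI)
      fix i assume "i \<in> {..<n}"
      then have "q i \<in> {s..t}" "q (Suc i) \<in> {s..t}"
        using partition_in[OF parts(1)] by auto
      then show "dist (\<gamma> (q i)) (\<gamma> (q (Suc i))) \<le> e / (2 * (n + 1))"
        using st by (intro less_imp_le small) (auto simp: dist_real_def)
    qed
    also have "\<dots> = ennreal (n * (e / (2 * (n + 1))))"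
      by (simp only: sum_constant card_lessThan ennreal_of_nat_eq_real_of_nat)
         (use \<open>0 < e\<close> in \<open>simp add: ennreal_mult[symmetric]\<close>)
    also have "\<dots> \<le> ennreal (e / 2)"
      using \<open>0 < e\<close> by (intro ennreal_leI) (simp add: field_simps)
    finally show "curve_length \<gamma> s t \<le> ennreal e"
      using \<open>0 < e\<close> by (simp add: ennreal_plus[symmetric] del: ennreal_plus)
  qed
qed

section \<open>Arc length and integrals along subarcs\<close>

locale rectifiable =
  fixes \<gamma> :: "real \<Rightarrow> 'a::metric_space" and a b :: real
  assumes ab: "a \<le> b" and cont: "continuous_on {a..b} \<gamma>" and finite_length: "curve_length \<gamma> a b < \<infinity>"
begin

definition len :: "real \<Rightarrow> real" where "len t = enn2real (curve_length \<gamma> a t)"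

text \<open>The locale admits constant and degenerate arcs, unlike \<open>curves\<close>; therefore
  every subarc is again an instance.\<close>

lemma sub: "a \<le> s \<Longrightarrow> s \<le> t \<Longrightarrow> t \<le> b \<Longrightarrow> rectifiable \<gamma> s t"
  using cont curve_length_mono[of a s t b \<gamma>] finite_length
  by unfold_locales (auto intro: continuous_on_subset)

lemma curve_length_eq:
  assumes "a \<le> s" "s \<le> t" "t \<le> b"
  shows "curve_length \<gamma> s t = ennreal (len t - len s)" "len s \<le> len t"
proof -
  have fin: "curve_length \<gamma> a s < top" "curve_length \<gamma> s t < top"
    using sub[of a s] sub[of s t] assms ab by (auto simp: rectifiable_def)
  have "len t = len s + enn2real (curve_length \<gamma> s t)"
    unfolding len_def using curve_length_add[of a s t \<gamma>] assms fin by (simp add: enn2real_plus)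
  then show "curve_length \<gamma> s t = ennreal (len t - len s)" "len s \<le> len t"
    using fin by auto
qed

lemma len_a [simp]: "len a = 0" by (simp add: len_def)

lemma curve_length_len: "t \<in> {a..b} \<Longrightarrow> curve_length \<gamma> a t = ennreal (len t)"
  using curve_length_eq[of a t] by simp

lemma len_nonneg: "0 \<le> len t"
  by (simp add: len_def)

lemma len_small:
  assumes "0 < e"
  obtains d where "d > 0"
    "\<And>s t. a \<le> s \<Longrightarrow> s \<le> t \<Longrightarrow> t \<le> b \<Longrightarrow> t - s < d \<Longrightarrow> len t - len s \<le> e"
proof -
  obtain d where "d > 0"
    "\<And>s t. a \<le> s \<Longrightarrow> s \<le> t \<Longrightarrow> t \<le> b \<Longrightarrow> t - s < d \<Longrightarrow> curve_length \<gamma> s t \<le> ennreal e"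
    using curve_length_small[OF cont finite_length ab assms] by blast
  then show ?thesis using assms curve_length_eq by (intro that[of d]) (auto simp: ennreal_le_iff)
qed

lemma continuous_len: "continuous_on {a..b} len"
  unfolding continuous_on_iff
proof (intro ballI allI impI)
  fix x e :: real assume x: "x \<in> {a..b}" and "0 < e"
  then obtain d where d: "d > 0"
    "\<And>s t. a \<le> s \<Longrightarrow> s \<le> t \<Longrightarrow> t \<le> b \<Longrightarrow> t - s < d \<Longrightarrow> len t - len s \<le> e / 2"
    using len_small[of "e / 2"] by auto
  show "\<exists>d>0. \<forall>x'\<in>{a..b}. dist x' x < d \<longrightarrow> dist (len x') (len x) < e"
  proof (intro exI[of _ d] conjI ballI impI)
    fix y assume y: "y \<in> {a..b}" "dist y x < d"
    show "dist (len y) (len x) < e"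
      using d(2)[of x y] d(2)[of y x] curve_length_eq(2)[of x y] curve_length_eq(2)[of y x] x y \<open>0 < e\<close>
      by (cases "x \<le> y") (auto simp: dist_real_def)
  qed fact
qed

lemma len_surj:
  assumes "0 \<le> s" "s \<le> len b"
  obtains t where "t \<in> {a..b}" "len t = s"
  using IVT'[of len a s b] assms ab continuous_len by auto

text \<open>The choice behind \<open>SOME\<close> is harmless: two parameters with equal arc length
  bound an arc of length zero, so its endpoints coincide.\<close>

lemma arc_length_param_len:
  assumes t: "t \<in> {a..b}"
  shows "arc_length_param \<gamma> a b (len t) = \<gamma> t"
proof -
  have eq: "\<gamma> x = \<gamma> y" if "x \<in> {a..b}" "y \<in> {a..b}" "x \<le> y" "len x = len y" for x y
    using dist_le_curve_length[of x y \<gamma>] curve_length_eq(1)[of x y] that by simp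
  define x where "x = (SOME x. x \<in> {a..b} \<and> curve_length \<gamma> a x = ennreal (len t))"
  have x: "x \<in> {a..b} \<and> curve_length \<gamma> a x = ennreal (len t)"
    unfolding x_def by (rule someI[of _ t]) (use t curve_length_len in auto)
  then have "len x = len t" unfolding len_def[of x] using len_nonneg[of t] by simp
  then have "\<gamma> x = \<gamma> t"
    using eq t x by (metis linear)
  then show ?thesis unfolding arc_length_param_def x_def .
qed

text \<open>The arc length of a subarc is that of the whole curve shifted by \<open>len s\<close>.
  All subarcs thus become subintervals for one fixed integrand, to which monotonicity and absolute
  continuity apply.\<close>

lemma curve_integral_sub:
  assumes st: "a \<le> s" "s \<le> t" "t \<le> b"
  shows "curve_integral g (\<gamma>, s, t) = (\<integral>\<^sup>+x\<in>{len s..len t}. g (arc_length_param \<gamma> a b x) \<partial>lebesgue)"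
proof -
  interpret r: rectifiable \<gamma> s t using st by (rule sub)
  have L: "r.len u = len u - len s" if "u \<in> {s..t}" for u
    unfolding r.len_def using curve_length_eq[of s u] that st by simp
  have "curve_integral g (\<gamma>, s, t)
    = (\<integral>\<^sup>+x\<in>{0..r.len t}. g (arc_length_param \<gamma> s t x) \<partial>lebesgue)"
    by (simp add: curve_integral_def r.len_def)
  also have "\<dots> = (\<integral>\<^sup>+x. g (arc_length_param \<gamma> a b (len s + x)) * indicator {len s..len t} (len s + x) \<partial>lebesgue)"
  proof (rule nn_integral_cong)
    fix x
    show "g (arc_length_param \<gamma> s t x) * indicator {0..r.len t} x
       = g (arc_length_param \<gamma> a b (len s + x)) * indicator {len s..len t} (len s + x)"
    proof (cases "x \<in> {0..r.len t}")
      case True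
      then obtain u where u: "u \<in> {s..t}" "r.len u = x" using r.len_surj by auto
      then have "arc_length_param \<gamma> s t x = \<gamma> u" using r.arc_length_param_len[of u] by simp
      moreover have "arc_length_param \<gamma> a b (len s + x) = \<gamma> u"
        using arc_length_param_len[of u] L[of u] u st by simp
      ultimately show ?thesis using True L[of t] st by (simp add: indicator_def)
    next
      case False
      then show ?thesis using L[of t] st by (auto simp: indicator_def)
    qed
  qed
  also have "\<dots> = (\<integral>\<^sup>+x\<in>{len s..len t}. g (arc_length_param \<gamma> a b x) \<partial>lebesgue)"
    by (rule nn_integral_lebesgue_shift[of "\<lambda>x. g (arc_length_param \<gamma> a b x) * indicator {len s..len t} x"])
  finally show ?thesis .
qed

lemma curve_integral_eq:
  "curve_integral g (\<gamma>, a, b) = (\<integral>\<^sup>+x\<in>{0..len b}. g (arc_length_param \<gamma> a b x) \<partial>lebesgue)"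
  using curve_integral_sub[of a b g] ab by simp

lemma curve_integral_subarc_le:
  assumes st: "a \<le> s" "s \<le> t" "t \<le> b"
  shows "curve_integral g (\<gamma>, s, t) \<le> curve_integral g (\<gamma>, a, b)"
  unfolding curve_integral_eq curve_integral_sub[OF st]
  using curve_length_eq(2)[of t b] st len_nonneg[of s]
  by (intro nn_integral_mono) (auto simp: indicator_def)

text \<open>Only the arc length parameters \<open>0\<close> and \<open>len b\<close> escape the
  hypothesis, and they form a null set. Ignoring the endpoints is what later allows strict
  inequalities in the bands of a truncation.\<close>

lemma curve_integral_mono:
  assumes "\<And>t. a < t \<Longrightarrow> t < b \<Longrightarrow> g (\<gamma> t) \<le> h (\<gamma> t)"
  shows "curve_integral g (\<gamma>, a, b) \<le> curve_integral h (\<gamma>, a, b)"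
  unfolding curve_integral_eq
proof (rule nn_integral_mono_AE)
  have "AE x in lebesgue. x \<notin> {0, len b}"
    by (intro AE_not_in) (simp add: null_sets_def emeasure_lborel_countable)
  then show "AE x in lebesgue. g (arc_length_param \<gamma> a b x) * indicator {0..len b} x
      \<le> h (arc_length_param \<gamma> a b x) * indicator {0..len b} x"
  proof eventually_elim
    case (elim x)
    show ?case
    proof (cases "x \<in> {0..len b}")
      case True
      then obtain t where t: "t \<in> {a..b}" "len t = x" using len_surj by auto
      moreover have "t \<noteq> a" "t \<noteq> b" using t(2) elim len_a by auto
      ultimately have "a < t" "t < b" by auto
      with t show ?thesis using assms[of t] arc_length_param_len[OF t(1)] t(2) by (simp add: mult_right_mono)
    qed simp
  qed
qed

lemma curve_integral_superadd:
  "curve_integral g (\<gamma>, a, b) + curve_integral h (\<gamma>, a, b) \<le> curve_integral (\<lambda>x. g x + h x) (\<gamma>, a, b)"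
  unfolding curve_integral_eq distrib_right by (rule nn_integral_superadd)

lemma curve_integral_cmult_ge:
  "ennreal c * curve_integral g (\<gamma>, a, b) \<le> curve_integral (\<lambda>x. ennreal c * g x) (\<gamma>, a, b)"
  unfolding curve_integral_eq mult.assoc by (rule nn_integral_cmult_ge)

lemma curve_integral_one: "curve_integral (\<lambda>x. 1) (\<gamma>, a, b) = curve_length \<gamma> a b"
  unfolding curve_integral_eq using curve_length_len[of b] ab len_nonneg[of b] by simp

text \<open>Short parameter intervals have small length, and absolute continuity does the rest. This
  is the source of the continuity of Newtonian functions along curves.\<close>

lemma curve_integral_small:
  assumes fin: "curve_integral g (\<gamma>, a, b) < \<infinity>" and e: "0 < e"
  obtains d where "d > 0" "\<And>s t. a \<le> s \<Longrightarrow> s \<le> t \<Longrightarrow> t \<le> b \<Longrightarrow> t - s < d \<Longrightarrow>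
    curve_integral g (\<gamma>, s, t) \<le> ennreal e"
proof -
  obtain K where K: "K \<ge> 0" "\<And>A. A \<in> sets lebesgue \<Longrightarrow> A \<subseteq> {0..len b} \<Longrightarrow>
     (\<integral>\<^sup>+x\<in>A. g (arc_length_param \<gamma> a b x) \<partial>lebesgue) \<le> ennreal K * emeasure lebesgue A + ennreal (e / 2)"
    using set_nn_integral_absolutely_continuous[of lebesgue "\<lambda>x. g (arc_length_param \<gamma> a b x)" "{0..len b}" "e / 2"]
      fin e unfolding curve_integral_eq by auto
  \<comment> \<open>\<open>K + 1\<close> keeps the denominator positive when
    \<open>K = 0\<close>.\<close>
  have "e / (2 * (K + 1)) > 0" using K e by simp
  then obtain d where d: "d > 0"
    "\<And>s t. a \<le> s \<Longrightarrow> s \<le> t \<Longrightarrow> t \<le> b \<Longrightarrow> t - s < d \<Longrightarrow> len t - len s \<le> e / (2 * (K + 1))"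
    using len_small by blast
  show ?thesis
  proof (rule that[OF d(1)])
    fix s t assume st: "a \<le> s" "s \<le> t" "t \<le> b" "t - s < d"
    have l: "len s \<le> len t" "len t \<le> len b" using curve_length_eq(2)[of s t] curve_length_eq(2)[of t b] st by auto
    have "curve_integral g (\<gamma>, s, t) \<le> ennreal K * emeasure lebesgue {len s..len t} + ennreal (e / 2)"
      unfolding curve_integral_sub[OF st(1-3)] using l len_nonneg[of s] by (intro K) auto
    also have "\<dots> = ennreal (K * (len t - len s) + e / 2)"
      using K l e by (simp add: ennreal_mult[symmetric] ennreal_plus[symmetric] del: ennreal_plus)
    also have "\<dots> \<le> ennreal e"
    proof (rule ennreal_leI)
      have "K * (len t - len s) \<le> K * (e / (2 * (K + 1)))"
        using d(2)[OF st] K by (intro mult_left_mono) auto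
      also have "\<dots> \<le> e / 2" using K e by (simp add: field_simps)
      finally show "K * (len t - len s) + e / 2 \<le> e" by simp
    qed
    finally show "curve_integral g (\<gamma>, s, t) \<le> ennreal e" .
  qed
qed

end

lemma curves_iff: "(\<gamma>, a, b) \<in> curves \<longleftrightarrow> rectifiable \<gamma> a b \<and> \<not> \<gamma> constant_on {a..b}"
  by (auto simp: curves_def rectifiable_def)

section \<open>Curve families of zero modulus\<close>

lemma epowr_0 [simp]: "epowr 0 p = 0"
  by (simp add: epowr_def)

lemma epowr_ennreal: "0 \<le> x \<Longrightarrow> epowr (ennreal x) p = ennreal (x powr p)"
  by (simp add: epowr_def)

lemma epowr_top [simp]: "epowr top p = top"
  by (simp add: epowr_def)

lemma epowr_mono: "0 < p \<Longrightarrow> x \<le> y \<Longrightarrow> epowr x p \<le> epowr y p"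
  by (cases x; cases y) (auto simp: epowr_ennreal top_unique intro!: ennreal_leI powr_mono2)

lemma epowr_cmult:
  assumes "0 < p" "0 \<le> c"
  shows "epowr (ennreal c * x) p = ennreal (c powr p) * epowr x p"
proof (cases x)
  case (real r)
  then show ?thesis using assms
    by (simp add: epowr_ennreal ennreal_mult[symmetric] powr_mult)
next
  case top
  then show ?thesis using assms by (cases "c = 0") (auto simp: ennreal_mult_top)
qed

lemma epowr_add_le:
  assumes p: "0 < p"
  shows "epowr (x + y) p \<le> ennreal (2 powr p) * (epowr x p + epowr y p)"
proof -
  have "epowr (x + y) p \<le> epowr (ennreal 2 * max x y) p"
    using p by (intro epowr_mono) (auto simp: max_def mult_2 intro: add_mono)
  also have "\<dots> = ennreal (2 powr p) * epowr (max x y) p"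
    using p by (intro epowr_cmult) auto
  also have "epowr (max x y) p \<le> epowr x p + epowr y p"
    by (simp add: max_def)
  finally show ?thesis by (simp add: mult_left_mono)
qed

lemma epowr_inverse: "0 < p \<Longrightarrow> epowr (epowr x (1 / p)) p = x"
  by (cases x) (auto simp: epowr_ennreal powr_powr)

lemma borel_measurable_epowr [measurable]:
  assumes [measurable]: "f \<in> borel_measurable M"
  shows "(\<lambda>x. epowr (f x) p) \<in> borel_measurable M"
  unfolding epowr_def by measurable

text \<open>The exceptional family may contain triples that are not curves; intersecting it with
  \<open>curves\<close> keeps its modulus zero by \<open>modulus_mono\<close>.\<close>

definition ae_curve :: "'a::metric_space measure \<Rightarrow> real \<Rightarrow> ('a curve \<Rightarrow> bool) \<Rightarrow> bool" where
  "ae_curve M p P \<longleftrightarrow> (\<exists>\<Gamma>. modulus M p \<Gamma> = 0 \<and> (\<forall>c\<in>curves - \<Gamma>. P c))"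

lemma modulus_eq_0_iff:
  "modulus M p \<Gamma> = 0 \<longleftrightarrow> (\<forall>e>0. \<exists>\<rho>. \<rho> \<in> borel_measurable borel \<and>
     (\<forall>c\<in>\<Gamma>. 1 \<le> curve_integral \<rho> c) \<and> (\<integral>\<^sup>+x. epowr (\<rho> x) p \<partial>M) < e)"
  (is "?L \<longleftrightarrow> ?R")
proof
  assume L: ?L
  show ?R
  proof (intro allI impI)
    fix e :: ennreal assume "0 < e"
    then have "modulus M p \<Gamma> < e" using L by simp
    then show "\<exists>\<rho>. \<rho> \<in> borel_measurable borel \<and>
     (\<forall>c\<in>\<Gamma>. 1 \<le> curve_integral \<rho> c) \<and> (\<integral>\<^sup>+x. epowr (\<rho> x) p \<partial>M) < e"
      unfolding modulus_def Inf_less_iff by blast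
  qed
next
  assume R: ?R
  have "modulus M p \<Gamma> \<le> e" if e: "0 < e" for e
  proof -
    obtain \<rho> where "\<rho> \<in> borel_measurable borel" "\<forall>c\<in>\<Gamma>. 1 \<le> curve_integral \<rho> c"
      "(\<integral>\<^sup>+x. epowr (\<rho> x) p \<partial>M) < e" using R e by blast
    then show ?thesis unfolding modulus_def by (intro Inf_lower2[of "\<integral>\<^sup>+x. epowr (\<rho> x) p \<partial>M"]) auto
  qed
  then show ?L by (metis dense leD not_gr_zero)
qed

lemma modulus_mono: "\<Gamma> \<subseteq> \<Delta> \<Longrightarrow> modulus M p \<Delta> = 0 \<Longrightarrow> modulus M p \<Gamma> = 0"
  unfolding modulus_eq_0_iff by (meson subsetD)

lemma ae_curve_mono:
  "ae_curve M p P \<Longrightarrow> (\<And>c. c \<in> curves \<Longrightarrow> P c \<Longrightarrow> Q c) \<Longrightarrow> ae_curve M p Q"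
  unfolding ae_curve_def by (meson DiffD1)

lemma ae_curve_all: "(\<And>c. c \<in> curves \<Longrightarrow> P c) \<Longrightarrow> ae_curve M p P"
  unfolding ae_curve_def
  by (rule exI[of _ "{}"]) (auto simp: modulus_eq_0_iff intro!: exI[of _ "\<lambda>_. 0"])

text \<open>A density admissible for the exceptional family is admissible for all curves having a
  subarc in it, since passing to a longer curve only increases the integral. This gives upper
  gradient inequalities on all subarcs at once.\<close>

lemma ae_curve_subarcs:
  assumes "ae_curve M p P"
  shows "ae_curve M p (\<lambda>(\<gamma>, a, b). \<forall>s t. a \<le> s \<and> s \<le> t \<and> t \<le> b \<and> (\<gamma>, s, t) \<in> curves \<longrightarrow> P (\<gamma>, s, t))"
proof -
  obtain \<Gamma> where G: "modulus M p \<Gamma> = 0" "\<forall>c\<in>curves - \<Gamma>. P c"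
    using assms unfolding ae_curve_def by blast
  let ?D = "{(\<gamma>, a, b). (\<gamma>, a, b) \<in> curves \<and> (\<exists>s t. a \<le> s \<and> s \<le> t \<and> t \<le> b \<and> (\<gamma>, s, t) \<in> \<Gamma>)}"
  have "1 \<le> curve_integral \<rho> c" if adm: "\<forall>c\<in>\<Gamma>. 1 \<le> curve_integral \<rho> c" "c \<in> ?D" for \<rho> c
  proof -
    obtain \<gamma> a b s t where c: "c = (\<gamma>, a, b)" "rectifiable \<gamma> a b" "a \<le> s" "s \<le> t" "t \<le> b" "(\<gamma>, s, t) \<in> \<Gamma>"
      using adm(2) by (auto simp: curves_iff)
    have "1 \<le> curve_integral \<rho> (\<gamma>, s, t)" using adm c by blast
    then show ?thesis
      using rectifiable.curve_integral_subarc_le[OF c(2-5)] c(1) order_trans by blast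
  qed
  then have "modulus M p ?D = 0" using G(1) unfolding modulus_eq_0_iff by blast
  then show ?thesis
    unfolding ae_curve_def using G(2) by (intro exI[of _ ?D]) blast
qed

text \<open>\<open>borel_hull\<close> expresses Borel regularity through a null difference, which
  remains meaningful for sets of infinite measure.\<close>

locale metric_measure =
  fixes M :: "'a::metric_space measure"
  assumes space_M: "space M = UNIV"
    and borel_sets: "sets borel \<subseteq> sets M"
    and ball_pos: "0 < r \<Longrightarrow> 0 < emeasure M (ball x r)"
    and ball_finite: "emeasure M (ball x r) < \<infinity>"
    and borel_hull: "A \<in> sets M \<Longrightarrow> \<exists>B\<in>sets borel. A \<subseteq> B \<and> emeasure M (B - A) = 0"
begin

lemma borel_measurable_M: "f \<in> borel_measurable borel \<Longrightarrow> f \<in> borel_measurable M"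
  using borel_sets space_M by (auto simp: measurable_def)

lemma ball_sets [measurable]: "ball x r \<in> sets M"
  using borel_sets by auto

text \<open>The maximum of two densities is admissible for both families, and its
  \<open>p\<close>-th power is at most the sum of the two \<open>p\<close>-th powers.\<close>

lemma ae_curve_conj:
  assumes p: "0 < p" and "ae_curve M p P" "ae_curve M p Q"
  shows "ae_curve M p (\<lambda>c. P c \<and> Q c)"
proof -
  obtain \<Gamma> \<Delta> where G: "modulus M p \<Gamma> = 0" "\<forall>c\<in>curves - \<Gamma>. P c"
    and D: "modulus M p \<Delta> = 0" "\<forall>c\<in>curves - \<Delta>. Q c"
    using assms(2,3) unfolding ae_curve_def by blast
  have "modulus M p ((\<Gamma> \<union> \<Delta>) \<inter> curves) = 0"
    unfolding modulus_eq_0_iff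
  proof (intro allI impI)
    fix e :: ennreal assume "0 < e"
    then have e2: "0 < e / 2" by (simp add: ennreal_zero_less_divide)
    obtain \<rho> where r: "\<rho> \<in> borel_measurable borel" "\<forall>c\<in>\<Gamma>. 1 \<le> curve_integral \<rho> c"
      "(\<integral>\<^sup>+x. epowr (\<rho> x) p \<partial>M) < e / 2" using G(1) e2 unfolding modulus_eq_0_iff by blast
    obtain \<sigma> where s: "\<sigma> \<in> borel_measurable borel" "\<forall>c\<in>\<Delta>. 1 \<le> curve_integral \<sigma> c"
      "(\<integral>\<^sup>+x. epowr (\<sigma> x) p \<partial>M) < e / 2" using D(1) e2 unfolding modulus_eq_0_iff by blast
    note [measurable] = r(1)[THEN borel_measurable_M] s(1)[THEN borel_measurable_M] r(1) s(1)
    show "\<exists>\<rho>. \<rho> \<in> borel_measurable borel \<and>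
     (\<forall>c\<in>(\<Gamma> \<union> \<Delta>) \<inter> curves. 1 \<le> curve_integral \<rho> c) \<and> (\<integral>\<^sup>+x. epowr (\<rho> x) p \<partial>M) < e"
    proof (intro exI[of _ "\<lambda>x. max (\<rho> x) (\<sigma> x)"] conjI ballI)
      fix c assume c: "c \<in> (\<Gamma> \<union> \<Delta>) \<inter> curves"
      obtain \<gamma> a b where [simp]: "c = (\<gamma>, a, b)" by (cases c)
      interpret rectifiable \<gamma> a b using c by (simp add: curves_iff)
      have "curve_integral \<rho> c \<le> curve_integral (\<lambda>x. max (\<rho> x) (\<sigma> x)) c"
        "curve_integral \<sigma> c \<le> curve_integral (\<lambda>x. max (\<rho> x) (\<sigma> x)) c"
        by (auto intro!: curve_integral_mono)
      then show "1 \<le> curve_integral (\<lambda>x. max (\<rho> x) (\<sigma> x)) c"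
        using r(2) s(2) c by (meson IntD1 UnE order_trans)
    next
      have "(\<integral>\<^sup>+x. epowr (max (\<rho> x) (\<sigma> x)) p \<partial>M) \<le> (\<integral>\<^sup>+x. epowr (\<rho> x) p + epowr (\<sigma> x) p \<partial>M)"
        by (intro nn_integral_mono) (simp add: max_def)
      also have "\<dots> = (\<integral>\<^sup>+x. epowr (\<rho> x) p \<partial>M) + (\<integral>\<^sup>+x. epowr (\<sigma> x) p \<partial>M)"
        by (intro nn_integral_add) auto
      also have "\<dots> < e / 2 + e / 2" using r(3) s(3) by (intro add_strict_mono)
      also have "e / 2 + e / 2 = e"
        using ennreal_mult_divide_eq[of 2 e]
        by (simp add: add_divide_distrib_ennreal[symmetric] mult_2_right)
      finally show "(\<integral>\<^sup>+x. epowr (max (\<rho> x) (\<sigma> x)) p \<partial>M) < e" .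
    qed measurable
  qed
  then show ?thesis unfolding ae_curve_def using G(2) D(2)
    by (intro exI[of _ "(\<Gamma> \<union> \<Delta>) \<inter> curves"]) blast
qed

text \<open>Admissible densities in the modulus are Borel, while \<open>g\<close> is only measurable
  with respect to \<open>M\<close>. The majorant bridges this without changing the
  \<open>p\<close>-energy.\<close>

lemma borel_majorant:
  fixes f :: "'a \<Rightarrow> ennreal"
  assumes f: "f \<in> borel_measurable M"
  obtains h where "h \<in> borel_measurable borel" "\<And>x. f x \<le> h x" "AE x in M. f x = h x"
proof -
  let ?A = "\<lambda>q :: rat. {x. ennreal (of_rat q) < f x}"
  have A: "?A q \<in> sets M" for q
  proof -
    have "{x\<in>space M. ennreal (of_rat q) < f x} \<in> sets M" using f by measurable
    then show ?thesis by (simp add: space_M)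
  qed
  have "\<forall>q. \<exists>B\<in>sets borel. ?A q \<subseteq> B \<and> emeasure M (B - ?A q) = 0" using borel_hull[OF A] by blast
  then obtain B where B: "\<And>q. B q \<in> sets borel" "\<And>q. ?A q \<subseteq> B q" "\<And>q. emeasure M (B q - ?A q) = 0"
    by metis
  \<comment> \<open>\<open>f\<close> is the supremum of the rational levels that it exceeds; here
    each superlevel set is replaced by its Borel hull. Negative rationals are harmless, as
    \<open>ennreal\<close> sends them to \<open>0\<close>.\<close>
  define h where "h = (\<lambda>x. SUP q. ennreal (of_rat q) * indicator (B q) x)"
  show ?thesis
  proof
    show "h \<in> borel_measurable borel" unfolding h_def using B(1) by measurable
    show le: "f x \<le> h x" for x
    proof (rule ccontr)
      assume "\<not> f x \<le> h x"
      then have "h x < f x" by simp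
      then obtain q :: rat where q: "h x < ennreal (of_rat q)" "ennreal (of_rat q) < f x"
        using ennreal_rat_dense by blast
      then have "x \<in> B q" using B(2) by auto
      then have "ennreal (of_rat q) \<le> h x" unfolding h_def by (intro SUP_upper2[of q]) auto
      then show False using q by auto
    qed
    have "AE x in M. \<forall>q. x \<notin> B q - ?A q"
    proof (subst AE_all_countable, intro allI AE_not_in)
      fix q show "B q - ?A q \<in> null_sets M"
        using B(1,3)[of q] A[of q] borel_sets by (intro null_setsI) auto
    qed
    then show "AE x in M. f x = h x"
    proof eventually_elim
      case (elim x)
      have "h x \<le> f x" unfolding h_def
      proof (rule SUP_least)
        fix q show "ennreal (of_rat q) * indicator (B q) x \<le> f x"
          using elim by (cases "x \<in> B q") auto
      qed
      then show ?case using le[of x] by simp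
    qed
  qed
qed

text \<open>If \<open>h\<close> has infinite integral along every curve of a family, then so does
  every positive multiple of \<open>h\<close>; such multiples are admissible and have arbitrarily
  small energy.\<close>

lemma ae_curve_finite_integral:
  assumes p: "0 < p" and g: "g \<in> borel_measurable M" and fin: "(\<integral>\<^sup>+x. epowr (g x) p \<partial>M) < \<infinity>"
  shows "ae_curve M p (\<lambda>c. curve_integral g c < \<infinity>)"
proof -
  obtain h where h: "h \<in> borel_measurable borel" "\<And>x. g x \<le> h x" "AE x in M. g x = h x"
    using borel_majorant[OF g] by blast
  note [measurable] = h(1) h(1)[THEN borel_measurable_M]
  have "(\<integral>\<^sup>+x. epowr (g x) p \<partial>M) = (\<integral>\<^sup>+x. epowr (h x) p \<partial>M)"
    using h(3) by (intro nn_integral_cong_AE) auto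
  then have hf: "(\<integral>\<^sup>+x. epowr (h x) p \<partial>M) < \<infinity>" using fin by simp
  let ?G = "{c \<in> curves. curve_integral h c = \<infinity>}"
  have "modulus M p ?G = 0"
    unfolding modulus_eq_0_iff
  proof (intro allI impI)
    fix e :: ennreal assume "0 < e"
    obtain I where I: "(\<integral>\<^sup>+x. epowr (h x) p \<partial>M) = ennreal I" "I \<ge> 0"
      using hf by (cases "\<integral>\<^sup>+x. epowr (h x) p \<partial>M") auto
    obtain e' where e': "0 < e'" "ennreal e' < e"
    proof -
      obtain z where z: "0 < z" "z < e" using dense[OF \<open>0 < e\<close>] by blast
      then have "z < top" by (meson less_top_ennreal order.strict_trans2 top_greatest)
      then have "0 < enn2real z" "ennreal (enn2real z) = z" using z by (auto simp: enn2real_positive_iff)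
      then show ?thesis using z that by metis
    qed
    \<comment> \<open>Chosen so that the energy of \<open>c * h\<close> is
      \<open>e' * I / (I + 1)\<close>, below \<open>e\<close> even when
      \<open>I = 0\<close>.\<close>
    define c where "c = (e' / (I + 1)) powr (1 / p)"
    have c: "c > 0" "c powr p = e' / (I + 1)" unfolding c_def using e' I p by (auto simp: powr_powr)
    show "\<exists>\<rho>. \<rho> \<in> borel_measurable borel \<and>
     (\<forall>c\<in>?G. 1 \<le> curve_integral \<rho> c) \<and> (\<integral>\<^sup>+x. epowr (\<rho> x) p \<partial>M) < e"
    proof (intro exI[of _ "\<lambda>x. ennreal c * h x"] conjI ballI)
      fix C assume C: "C \<in> ?G"
      obtain \<gamma> a b where [simp]: "C = (\<gamma>, a, b)" by (cases C)
      interpret rectifiable \<gamma> a b using C by (simp add: curves_iff)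
      show "1 \<le> curve_integral (\<lambda>x. ennreal c * h x) C"
        using curve_integral_cmult_ge[of c h] C c by (auto simp: ennreal_mult_top top_unique)
    next
      have "(\<integral>\<^sup>+x. epowr (ennreal c * h x) p \<partial>M) = ennreal (c powr p) * ennreal I"
        using p c I by (simp add: epowr_cmult nn_integral_cmult)
      also have "\<dots> = ennreal (e' * (I / (I + 1)))"
        using c I e' by (simp add: ennreal_mult[symmetric])
      also have "\<dots> \<le> ennreal (e' * 1)" using e' I by (intro ennreal_leI mult_left_mono) auto
      also have "\<dots> < e" using e' by simp
      finally show "(\<integral>\<^sup>+x. epowr (ennreal c * h x) p \<partial>M) < e" .
    qed measurable
  qed
  moreover have "curve_integral g c < \<infinity>" if "c \<in> curves - ?G" for c
  proof -
    obtain \<gamma> a b where [simp]: "c = (\<gamma>, a, b)" by (cases c)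
    interpret rectifiable \<gamma> a b using that by (simp add: curves_iff)
    have "curve_integral g c \<le> curve_integral h c" using h(2) by (auto intro!: curve_integral_mono)
    also have "\<dots> < \<infinity>" using that by (simp add: less_top)
    finally show ?thesis .
  qed
  ultimately show ?thesis unfolding ae_curve_def by blast
qed

end

text \<open>The point is \<open>borel_hull\<close>: equal measures give a null difference only when
  they are finite, so bounded pieces are treated separately.\<close>

lemma metric_measure_caratheodory:
  assumes "metric_measure_space \<mu>"
  shows "metric_measure (caratheodory \<mu>)"
    and "emeasure (caratheodory \<mu>) (ball x r) = \<mu> (ball x r)"
proof -
  let ?M = "caratheodory \<mu>"
  have om: "outer_measure_space UNIV \<mu>" and bl: "sets borel \<subseteq> lambda_system UNIV UNIV \<mu>"
    and hull: "\<And>A. \<exists>B\<in>sets borel. A \<subseteq> B \<and> \<mu> B = \<mu> A"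
    and ball: "\<And>x r. r > 0 \<Longrightarrow> 0 < \<mu> (ball x r) \<and> \<mu> (ball x r) < \<infinity>"
    using assms by (auto simp: metric_measure_space_def borel_regular_outer_measure_def)
  have borel: "sets borel \<subseteq> sets ?M" using bl sets_caratheodory[OF om] by simp
  have em: "emeasure ?M A = \<mu> A" if "A \<in> sets ?M" for A
    using that emeasure_caratheodory[OF om] sets_caratheodory[OF om] by simp
  have bM: "ball x r \<in> sets ?M" for x r using borel by auto
  show "emeasure ?M (ball x r) = \<mu> (ball x r)" by (rule em[OF bM])
  show "metric_measure ?M"
  proof
    show "space ?M = UNIV" by (rule space_caratheodory[OF om])
    show "sets borel \<subseteq> sets ?M" by fact
    show "0 < emeasure ?M (ball x r)" if "0 < r" for x r using ball[OF that] em[OF bM] by simp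
    show fin: "emeasure ?M (ball x r) < \<infinity>" for x r
      using ball[of r x] em[OF bM] by (cases "0 < r") (auto simp: ball_empty)
    fix A assume A: "A \<in> sets ?M"
    define x0 :: 'a where "x0 = undefined"
    \<comment> \<open>Each piece lies in a ball and has finite measure, so its hull exceeds it by a
      null set; the union of the hulls then serves for \<open>A\<close>.\<close>
    define An where "An n = A \<inter> ball x0 (real n)" for n
    have An: "An n \<in> sets ?M" for n unfolding An_def using A bM by auto
    have Afin: "emeasure ?M (An n) < \<infinity>" for n
      using emeasure_mono[of "An n" "ball x0 (real n)" ?M] bM fin[of x0 "real n"]
      by (auto simp: An_def intro: le_less_trans)
    obtain B where B: "\<And>n. B n \<in> sets borel" "\<And>n. An n \<subseteq> B n" "\<And>n. \<mu> (B n) = \<mu> (An n)"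
    proof -
      have "\<forall>n. \<exists>B\<in>sets borel. An n \<subseteq> B \<and> \<mu> B = \<mu> (An n)" using hull by blast
      then show ?thesis using that by metis
    qed
    have BM: "B n \<in> sets ?M" for n using B(1) borel by blast
    have null: "B n - An n \<in> null_sets ?M" for n
    proof (rule null_setsI)
      have "emeasure ?M (B n - An n) = emeasure ?M (B n) - emeasure ?M (An n)"
        using BM[of n] An[of n] Afin[of n] B(2)[of n] by (intro emeasure_Diff) auto
      also have "\<dots> = 0" using B(3)[of n] em[OF BM[of n]] em[OF An[of n]] Afin[of n]
        by (simp add: diff_eq_0_ennreal)
      finally show "emeasure ?M (B n - An n) = 0" .
    qed (use BM An in auto)
    show "\<exists>B\<in>sets borel. A \<subseteq> B \<and> emeasure ?M (B - A) = 0"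
    proof (intro bexI[of _ "\<Union>n. B n"] conjI)
      show "A \<subseteq> (\<Union>n. B n)"
      proof
        fix x assume "x \<in> A"
        obtain n where "dist x0 x < real n" using reals_Archimedean2 by blast
        then have "x \<in> An n" using \<open>x \<in> A\<close> by (simp add: An_def)
        then show "x \<in> (\<Union>n. B n)" using B(2) by blast
      qed
      have "(\<Union>n. B n) - A \<subseteq> (\<Union>n. B n - An n)" by (auto simp: An_def)
      moreover have "(\<Union>n. B n - An n) \<in> null_sets ?M" using null by (intro null_sets_UN) auto
      moreover have "(\<Union>n. B n) - A \<in> sets ?M" using BM A by auto
      ultimately show "emeasure ?M ((\<Union>n. B n) - A) = 0"
        by (metis null_setsD1 null_sets_subset)
    qed (use B(1) in auto)
  qed
qed

section \<open>Truncations of weak upper gradients\<close>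

text \<open>Only the part of the curve between the last time below \<open>\<alpha>\<close> and the next time above \<open>\<beta>\<close>
  contributes to the oscillation of the truncation.\<close>
lemma clamp_oscillation:
  fixes f :: "real \<Rightarrow> real" and I J :: "real \<Rightarrow> real \<Rightarrow> ennreal"
  assumes ab: "a \<le> b" and f: "continuous_on {a..b} f" and fab: "f a \<le> f b" and "\<alpha> \<le> \<beta>"
    and I: "\<And>s t. a \<le> s \<Longrightarrow> s \<le> t \<Longrightarrow> t \<le> b \<Longrightarrow> ennreal \<bar>f s - f t\<bar> \<le> I s t"
    and J: "\<And>s t. a \<le> s \<Longrightarrow> s \<le> t \<Longrightarrow> t \<le> b \<Longrightarrow>
      (\<And>u. s < u \<Longrightarrow> u < t \<Longrightarrow> \<alpha> < f u \<and> f u < \<beta>) \<Longrightarrow> I s t \<le> J a b"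
  shows "ennreal \<bar>max \<alpha> (min \<beta> (f a)) - max \<alpha> (min \<beta> (f b))\<bar> \<le> J a b"
proof -
  \<comment> \<open>These are the truncated endpoint values whenever \<open>A < B\<close>; otherwise
    the truncation takes the same value at both ends.\<close>
  define A B where "A = max \<alpha> (f a)" and "B = min \<beta> (f b)"
  show ?thesis
  proof (cases "A < B")
    case False
    then have "max \<alpha> (min \<beta> (f a)) = max \<alpha> (min \<beta> (f b))"
      using fab \<open>\<alpha> \<le> \<beta>\<close> unfolding A_def B_def by (auto simp: max_def min_def split: if_splits)
    then show ?thesis by simp
  next
    case True
    then have AB: "\<alpha> \<le> A" "f a \<le> A" "B \<le> \<beta>" "B \<le> f b" unfolding A_def B_def by auto
    have "compact ({a..b} \<inter> f -` {..A})"
      using continuous_closed_preimage[OF f, of "{..A}"] compact_Icc by (auto simp: compact_eq_bounded_closed intro: bounded_subset)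
    moreover have "a \<in> {a..b} \<inter> f -` {..A}" using ab AB by auto
    ultimately obtain s where s: "s \<in> {a..b} \<inter> f -` {..A}" and smax: "\<And>u. u \<in> {a..b} \<inter> f -` {..A} \<Longrightarrow> u \<le> s"
      using compact_attains_sup[of "{a..b} \<inter> f -` {..A}"] by blast
    \<comment> \<open>\<open>t\<close> is sought only after \<open>s\<close>. Hence \<open>f\<close>
      lies strictly between \<open>A\<close> and \<open>B\<close> on the open interval from
      \<open>s\<close> to \<open>t\<close>.\<close>
    have fs: "continuous_on {s..b} f" using f s by (auto intro: continuous_on_subset)
    have "compact ({s..b} \<inter> f -` {B..})"
      using continuous_closed_preimage[OF fs, of "{B..}"] compact_Icc by (auto simp: compact_eq_bounded_closed intro: bounded_subset)
    moreover have "b \<in> {s..b} \<inter> f -` {B..}" using s AB by auto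
    ultimately obtain t where t: "t \<in> {s..b} \<inter> f -` {B..}" and tmin: "\<And>u. u \<in> {s..b} \<inter> f -` {B..} \<Longrightarrow> t \<le> u"
      using compact_attains_inf[of "{s..b} \<inter> f -` {B..}"] by blast
    have "\<bar>max \<alpha> (min \<beta> (f a)) - max \<alpha> (min \<beta> (f b))\<bar> = B - A"
      using True fab \<open>\<alpha> \<le> \<beta>\<close> unfolding A_def B_def by (auto simp: max_def min_def split: if_splits)
    also have "B - A \<le> \<bar>f s - f t\<bar>" using s t by auto
    finally have "ennreal \<bar>max \<alpha> (min \<beta> (f a)) - max \<alpha> (min \<beta> (f b))\<bar> \<le> ennreal \<bar>f s - f t\<bar>"
      by (rule ennreal_leI)
    also have "\<dots> \<le> I s t" using s t by (intro I) auto
    also have "\<dots> \<le> J a b"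
    proof (rule J)
      fix u assume u: "s < u" "u < t"
      have "\<not> f u \<le> A" using smax[of u] u s t by auto
      moreover have "\<not> B \<le> f u" using tmin[of u] u s t by auto
      ultimately show "\<alpha> < f u \<and> f u < \<beta>" using AB by auto
    qed (use s t in auto)
    finally show ?thesis .
  qed
qed

text \<open>Truncation needs the intermediate values along curves; a Newtonian function may be
  discontinuous on the space and still have this property.\<close>

definition curve_continuous :: "'a::metric_space measure \<Rightarrow> real \<Rightarrow> ('a \<Rightarrow> real) \<Rightarrow> bool" where
  "curve_continuous M p v \<longleftrightarrow> ae_curve M p (\<lambda>(\<gamma>, a, b). continuous_on {a..b} (\<lambda>t. v (\<gamma> t)))"

lemma eabs_ereal [simp]: "eabs (ereal x) = ennreal \<bar>x\<bar>"
  by (simp add: eabs_def)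

lemma weak_upper_gradient_ereal_iff:
  "weak_upper_gradient M p (\<lambda>x. ereal (v x)) g \<longleftrightarrow> g \<in> borel_measurable M \<and>
     ae_curve M p (\<lambda>(\<gamma>, a, b). ennreal \<bar>v (\<gamma> a) - v (\<gamma> b)\<bar> \<le> curve_integral g (\<gamma>, a, b))"
  (is "?L \<longleftrightarrow> ?R")
proof
  assume ?L
  then show ?R unfolding weak_upper_gradient_def ae_curve_def by auto
next
  assume R: ?R
  then obtain \<Gamma> where G: "modulus M p \<Gamma> = 0" "\<forall>c\<in>curves - \<Gamma>.
     (\<lambda>(\<gamma>, a, b). ennreal \<bar>v (\<gamma> a) - v (\<gamma> b)\<bar> \<le> curve_integral g (\<gamma>, a, b)) c"
    unfolding ae_curve_def by blast
  have "modulus M p (\<Gamma> \<inter> curves) = 0" using G(1) by (rule modulus_mono[rotated]) auto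
  moreover have "ennreal \<bar>v (\<gamma> a) - v (\<gamma> b)\<bar> \<le> curve_integral g (\<gamma>, a, b)"
    if "(\<gamma>, a, b) \<in> curves" "(\<gamma>, a, b) \<notin> \<Gamma>" for \<gamma> a b
    using bspec[OF G(2), of "(\<gamma>, a, b)"] that by simp
  ultimately show ?L unfolding weak_upper_gradient_def using R
    by (intro conjI exI[of _ "\<Gamma> \<inter> curves"]) auto
qed

text \<open>Constant subarcs are not in \<open>curves\<close>, but on them the left-hand side
  vanishes.\<close>

lemma weak_upper_gradient_ereal_subarcs:
  assumes "weak_upper_gradient M p (\<lambda>x. ereal (v x)) g"
  shows "ae_curve M p (\<lambda>(\<gamma>, a, b). \<forall>s t. a \<le> s \<and> s \<le> t \<and> t \<le> b \<longrightarrow>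
     ennreal \<bar>v (\<gamma> s) - v (\<gamma> t)\<bar> \<le> curve_integral g (\<gamma>, s, t))"
proof (rule ae_curve_mono[OF ae_curve_subarcs[OF conjunct2[OF assms[unfolded weak_upper_gradient_ereal_iff]]]])
  fix c :: "'a curve"
  obtain \<gamma> a b where c: "c = (\<gamma>, a, b)" by (cases c)
  assume "c \<in> curves" and *: "case c of (\<gamma>, a, b) \<Rightarrow> \<forall>s t. a \<le> s \<and> s \<le> t \<and> t \<le> b \<and> (\<gamma>, s, t) \<in> curves \<longrightarrow>
     (case (\<gamma>, s, t) of (\<gamma>, a, b) \<Rightarrow> ennreal \<bar>v (\<gamma> a) - v (\<gamma> b)\<bar> \<le> curve_integral g (\<gamma>, a, b))"
  then interpret rectifiable \<gamma> a b by (simp add: c curves_iff)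
  have "ennreal \<bar>v (\<gamma> s) - v (\<gamma> t)\<bar> \<le> curve_integral g (\<gamma>, s, t)" if "a \<le> s" "s \<le> t" "t \<le> b" for s t
  proof (cases "(\<gamma>, s, t) \<in> curves")
    case True
    then show ?thesis using * that by (auto simp: c)
  next
    case False
    then have "\<gamma> constant_on {s..t}" using sub[OF that] by (simp add: curves_iff)
    then have "\<gamma> s = \<gamma> t" using that by (auto simp: constant_on_def)
    then show ?thesis by simp
  qed
  then show "case c of (\<gamma>, a, b) \<Rightarrow> \<forall>s t. a \<le> s \<and> s \<le> t \<and> t \<le> b \<longrightarrow>
     ennreal \<bar>v (\<gamma> s) - v (\<gamma> t)\<bar> \<le> curve_integral g (\<gamma>, s, t)"
    by (simp add: c)
qed

section \<open>Calculus of weak upper gradients\<close>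

context metric_measure
begin

text \<open>A single increment estimate covers sums, multiples and minima. The integrals enter only
  through superadditivity and \<open>curve_integral_cmult_ge\<close>, so lower integrals are
  permitted.\<close>

lemma weak_upper_gradient_lipschitz2:
  assumes p: "0 < p"
    and v: "weak_upper_gradient M p (\<lambda>x. ereal (v x)) g"
    and w: "weak_upper_gradient M p (\<lambda>x. ereal (w x)) h"
    and cd: "0 \<le> c" "0 \<le> d"
    and f: "\<And>x y. \<bar>f x - f y\<bar> \<le> c * \<bar>v x - v y\<bar> + d * \<bar>w x - w y\<bar>"
  shows "weak_upper_gradient M p (\<lambda>x. ereal (f x)) (\<lambda>x. ennreal c * g x + ennreal d * h x)"
  unfolding weak_upper_gradient_ereal_iff
proof
  have [measurable]: "g \<in> borel_measurable M" "h \<in> borel_measurable M"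
    using v w by (auto simp: weak_upper_gradient_ereal_iff)
  show "(\<lambda>x. ennreal c * g x + ennreal d * h x) \<in> borel_measurable M"
    by measurable
  show "ae_curve M p (\<lambda>(\<gamma>, a, b). ennreal \<bar>f (\<gamma> a) - f (\<gamma> b)\<bar>
      \<le> curve_integral (\<lambda>x. ennreal c * g x + ennreal d * h x) (\<gamma>, a, b))"
  proof (rule ae_curve_mono[OF ae_curve_conj[OF p]])
    show "ae_curve M p (\<lambda>(\<gamma>, a, b). ennreal \<bar>v (\<gamma> a) - v (\<gamma> b)\<bar> \<le> curve_integral g (\<gamma>, a, b))"
      "ae_curve M p (\<lambda>(\<gamma>, a, b). ennreal \<bar>w (\<gamma> a) - w (\<gamma> b)\<bar> \<le> curve_integral h (\<gamma>, a, b))"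
      using v w by (auto simp: weak_upper_gradient_ereal_iff)
    fix C :: "'a curve"
    obtain \<gamma> a b where C: "C = (\<gamma>, a, b)" by (cases C)
    assume "C \<in> curves"
    then interpret rectifiable \<gamma> a b by (simp add: C curves_iff)
    assume "(case C of (\<gamma>, a, b) \<Rightarrow> ennreal \<bar>v (\<gamma> a) - v (\<gamma> b)\<bar> \<le> curve_integral g (\<gamma>, a, b)) \<and>
      (case C of (\<gamma>, a, b) \<Rightarrow> ennreal \<bar>w (\<gamma> a) - w (\<gamma> b)\<bar> \<le> curve_integral h (\<gamma>, a, b))"
    then have *: "ennreal \<bar>v (\<gamma> a) - v (\<gamma> b)\<bar> \<le> curve_integral g (\<gamma>, a, b)"
      "ennreal \<bar>w (\<gamma> a) - w (\<gamma> b)\<bar> \<le> curve_integral h (\<gamma>, a, b)" by (auto simp: C)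
    have "ennreal \<bar>f (\<gamma> a) - f (\<gamma> b)\<bar> \<le> ennreal (c * \<bar>v (\<gamma> a) - v (\<gamma> b)\<bar> + d * \<bar>w (\<gamma> a) - w (\<gamma> b)\<bar>)"
      by (intro ennreal_leI f)
    also have "\<dots> = ennreal c * ennreal \<bar>v (\<gamma> a) - v (\<gamma> b)\<bar> + ennreal d * ennreal \<bar>w (\<gamma> a) - w (\<gamma> b)\<bar>"
      using cd by (simp add: ennreal_mult)
    also have "\<dots> \<le> ennreal c * curve_integral g (\<gamma>, a, b) + ennreal d * curve_integral h (\<gamma>, a, b)"
      using * by (intro add_mono mult_left_mono) auto
    also have "\<dots> \<le> curve_integral (\<lambda>x. ennreal c * g x) (\<gamma>, a, b) + curve_integral (\<lambda>x. ennreal d * h x) (\<gamma>, a, b)"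
      by (intro add_mono curve_integral_cmult_ge)
    also have "\<dots> \<le> curve_integral (\<lambda>x. ennreal c * g x + ennreal d * h x) (\<gamma>, a, b)"
      by (rule curve_integral_superadd)
    finally show "case C of (\<gamma>, a, b) \<Rightarrow> ennreal \<bar>f (\<gamma> a) - f (\<gamma> b)\<bar>
      \<le> curve_integral (\<lambda>x. ennreal c * g x + ennreal d * h x) (\<gamma>, a, b)" by (simp add: C)
  qed
qed

lemma weak_upper_gradient_const:
  "weak_upper_gradient M p (\<lambda>x. ereal c) (\<lambda>x. 0)"
  unfolding weak_upper_gradient_ereal_iff by (auto intro: ae_curve_all)

lemma weak_upper_gradient_mono:
  assumes "weak_upper_gradient M p (\<lambda>x. ereal (v x)) g" "\<And>x. g x \<le> h x" "h \<in> borel_measurable M"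
  shows "weak_upper_gradient M p (\<lambda>x. ereal (v x)) h"
  unfolding weak_upper_gradient_ereal_iff
proof
  show "ae_curve M p (\<lambda>(\<gamma>, a, b). ennreal \<bar>v (\<gamma> a) - v (\<gamma> b)\<bar> \<le> curve_integral h (\<gamma>, a, b))"
  proof (rule ae_curve_mono[OF conjunct2[OF assms(1)[unfolded weak_upper_gradient_ereal_iff]]])
    fix C :: "'a curve"
    obtain \<gamma> a b where C: "C = (\<gamma>, a, b)" by (cases C)
    assume "C \<in> curves"
    then interpret rectifiable \<gamma> a b by (simp add: C curves_iff)
    have "curve_integral g (\<gamma>, a, b) \<le> curve_integral h (\<gamma>, a, b)"
      using assms(2) by (intro curve_integral_mono)
    moreover assume "case C of (\<gamma>, a, b) \<Rightarrow> ennreal \<bar>v (\<gamma> a) - v (\<gamma> b)\<bar> \<le> curve_integral g (\<gamma>, a, b)"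
    ultimately show "case C of (\<gamma>, a, b) \<Rightarrow> ennreal \<bar>v (\<gamma> a) - v (\<gamma> b)\<bar> \<le> curve_integral h (\<gamma>, a, b)"
      by (auto simp: C)
  qed
qed fact

lemma weak_upper_gradient_infdist:
  "weak_upper_gradient M p (\<lambda>x. ereal (infdist x S)) (\<lambda>x. 1)"
  unfolding weak_upper_gradient_ereal_iff
proof
  show "ae_curve M p (\<lambda>(\<gamma>, a, b). ennreal \<bar>infdist (\<gamma> a) S - infdist (\<gamma> b) S\<bar> \<le> curve_integral (\<lambda>x. 1) (\<gamma>, a, b))"
  proof (rule ae_curve_all, clarify)
    fix \<gamma> :: "real \<Rightarrow> 'a" and a b assume "(\<gamma>, a, b) \<in> curves"
    then interpret rectifiable \<gamma> a b by (simp add: curves_iff)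
    have "\<bar>infdist (\<gamma> a) S - infdist (\<gamma> b) S\<bar> \<le> dist (\<gamma> a) (\<gamma> b)"
      using infdist_triangle[of "\<gamma> a" S "\<gamma> b"] infdist_triangle[of "\<gamma> b" S "\<gamma> a"] by (simp add: dist_commute)
    then have "ennreal \<bar>infdist (\<gamma> a) S - infdist (\<gamma> b) S\<bar> \<le> ennreal (dist (\<gamma> a) (\<gamma> b))"
      by (rule ennreal_leI)
    also have "\<dots> \<le> curve_integral (\<lambda>x. 1) (\<gamma>, a, b)"
      unfolding curve_integral_one using ab by (rule dist_le_curve_length)
    finally show "ennreal \<bar>infdist (\<gamma> a) S - infdist (\<gamma> b) S\<bar> \<le> curve_integral (\<lambda>x. 1) (\<gamma>, a, b)" .
  qed
qed simp

lemma curve_continuous_compose: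
  assumes "curve_continuous M p v" "continuous_on UNIV f"
  shows "curve_continuous M p (\<lambda>x. f (v x))"
  using assms(1) unfolding curve_continuous_def
  by (rule ae_curve_mono) (auto intro: continuous_on_compose2[OF assms(2)])

lemma curve_continuous_min:
  assumes "0 < p" "curve_continuous M p v" "curve_continuous M p w"
  shows "curve_continuous M p (\<lambda>x. min (v x) (w x))"
  unfolding curve_continuous_def
  by (rule ae_curve_mono[OF ae_curve_conj[OF assms(1) assms(2,3)[unfolded curve_continuous_def]]])
     (auto intro: continuous_on_min)

lemma curve_continuous_continuous:
  assumes "continuous_on UNIV v"
  shows "curve_continuous M p v"
  unfolding curve_continuous_def
  by (rule ae_curve_all) (auto simp: curves_iff rectifiable_def intro: continuous_on_compose2[OF assms])

text \<open>Continuity along almost every curve isolates a subarc that carries the whole oscillation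
  of the truncation and whose interior stays strictly inside the band. There \<open>g\<close> and
  its restriction to the band agree.\<close>

lemma weak_upper_gradient_clamp:
  assumes p: "0 < p" and v: "curve_continuous M p v" "v \<in> borel_measurable M"
    and wug: "weak_upper_gradient M p (\<lambda>x. ereal (v x)) g" and "\<alpha> \<le> \<beta>"
  shows "weak_upper_gradient M p (\<lambda>x. ereal (max \<alpha> (min \<beta> (v x)))) (\<lambda>x. g x * indicator {x. \<alpha> < v x \<and> v x < \<beta>} x)"
  unfolding weak_upper_gradient_ereal_iff
proof
  let ?S = "{x. \<alpha> < v x \<and> v x < \<beta>}"
  let ?h = "\<lambda>x. g x * indicator ?S x"
  have "{x \<in> space M. \<alpha> < v x \<and> v x < \<beta>} \<in> sets M" using v(2) by measurable
  then have [measurable]: "?S \<in> sets M" by (simp add: space_M)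
  have [measurable]: "g \<in> borel_measurable M" using wug by (simp add: weak_upper_gradient_ereal_iff)
  show "?h \<in> borel_measurable M" by measurable
  show "ae_curve M p (\<lambda>(\<gamma>, a, b). ennreal \<bar>max \<alpha> (min \<beta> (v (\<gamma> a))) - max \<alpha> (min \<beta> (v (\<gamma> b)))\<bar>
     \<le> curve_integral ?h (\<gamma>, a, b))"
  proof (rule ae_curve_mono[OF ae_curve_conj[OF p v(1)[unfolded curve_continuous_def] weak_upper_gradient_ereal_subarcs[OF wug]]], clarify)
    fix \<gamma> :: "real \<Rightarrow> 'a" and a b assume c: "(\<gamma>, a, b) \<in> curves"
      and cv: "continuous_on {a..b} (\<lambda>t. v (\<gamma> t))"
      and I: "\<forall>s t. a \<le> s \<and> s \<le> t \<and> t \<le> b \<longrightarrow> ennreal \<bar>v (\<gamma> s) - v (\<gamma> t)\<bar> \<le> curve_integral g (\<gamma>, s, t)"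
    interpret rectifiable \<gamma> a b using c by (simp add: curves_iff)
    have J: "curve_integral g (\<gamma>, s, t) \<le> curve_integral ?h (\<gamma>, a, b)"
      if st: "a \<le> s" "s \<le> t" "t \<le> b" and "\<And>u. s < u \<Longrightarrow> u < t \<Longrightarrow> \<alpha> < v (\<gamma> u) \<and> v (\<gamma> u) < \<beta>" for s t
    proof -
      interpret r: rectifiable \<gamma> s t using st by (rule sub)
      have "curve_integral g (\<gamma>, s, t) \<le> curve_integral ?h (\<gamma>, s, t)"
        using that(4) by (intro r.curve_integral_mono) simp
      also have "\<dots> \<le> curve_integral ?h (\<gamma>, a, b)" using st by (rule curve_integral_subarc_le)
      finally show ?thesis .
    qed
    show "ennreal \<bar>max \<alpha> (min \<beta> (v (\<gamma> a))) - max \<alpha> (min \<beta> (v (\<gamma> b)))\<bar> \<le> curve_integral ?h (\<gamma>, a, b)"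
    proof (cases "v (\<gamma> a) \<le> v (\<gamma> b)")
      case True
      show ?thesis
        by (rule clamp_oscillation[where I = "\<lambda>s t. curve_integral g (\<gamma>, s, t)" and f = "\<lambda>t. v (\<gamma> t)"
              and J = "\<lambda>s t. curve_integral ?h (\<gamma>, s, t)"])
           (use ab cv True \<open>\<alpha> \<le> \<beta>\<close> I J in auto)
    next
      case False
      \<comment> \<open>The case of larger initial value reduces to the other one by reflecting
        \<open>v\<close> and both levels.\<close>
      have "ennreal \<bar>max (-\<beta>) (min (-\<alpha>) (- v (\<gamma> a))) - max (-\<beta>) (min (-\<alpha>) (- v (\<gamma> b)))\<bar> \<le> curve_integral ?h (\<gamma>, a, b)"
      proof (rule clamp_oscillation[where I = "\<lambda>s t. curve_integral g (\<gamma>, s, t)" and f = "\<lambda>t. - v (\<gamma> t)"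
              and J = "\<lambda>s t. curve_integral ?h (\<gamma>, s, t)"])
        show "continuous_on {a..b} (\<lambda>t. - v (\<gamma> t))" using cv by (intro continuous_on_minus)
        show "ennreal \<bar>- v (\<gamma> s) - - v (\<gamma> t)\<bar> \<le> curve_integral g (\<gamma>, s, t)" if "a \<le> s" "s \<le> t" "t \<le> b" for s t
          using I that by (simp add: abs_minus_commute)
        show "curve_integral g (\<gamma>, s, t) \<le> curve_integral ?h (\<gamma>, a, b)"
          if "a \<le> s" "s \<le> t" "t \<le> b" "\<And>u. s < u \<Longrightarrow> u < t \<Longrightarrow> - \<beta> < - v (\<gamma> u) \<and> - v (\<gamma> u) < - \<alpha>" for s t
          using that by (intro J) auto
      qed (use ab False \<open>\<alpha> \<le> \<beta>\<close> in auto)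
      moreover have "max (-\<beta>) (min (-\<alpha>) (- x)) = - max \<alpha> (min \<beta> x)" for x
        using \<open>\<alpha> \<le> \<beta>\<close> by (simp add: max_def min_def)
      ultimately show ?thesis by (simp add: abs_minus_commute)
    qed
  qed
qed

text \<open>Almost every curve has finite integral of a \<open>p\<close>-integrable upper gradient,
  which rules out infinite endpoint values on all its nonconstant subarcs. Absolute continuity of
  that integral then gives continuity.\<close>

lemma newtonian_finite_on_curves:
  assumes p: "0 < p" and u: "u \<in> newtonian M p"
  shows "ae_curve M p (\<lambda>(\<gamma>, a, b). (\<forall>t\<in>{a..b}. \<bar>u (\<gamma> t)\<bar> \<noteq> \<infinity>) \<and>
     continuous_on {a..b} (\<lambda>t. real_of_ereal \<bar>u (\<gamma> t)\<bar>))"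
proof -
  obtain g where g: "weak_upper_gradient M p u g" "(\<integral>\<^sup>+x. epowr (g x) p \<partial>M) < \<infinity>"
    using u by (auto simp: newtonian_def)
  then have gm: "g \<in> borel_measurable M" by (auto simp: weak_upper_gradient_def)
  let ?Q = "\<lambda>(\<gamma>, a, b). if \<bar>u (\<gamma> a)\<bar> \<noteq> \<infinity> \<and> \<bar>u (\<gamma> b)\<bar> \<noteq> \<infinity>
           then eabs (u (\<gamma> a) - u (\<gamma> b)) \<le> curve_integral g (\<gamma>, a, b)
           else curve_integral g (\<gamma>, a, b) = \<infinity>"
  have Q: "ae_curve M p ?Q" using g(1) unfolding weak_upper_gradient_def ae_curve_def by blast
  show ?thesis
  proof (rule ae_curve_mono[OF ae_curve_conj[OF p ae_curve_subarcs[OF Q] ae_curve_finite_integral[OF p gm g(2)]]])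
    fix c :: "'a curve"
    obtain \<gamma> a b where c': "c = (\<gamma>, a, b)" by (cases c)
    assume "c \<in> curves" and *: "(case c of (\<gamma>, a, b) \<Rightarrow> \<forall>s t. a \<le> s \<and> s \<le> t \<and> t \<le> b \<and> (\<gamma>, s, t) \<in> curves \<longrightarrow> ?Q (\<gamma>, s, t))
      \<and> curve_integral g c < \<infinity>"
    then have c: "(\<gamma>, a, b) \<in> curves" and fin: "curve_integral g (\<gamma>, a, b) < \<infinity>" by (auto simp: c')
    have "\<forall>s t. a \<le> s \<and> s \<le> t \<and> t \<le> b \<and> (\<gamma>, s, t) \<in> curves \<longrightarrow> ?Q (\<gamma>, s, t)"
      using * unfolding c' by simp
    then have Q: "?Q (\<gamma>, s, t)" if "a \<le> s" "s \<le> t" "t \<le> b" "(\<gamma>, s, t) \<in> curves" for s t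
      using that by blast
    interpret rectifiable \<gamma> a b using c by (simp add: curves_iff)
    have fin': "curve_integral g (\<gamma>, s, t) \<noteq> \<infinity>" if "a \<le> s" "s \<le> t" "t \<le> b" for s t
      using curve_integral_subarc_le[OF that, of g] fin by (auto simp: top_unique)
    have finu: "\<bar>u (\<gamma> s)\<bar> \<noteq> \<infinity> \<and> \<bar>u (\<gamma> t)\<bar> \<noteq> \<infinity>" if "a \<le> s" "s \<le> t" "t \<le> b" "(\<gamma>, s, t) \<in> curves" for s t
      using Q[OF that] fin'[OF that(1-3)] by (auto split: if_splits)
    have crv: "(\<gamma>, s, t) \<in> curves" if "a \<le> s" "s \<le> t" "t \<le> b" "\<gamma> s \<noteq> \<gamma> t" for s t
    proof -
      have "s \<in> {s..t}" "t \<in> {s..t}" using that by auto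
      then have "\<not> \<gamma> constant_on {s..t}" using that(4) unfolding constant_on_def by metis
      then show ?thesis using sub[OF that(1-3)] by (simp add: curves_iff)
    qed
    have ua: "\<bar>u (\<gamma> a)\<bar> \<noteq> \<infinity>" using finu[of a b] c ab by auto
    \<comment> \<open>If \<open>\<gamma> t = \<gamma> a\<close>, the subarc may be constant and the
      upper gradient says nothing, but then the value at \<open>a\<close> applies.\<close>
    have ut: "\<bar>u (\<gamma> t)\<bar> \<noteq> \<infinity>" if "t \<in> {a..b}" for t
      using ua crv[of a t] finu[of a t] that by (cases "\<gamma> a = \<gamma> t") auto
    have le: "ennreal \<bar>real_of_ereal \<bar>u (\<gamma> s)\<bar> - real_of_ereal \<bar>u (\<gamma> t)\<bar>\<bar> \<le> curve_integral g (\<gamma>, s, t)"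
      if st: "a \<le> s" "s \<le> t" "t \<le> b" for s t
    proof (cases "\<gamma> s = \<gamma> t")
      case False
      obtain x y where xy: "u (\<gamma> s) = ereal x" "u (\<gamma> t) = ereal y"
        using ut[of s] ut[of t] st by (cases "u (\<gamma> s)"; cases "u (\<gamma> t)") auto
      have "ennreal \<bar>\<bar>x\<bar> - \<bar>y\<bar>\<bar> \<le> ennreal \<bar>x - y\<bar>" by (intro ennreal_leI) auto
      also have "\<dots> \<le> curve_integral g (\<gamma>, s, t)" using Q[OF st crv[OF st False]] xy by simp
      finally show ?thesis using xy by simp
    qed simp
    have C: "continuous_on {a..b} (\<lambda>t. real_of_ereal \<bar>u (\<gamma> t)\<bar>)"
      unfolding continuous_on_iff
    proof (intro ballI allI impI)
      fix x e :: real assume x: "x \<in> {a..b}" and e: "0 < e"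
      obtain d where d: "d > 0" "\<And>s t. a \<le> s \<Longrightarrow> s \<le> t \<Longrightarrow> t \<le> b \<Longrightarrow> t - s < d \<Longrightarrow>
          curve_integral g (\<gamma>, s, t) \<le> ennreal (e / 2)"
        using curve_integral_small[OF fin, of "e / 2"] e by auto
      have *: "\<bar>real_of_ereal \<bar>u (\<gamma> s)\<bar> - real_of_ereal \<bar>u (\<gamma> t)\<bar>\<bar> \<le> e / 2"
        if "a \<le> s" "s \<le> t" "t \<le> b" "t - s < d" for s t
        using order_trans[OF le d(2)] that e by (simp add: ennreal_le_iff)
      show "\<exists>d>0. \<forall>y\<in>{a..b}. dist y x < d \<longrightarrow>
          dist (real_of_ereal \<bar>u (\<gamma> y)\<bar>) (real_of_ereal \<bar>u (\<gamma> x)\<bar>) < e"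
      proof (intro exI[of _ d] conjI ballI impI d(1))
        fix y assume "y \<in> {a..b}" "dist y x < d"
        then show "dist (real_of_ereal \<bar>u (\<gamma> y)\<bar>) (real_of_ereal \<bar>u (\<gamma> x)\<bar>) < e"
          using *[of x y] *[of y x] x e by (cases "x \<le> y") (auto simp: dist_real_def abs_minus_commute)
      qed
    qed
    show "case c of (\<gamma>, a, b) \<Rightarrow> (\<forall>t\<in>{a..b}. \<bar>u (\<gamma> t)\<bar> \<noteq> \<infinity>) \<and> continuous_on {a..b} (\<lambda>t. real_of_ereal \<bar>u (\<gamma> t)\<bar>)"
      unfolding c' prod.case by (intro conjI ballI ut C)
  qed
qed

lemma newtonian_curve_continuous:
  assumes "0 < p" "u \<in> newtonian M p"
  shows "curve_continuous M p (\<lambda>x. real_of_ereal \<bar>u x\<bar>)"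
  unfolding curve_continuous_def
  by (rule ae_curve_mono[OF newtonian_finite_on_curves[OF assms]]) auto

text \<open>\<open>real_of_ereal\<close> sends infinity to \<open>0\<close> and could break the
  inequality, but almost every curve avoids infinite values. The given \<open>g\<close> may have
  infinite energy; finiteness of \<open>u\<close> comes from another weak upper gradient that is
  \<open>p\<close>-integrable.\<close>

lemma newtonian_weak_upper_gradient_abs:
  assumes p: "0 < p" and u: "u \<in> newtonian M p" and g: "weak_upper_gradient M p u g"
  shows "weak_upper_gradient M p (\<lambda>x. ereal (real_of_ereal \<bar>u x\<bar>)) g"
  unfolding weak_upper_gradient_ereal_iff
proof
  show "g \<in> borel_measurable M" using g by (simp add: weak_upper_gradient_def)
  have Q: "ae_curve M p (\<lambda>(\<gamma>, a, b). if \<bar>u (\<gamma> a)\<bar> \<noteq> \<infinity> \<and> \<bar>u (\<gamma> b)\<bar> \<noteq> \<infinity>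
           then eabs (u (\<gamma> a) - u (\<gamma> b)) \<le> curve_integral g (\<gamma>, a, b)
           else curve_integral g (\<gamma>, a, b) = \<infinity>)"
    using g unfolding weak_upper_gradient_def ae_curve_def by blast
  show "ae_curve M p (\<lambda>(\<gamma>, a, b). ennreal \<bar>real_of_ereal \<bar>u (\<gamma> a)\<bar> - real_of_ereal \<bar>u (\<gamma> b)\<bar>\<bar>
    \<le> curve_integral g (\<gamma>, a, b))"
  proof (rule ae_curve_mono[OF ae_curve_conj[OF p Q newtonian_finite_on_curves[OF p u]]], clarify)
    fix \<gamma> :: "real \<Rightarrow> 'a" and a b
    assume "(\<gamma>, a, b) \<in> curves" and fin: "\<forall>t\<in>{a..b}. \<bar>u (\<gamma> t)\<bar> \<noteq> \<infinity>"
      and Q: "if \<bar>u (\<gamma> a)\<bar> \<noteq> \<infinity> \<and> \<bar>u (\<gamma> b)\<bar> \<noteq> \<infinity>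
           then eabs (u (\<gamma> a) - u (\<gamma> b)) \<le> curve_integral g (\<gamma>, a, b)
           else curve_integral g (\<gamma>, a, b) = \<infinity>"
    interpret rectifiable \<gamma> a b using \<open>(\<gamma>, a, b) \<in> curves\<close> by (simp add: curves_iff)
    have "\<bar>u (\<gamma> a)\<bar> \<noteq> \<infinity>" "\<bar>u (\<gamma> b)\<bar> \<noteq> \<infinity>" using fin ab by auto
    then obtain x y where xy: "u (\<gamma> a) = ereal x" "u (\<gamma> b) = ereal y"
      by (cases "u (\<gamma> a)"; cases "u (\<gamma> b)") auto
    have "ennreal \<bar>\<bar>x\<bar> - \<bar>y\<bar>\<bar> \<le> ennreal \<bar>x - y\<bar>" by (intro ennreal_leI) auto
    also have "\<dots> \<le> curve_integral g (\<gamma>, a, b)" using Q xy by simp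
    finally show "ennreal \<bar>real_of_ereal \<bar>u (\<gamma> a)\<bar> - real_of_ereal \<bar>u (\<gamma> b)\<bar>\<bar> \<le> curve_integral g (\<gamma>, a, b)"
      using xy by simp
  qed
qed

end

section \<open>Vitali covering and a weak type estimate\<close>

lemma emeasure_UN_le_count_space:
  assumes I: "countable I" and X: "\<And>i. i \<in> I \<Longrightarrow> X i \<in> sets M"
  shows "emeasure M (\<Union>i\<in>I. X i) \<le> (\<integral>\<^sup>+i. emeasure M (X i) \<partial>count_space I)"
proof -
  have "(\<Union>i\<in>I. X i) \<in> sets M" using I X by (intro sets.countable_UN') auto
  then have "emeasure M (\<Union>i\<in>I. X i) = (\<integral>\<^sup>+x. indicator (\<Union>i\<in>I. X i) x \<partial>M)"
    by simp
  also have "\<dots> \<le> (\<integral>\<^sup>+x. (\<integral>\<^sup>+i. indicator (X i) x \<partial>count_space I) \<partial>M)"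
  proof (rule nn_integral_mono)
    fix x
    show "indicator (\<Union>i\<in>I. X i) x \<le> (\<integral>\<^sup>+i. indicator (X i) x \<partial>count_space I)"
    proof (cases "x \<in> (\<Union>i\<in>I. X i)")
      case True
      then obtain j where j: "j \<in> I" "x \<in> X j" by blast
      have "(1 :: ennreal) = (\<integral>\<^sup>+i. indicator {j} i \<partial>count_space I)"
        using j(1) by (simp add: nn_integral_indicator)
      also have "\<dots> \<le> (\<integral>\<^sup>+i. indicator (X i) x \<partial>count_space I)"
        using j by (intro nn_integral_mono) (auto simp: indicator_def)
      finally show ?thesis using True by simp
    qed simp
  qed
  also have "\<dots> = (\<integral>\<^sup>+i. emeasure M (X i) \<partial>count_space I)"
    using X by (subst nn_integral_count_space_nn_integral[OF I]) (auto intro!: nn_integral_cong)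
  finally show ?thesis .
qed

text \<open>Zorn's lemma selects disjoint balls such that every ball meeting the selection meets a
  member of at least half its radius. Bounded radii let a ball avoiding the selection be replaced by
  a nearly largest one, contradicting maximality.\<close>

lemma vitali_covering_balls:
  fixes F :: "('a::metric_space \<times> real) set"
  assumes F: "\<And>x r. (x, r) \<in> F \<Longrightarrow> 0 < r \<and> r \<le> R"
  obtains G where "G \<subseteq> F" "disjoint_family_on (\<lambda>(x, r). ball x r) G"
    "\<And>y s. (y, s) \<in> F \<Longrightarrow> \<exists>(x, r)\<in>G. ball y s \<subseteq> ball x (5 * r)"
proof -
  let ?B = "\<lambda>(x, r). ball x r"
  \<comment> \<open>The size condition concerns only balls that meet \<open>G\<close>. This makes
    \<open>Q\<close> closed under unions of chains.\<close>
  define Q where "Q = {G. G \<subseteq> F \<and> disjoint_family_on ?B G \<and>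
    (\<forall>B\<in>F. (\<exists>C\<in>G. ?B B \<inter> ?B C \<noteq> {}) \<longrightarrow> (\<exists>C\<in>G. ?B B \<inter> ?B C \<noteq> {} \<and> snd B \<le> 2 * snd C))}"
  have "\<exists>G\<in>Q. \<forall>X\<in>Q. G \<subseteq> X \<longrightarrow> X = G"
  proof (rule subset_Zorn')
    fix \<C> assume ch: "subset.chain Q \<C>"
    then have CQ: "\<C> \<subseteq> Q" and tot: "\<And>X Y. X \<in> \<C> \<Longrightarrow> Y \<in> \<C> \<Longrightarrow> X \<subseteq> Y \<or> Y \<subseteq> X"
      by (auto simp: subset_chain_def)
    have "disjoint_family_on ?B (\<Union>\<C>)"
      unfolding disjoint_family_on_def
    proof (intro ballI impI)
      fix m n assume mn: "m \<in> \<Union>\<C>" "n \<in> \<Union>\<C>" "m \<noteq> n"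
      then obtain X Y where XY: "X \<in> \<C>" "m \<in> X" "Y \<in> \<C>" "n \<in> Y" by blast
      obtain Z where "Z \<in> \<C>" "m \<in> Z" "n \<in> Z"
        using tot[OF XY(1,3)] XY by (elim disjE) (auto dest: subsetD)
      then have "disjoint_family_on ?B Z" "m \<in> Z" "n \<in> Z" using CQ by (auto simp: Q_def)
      then show "?B m \<inter> ?B n = {}" using mn(3) by (rule disjoint_family_onD)
    qed
    then show "\<Union>\<C> \<in> Q" using CQ unfolding Q_def by blast
  qed
  then obtain G where G: "G \<in> Q" and max: "\<And>X. X \<in> Q \<Longrightarrow> G \<subseteq> X \<Longrightarrow> X = G" by blast
  have meets: "\<exists>C\<in>G. ?B B \<inter> ?B C \<noteq> {}" if B: "B \<in> F" for B
  proof (rule ccontr)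
    assume not: "\<not> ?thesis"
    define N where "N = {B \<in> F. \<forall>C\<in>G. ?B B \<inter> ?B C = {}}"
    have BN: "B \<in> N" using B not by (simp add: N_def)
    have bdd: "bdd_above (snd ` N)" using F by (intro bdd_aboveI[of _ R]) (auto simp: N_def)
    have "0 < snd B" using F[of "fst B" "snd B"] B by simp
    moreover have "snd B \<le> Sup (snd ` N)" using BN bdd by (intro cSup_upper) auto
    ultimately have "Sup (snd ` N) / 2 < Sup (snd ` N)" by simp
    \<comment> \<open>More than half of the supremum of the radii: every other ball avoiding
      \<open>G\<close> then has at most twice the radius of \<open>C\<close>, so \<open>C\<close>
      can be added.\<close>
    then obtain C where C: "C \<in> N" "Sup (snd ` N) / 2 < snd C"
      using less_cSupE[of "Sup (snd ` N) / 2" "snd ` N"] BN by blast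
    have big: "snd A \<le> 2 * snd C" if "A \<in> N" for A
      using cSup_upper[of "snd A" "snd ` N"] that bdd C(2) by auto
    have C0: "0 < snd C" using F[of "fst C" "snd C"] C by (simp add: N_def)
    have Cne: "?B C \<noteq> {}" using C0 by (auto simp: case_prod_beta)
    have "C \<in> F" and dC: "\<And>D. D \<in> G \<Longrightarrow> ?B C \<inter> ?B D = {}" using C(1) by (auto simp: N_def)
    have "insert C G \<in> Q"
      unfolding Q_def
    proof (intro CollectI conjI ballI impI)
      show "insert C G \<subseteq> F" using G \<open>C \<in> F\<close> by (simp add: Q_def)
      show "disjoint_family_on ?B (insert C G)"
      proof -
        have "C \<notin> G" using dC[of C] Cne by auto
        moreover have "disjoint_family_on ?B G" using G unfolding Q_def by blast
        moreover have "?B C \<inter> (\<Union>D\<in>G. ?B D) = {}" using dC by blast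
        ultimately show ?thesis by (simp add: disjoint_family_on_insert)
      qed
      fix A assume A: "A \<in> F" "\<exists>D\<in>insert C G. ?B A \<inter> ?B D \<noteq> {}"
      show "\<exists>D\<in>insert C G. ?B A \<inter> ?B D \<noteq> {} \<and> snd A \<le> 2 * snd D"
      proof (cases "\<exists>D\<in>G. ?B A \<inter> ?B D \<noteq> {}")
        case True
        then have "\<exists>D\<in>G. ?B A \<inter> ?B D \<noteq> {} \<and> snd A \<le> 2 * snd D" using G A(1) unfolding Q_def by blast
        then show ?thesis by blast
      next
        case False
        then have "A \<in> N" using A(1) by (auto simp: N_def)
        moreover have "?B A \<inter> ?B C \<noteq> {}" using False A(2) by blast
        ultimately show ?thesis using big by blast
      qed
    qed
    then have "insert C G = G" by (rule max) auto
    then have "C \<in> G" by blast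
    from dC[OF this] show False using Cne by simp
  qed
  show ?thesis
  proof
    show "G \<subseteq> F" "disjoint_family_on ?B G" using G by (auto simp: Q_def)
    fix y s assume ys: "(y, s) \<in> F"
    then obtain x r where C: "(x, r) \<in> G" "ball y s \<inter> ball x r \<noteq> {}" "s \<le> 2 * r"
      using meets[OF ys] G unfolding Q_def by fastforce
    then obtain z where z: "dist y z < s" "dist x z < r" by auto
    \<comment> \<open>The factor arises from \<open>r + s + s\<close> with
      \<open>s \<le> 2 * r\<close>.\<close>
    have "ball y s \<subseteq> ball x (5 * r)"
    proof
      fix w assume "w \<in> ball y s"
      then have "dist y w < s" by simp
      moreover have "dist x w \<le> dist x z + dist y z + dist y w"
        using dist_triangle[of x w z] dist_triangle[of z w y] by (simp add: dist_commute)
      ultimately show "w \<in> ball x (5 * r)" using z C(3) by simp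
    qed
    then show "\<exists>(x, r)\<in>G. ball y s \<subseteq> ball x (5 * r)" using C(1) by blast
  qed
qed

context metric_measure
begin

text \<open>A ball of finite measure contains only finitely many disjoint balls of measure above
  \<open>1 / n\<close>. The bounds on centre and radius in \<open>H n\<close> place them all in one
  ball of radius \<open>2 * n\<close>.\<close>

lemma countable_disjoint_balls:
  fixes G :: "('a \<times> real) set"
  assumes disj: "disjoint_family_on (\<lambda>(x, r). ball x r) G" and pos: "\<And>x r. (x, r) \<in> G \<Longrightarrow> 0 < r"
  shows "countable G"
proof -
  define x0 :: 'a where "x0 = undefined"
  let ?B = "\<lambda>(x, r). ball x r"
  define H where "H n = {(x, r). (x, r) \<in> G \<and> dist x0 x < real n \<and> r < real n \<and> ennreal (1 / real n) < emeasure M (ball x r)}" for n :: nat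
  have "finite (H n)" if n: "n > 0" for n
  proof -
    obtain m where m: "emeasure M (ball x0 (2 * real n)) = ennreal m" "m \<ge> 0"
      using ball_finite[of x0 "2 * real n"] by (cases "emeasure M (ball x0 (2 * real n))") auto
    have "card K \<le> nat \<lceil>real n * m\<rceil>" if K: "K \<subseteq> H n" "finite K" for K
    proof -
      have "ennreal (real (card K) * (1 / real n)) = (\<Sum>i\<in>K. ennreal (1 / real n))"
        by (simp add: ennreal_mult[symmetric] ennreal_of_nat_eq_real_of_nat)
      also have "\<dots> \<le> (\<Sum>i\<in>K. emeasure M (?B i))"
        using K(1) by (intro sum_mono) (auto simp: H_def less_imp_le)
      also have "\<dots> = emeasure M (\<Union>i\<in>K. ?B i)"
      proof (rule sum_emeasure)
        show "disjoint_family_on ?B K"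
          by (rule disjoint_family_on_mono[OF _ disj]) (use K(1) in \<open>auto simp: H_def\<close>)
      qed (use K(2) in auto)
      also have "\<dots> \<le> emeasure M (ball x0 (2 * real n))"
      proof (rule emeasure_mono)
        show "(\<Union>i\<in>K. ?B i) \<subseteq> ball x0 (2 * real n)"
        proof clarify
          fix x y r assume "(x, r) \<in> K" "y \<in> ball x r"
          then have "dist x0 x < real n" "r < real n" "dist x y < r" using K(1) by (auto simp: H_def)
          then show "y \<in> ball x0 (2 * real n)" using dist_triangle[of x0 y x] by simp
        qed
      qed simp
      finally have "real (card K) * (1 / real n) \<le> m" using m by (simp add: ennreal_le_iff)
      then have "real (card K) \<le> real n * m" using n by (simp add: field_simps)
      then show ?thesis by linarith
    qed
    then show ?thesis using finite_if_finite_subsets_card_bdd by blast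
  qed
  then have "countable (\<Union>n\<in>{0<..}. H n)" by (intro countable_UN) (auto intro: countable_finite)
  moreover have "G \<subseteq> (\<Union>n\<in>{0<..}. H n)"
  proof clarify
    fix x r assume xr: "(x, r) \<in> G"
    have "0 < emeasure M (ball x r)" using ball_pos pos[OF xr] by simp
    moreover have "(\<lambda>n. ennreal (1 / real n)) \<longlonglongrightarrow> ennreal 0" by (intro tendsto_ennrealI lim_1_over_n)
    ultimately have "\<forall>\<^sub>F n in sequentially. ennreal (1 / real n) < emeasure M (ball x r)"
      by (intro order_tendstoD(2)[of _ "0::ennreal"]) auto
    moreover have "\<forall>\<^sub>F n in sequentially. dist x0 x < real n" "\<forall>\<^sub>F n in sequentially. r < real n"
      using filterlim_real_sequentially by (auto simp: filterlim_at_top_dense)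
    moreover have "\<forall>\<^sub>F n in sequentially. 0 < n" by (rule eventually_gt_at_top)
    ultimately have "\<forall>\<^sub>F n in sequentially. 0 < n \<and> (x, r) \<in> H n"
      by eventually_elim (use xr in \<open>auto simp: H_def\<close>)
    then obtain n where "0 < n" "(x, r) \<in> H n" unfolding eventually_sequentially by blast
    then show "(x, r) \<in> (\<Union>n\<in>{0<..}. H n)" by blast
  qed
  ultimately show ?thesis by (rule countable_subset[rotated])
qed

end

locale doubling_measure = metric_measure +
  fixes c\<^sub>D :: real
  assumes c_D: "1 \<le> c\<^sub>D"
    and doubling: "0 < r \<Longrightarrow> emeasure M (ball x (2 * r)) \<le> ennreal c\<^sub>D * emeasure M (ball x r)"
begin

lemma ball_5_le:
  assumes "0 < r"
  shows "emeasure M (ball x (5 * r)) \<le> ennreal (c\<^sub>D ^ 3) * emeasure M (ball x r)"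
proof -
  \<comment> \<open>Three doublings suffice, since \<open>5 \<le> 8\<close>.\<close>
  have "emeasure M (ball x (5 * r)) \<le> emeasure M (ball x (2 * (2 * (2 * r))))"
    using assms by (intro emeasure_mono subset_ball) auto
  also have "\<dots> \<le> ennreal c\<^sub>D * (ennreal c\<^sub>D * (ennreal c\<^sub>D * emeasure M (ball x r)))"
    using assms by (intro order_trans[OF doubling] mult_left_mono) auto
  also have "\<dots> = ennreal (c\<^sub>D ^ 3) * emeasure M (ball x r)"
    using c_D by (simp add: power3_eq_cube ennreal_mult mult.assoc)
  finally show ?thesis .
qed

text \<open>Disjoint Vitali balls charge disjoint parts of the integral, and their fivefold
  enlargements cover \<open>E\<close>. The radius bound \<open>R\<close> keeps the right-hand side
  local. With a measurable set \<open>E\<close> in place of a superlevel set, measurability of the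
  maximal function is no issue.\<close>

lemma maximal_weak_type:
  assumes f: "f \<in> borel_measurable M" and U: "U \<in> sets M" "\<And>x. x \<in> E \<Longrightarrow> ball x R \<subseteq> U"
    and E: "E \<in> sets M"
    and avg: "\<And>x. x \<in> E \<Longrightarrow> \<exists>r. 0 < r \<and> r \<le> R \<and> ennreal T * emeasure M (ball x r) \<le> (\<integral>\<^sup>+y\<in>ball x r. f y \<partial>M)"
  shows "ennreal T * emeasure M E \<le> ennreal (c\<^sub>D ^ 3) * (\<integral>\<^sup>+y\<in>U. f y \<partial>M)"
proof -
  let ?B = "\<lambda>(x, r). ball x r"
  let ?B5 = "\<lambda>(x, r). ball x (5 * r)"
  define F where "F = {(x, r). x \<in> E \<and> 0 < r \<and> r \<le> R \<and> ennreal T * emeasure M (ball x r) \<le> (\<integral>\<^sup>+y\<in>ball x r. f y \<partial>M)}"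
  obtain G where G: "G \<subseteq> F" "disjoint_family_on ?B G"
    "\<And>y s. (y, s) \<in> F \<Longrightarrow> \<exists>(x, r)\<in>G. ball y s \<subseteq> ball x (5 * r)"
    using vitali_covering_balls[of F R] by (auto simp: F_def)
  have pos: "0 < r" if "(x, r) \<in> G" for x r using that G(1) by (auto simp: F_def)
  have cG: "countable G" using G(2) pos by (rule countable_disjoint_balls)
  have "E \<subseteq> (\<Union>i\<in>G. ?B5 i)"
  proof
    fix y assume "y \<in> E"
    then obtain s where "0 < s" "(y, s) \<in> F" using avg by (auto simp: F_def)
    then show "y \<in> (\<Union>i\<in>G. ?B5 i)" using G(3)[of y s] by (force simp: subset_eq)
  qed
  then have "emeasure M E \<le> emeasure M (\<Union>i\<in>G. ?B5 i)"
    using cG by (intro emeasure_mono sets.countable_UN') auto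
  also have "\<dots> \<le> (\<integral>\<^sup>+i. emeasure M (?B5 i) \<partial>count_space G)"
    using cG by (intro emeasure_UN_le_count_space) auto
  also have "\<dots> \<le> (\<integral>\<^sup>+i. ennreal (c\<^sub>D ^ 3) * emeasure M (?B i) \<partial>count_space G)"
    using pos by (intro nn_integral_mono) (auto intro: ball_5_le)
  also have "\<dots> = ennreal (c\<^sub>D ^ 3) * (\<integral>\<^sup>+i. emeasure M (?B i) \<partial>count_space G)"
    by (rule nn_integral_cmult) simp
  finally have "ennreal T * emeasure M E \<le> ennreal T * (ennreal (c\<^sub>D ^ 3) * (\<integral>\<^sup>+i. emeasure M (?B i) \<partial>count_space G))"
    by (rule mult_left_mono) simp
  also have "\<dots> = ennreal (c\<^sub>D ^ 3) * (\<integral>\<^sup>+i. ennreal T * emeasure M (?B i) \<partial>count_space G)"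
    by (simp add: nn_integral_cmult ac_simps)
  also have "(\<integral>\<^sup>+i. ennreal T * emeasure M (?B i) \<partial>count_space G)
      \<le> (\<integral>\<^sup>+i. emeasure (density M f) (?B i) \<partial>count_space G)"
  proof (rule nn_integral_mono)
    fix i assume "i \<in> space (count_space G)"
    then have "i \<in> F" using G(1) by auto
    then show "ennreal T * emeasure M (?B i) \<le> emeasure (density M f) (?B i)"
      using f by (cases i) (auto simp: F_def emeasure_density)
  qed
  also have "\<dots> = emeasure (density M f) (\<Union>i\<in>G. ?B i)"
    using cG G(2) by (intro emeasure_UN_countable[symmetric]) auto
  also have "\<dots> \<le> emeasure (density M f) U"
  proof (rule emeasure_mono)
    show "(\<Union>i\<in>G. ?B i) \<subseteq> U"
    proof clarify
      fix x r y assume "(x, r) \<in> G" "y \<in> ball x r"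
      then have "x \<in> E" "y \<in> ball x R" using G(1) by (auto simp: F_def)
      then show "y \<in> U" using U(2) by blast
    qed
  qed (use U in simp)
  also have "\<dots> = (\<integral>\<^sup>+y\<in>U. f y \<partial>M)" using f U by (simp add: emeasure_density)
  finally show ?thesis by (simp add: mult_left_mono)
qed

end

section \<open>The layers of the domain\<close>

text \<open>For \<open>p \<ge> 1\<close> each term is at least twice its predecessor, so the last
  one dominates. The minimum strengthens the bound \<open>2 * v powr p\<close> enough for the
  induction to close.\<close>

lemma dyadic_sum_le:
  fixes v p :: real and m b :: int
  assumes p: "1 \<le> p" and v: "0 \<le> v" and "m \<le> b"
  shows "(\<Sum>k\<in>{m..b}. if 2 powr k < v then (2 powr k) powr p else 0) \<le> 2 * min v (2 powr b) powr p"
  using \<open>m \<le> b\<close>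
proof (induction b rule: int_ge_induct)
  case base
  then show ?case by (cases "2 powr m < v") (simp_all add: min_def)
next
  case (step b)
  have *: "{m..b + 1} = insert (b + 1) {m..b}" using step(1) by auto
  have two: "2 * (2 powr b) powr p \<le> (2 powr (b + 1)) powr p"
  proof -
    have "2 * (2 powr b) powr p \<le> 2 powr p * (2 powr b) powr p"
      using powr_mono[of 1 p "2 :: real"] p by (intro mult_right_mono) auto
    also have "\<dots> = (2 powr (b + 1)) powr p"
      by (simp add: powr_mult[symmetric] powr_add mult.commute)
    finally show ?thesis .
  qed
  show ?case
  proof (cases "2 powr (b + 1) < v")
    case True
    have "2 powr b \<le> (2 :: real) powr (b + 1)" by simp
    then have "2 powr b \<le> v" using True by linarith
    then have "min v (2 powr b) = 2 powr b" by simp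
    then show ?thesis using True step(2) two unfolding * by simp
  next
    case False
    have "min v (2 powr b) powr p \<le> min v (2 powr (b + 1)) powr p"
      using v p by (intro powr_mono2 min.mono) auto
    then show ?thesis using False step(2) unfolding * by simp
  qed
qed

locale pointwise_hardy_domain = doubling_measure M c\<^sub>D for M :: "'a::metric_space measure" and c\<^sub>D +
  fixes p :: real and \<Omega> :: "'a set" and c\<^sub>H L :: real
  assumes p: "1 < p" and open_\<Omega>: "open \<Omega>" and \<Omega>_ne: "\<Omega> \<noteq> UNIV"
    and c_H: "0 < c\<^sub>H" and L: "1 \<le> L"
    and pw: "u \<in> newtonian0 M p \<Omega> \<Longrightarrow> weak_upper_gradient M p u g \<Longrightarrow>
      AE x in M. x \<in> \<Omega> \<longrightarrow> eabs (u x) \<le> ennreal (c\<^sub>H * dist_compl \<Omega> x) *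
             epowr (restricted_maximal M (L * dist_compl \<Omega> x) (\<lambda>y. epowr (g y) p) x) (1 / p)"
begin

abbreviation d where "d \<equiv> dist_compl \<Omega>"

lemma p0: "0 < p" using p by simp

lemma d_nonneg: "0 \<le> d x"
  by (simp add: dist_compl_def infdist_nonneg)

text \<open>The complement must be nonempty: \<open>infdist\<close> to the empty set is
  \<open>0\<close> by convention.\<close>

lemma d_pos_iff: "0 < d x \<longleftrightarrow> x \<in> \<Omega>"
  using in_closed_iff_infdist_zero[of "- \<Omega>" x] open_\<Omega> \<Omega>_ne d_nonneg[of x]
  by (auto simp: dist_compl_def less_le)

lemma d_le: "d y \<le> d x + dist x y"
  using infdist_triangle[of y "- \<Omega>" x] by (simp add: dist_compl_def dist_commute)

lemma continuous_d: "continuous_on UNIV d"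
  unfolding dist_compl_def by (intro continuous_intros)

lemma d_measurable [measurable]: "d \<in> borel_measurable M"
  by (intro borel_measurable_M borel_measurable_continuous_onI continuous_d)

lemma d_less_sets [measurable]: "{x. d x < t} \<in> sets M"
proof -
  have "{x \<in> space M. d x < t} \<in> sets M" by measurable
  then show ?thesis by (simp add: space_M)
qed

definition layer :: "real \<Rightarrow> 'a set" where "layer t = {x. t / 2 \<le> d x \<and> d x < t}"

lemma layer_sets [measurable]: "layer t \<in> sets M"
proof -
  have "{x \<in> space M. t / 2 \<le> d x \<and> d x < t} \<in> sets M" by measurable
  then show ?thesis by (simp add: space_M layer_def)
qed

lemma \<Omega>_sets [measurable]: "\<Omega> \<in> sets M"
  using open_\<Omega> borel_sets by auto

text \<open>Where \<open>h \<ge> l\<close>, the pointwise inequality forces the maximal function of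
  the gradient energy to be large. In the layer the radii are at most \<open>L * t\<close>, so all
  balls stay below distance \<open>(1 + L) * t\<close> from the complement.\<close>

lemma layer_weak_type:
  assumes h: "(\<lambda>x. ereal (h x)) \<in> newtonian0 M p \<Omega>"
    and G: "weak_upper_gradient M p (\<lambda>x. ereal (h x)) G" and t: "0 < t" and l: "0 < l"
  shows "ennreal (l powr p) * emeasure M (layer t \<inter> {x. l \<le> h x})
    \<le> ennreal (2 * c\<^sub>H powr p * c\<^sub>D ^ 3 * t powr p) * (\<integral>\<^sup>+y\<in>{y. d y < (1 + L) * t}. epowr (G y) p \<partial>M)"
proof -
  have Gm [measurable]: "G \<in> borel_measurable M" using G by (simp add: weak_upper_gradient_def)
  have hm [measurable]: "h \<in> borel_measurable M"
    using h borel_measurable_real_of_ereal[of "\<lambda>x. ereal (h x)" M]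
    by (auto simp: newtonian0_def newtonian_def Lp_space_def)
  define E where "E = layer t \<inter> {x. l \<le> h x}"
  have "{x \<in> space M. l \<le> h x} \<in> sets M" by measurable
  then have E: "E \<in> sets M" unfolding E_def by (intro sets.Int layer_sets) (simp add: space_M)
  obtain N where N: "{x \<in> space M. \<not> (x \<in> \<Omega> \<longrightarrow> eabs (ereal (h x)) \<le> ennreal (c\<^sub>H * d x) *
             epowr (restricted_maximal M (L * d x) (\<lambda>y. epowr (G y) p) x) (1 / p))} \<subseteq> N"
    "emeasure M N = 0" "N \<in> sets M"
    using pw[OF h G] by (rule AE_E)
  \<comment> \<open>The maximal function is at least twice \<open>T\<close>. This slack gives a
    strict inequality, from which an actual radius is extracted; it is the factor \<open>2\<close>
    in the constant.\<close>
  define T where "T = (l / (c\<^sub>H * t)) powr p / 2"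
  have T: "0 < T" using l c_H t by (simp add: T_def)
  let ?U = "{y. d y < (1 + L) * t}"
  have "ennreal T * emeasure M (E - N) \<le> ennreal (c\<^sub>D ^ 3) * (\<integral>\<^sup>+y\<in>?U. epowr (G y) p \<partial>M)"
  proof (rule maximal_weak_type[where R = "L * t"])
    show "(\<lambda>y. epowr (G y) p) \<in> borel_measurable M" by measurable
    fix x assume "x \<in> E - N"
    then have x: "t / 2 \<le> d x" "d x < t" "l \<le> h x" "x \<notin> N" by (auto simp: E_def layer_def)
    show "ball x (L * t) \<subseteq> ?U"
    proof
      fix y assume "y \<in> ball x (L * t)"
      then show "y \<in> ?U" using d_le[of y x] x by (simp add: distrib_right)
    qed
    have dx: "0 < d x" using x t by simp
    then have "x \<in> \<Omega>" by (simp add: d_pos_iff)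
    let ?m = "restricted_maximal M (L * d x) (\<lambda>y. epowr (G y) p) x"
    have "eabs (ereal (h x)) \<le> ennreal (c\<^sub>H * d x) * epowr ?m (1 / p)"
      using N(1) x(4) \<open>x \<in> \<Omega>\<close> by (auto simp: space_M)
    moreover have "ennreal l \<le> eabs (ereal (h x))" using x(3) by (simp add: ennreal_leI)
    ultimately have "ennreal l \<le> ennreal (c\<^sub>H * d x) * epowr ?m (1 / p)" by (rule order_trans[rotated])
    also have "\<dots> \<le> ennreal (c\<^sub>H * t) * epowr ?m (1 / p)"
      using x(2) c_H by (intro mult_right_mono ennreal_leI) auto
    finally have "epowr (ennreal l) p \<le> epowr (ennreal (c\<^sub>H * t) * epowr ?m (1 / p)) p"
      using p0 by (intro epowr_mono)
    also have "\<dots> = ennreal ((c\<^sub>H * t) powr p) * ?m"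
      using p0 c_H t by (simp add: epowr_cmult epowr_inverse)
    finally have le: "ennreal (l powr p) \<le> ennreal ((c\<^sub>H * t) powr p) * ?m"
      using l by (simp add: epowr_ennreal)
    have "ennreal T < ?m"
    proof (rule ccontr)
      assume "\<not> ennreal T < ?m"
      then have "ennreal ((c\<^sub>H * t) powr p) * ?m \<le> ennreal ((c\<^sub>H * t) powr p) * ennreal T"
        by (intro mult_left_mono) auto
      with le have "ennreal (l powr p) \<le> ennreal ((c\<^sub>H * t) powr p * T)"
        using T by (simp add: ennreal_mult)
      then have "l powr p \<le> (c\<^sub>H * t) powr p * T" using T by (simp add: ennreal_le_iff)
      also have "\<dots> = l powr p / 2" using c_H t l by (simp add: T_def powr_divide)
      finally show False using l by simp
    qed
    then obtain r where r: "r \<in> {0<..L * d x}"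
      "ennreal T < (\<integral>\<^sup>+y\<in>ball x r. epowr (G y) p \<partial>M) / emeasure M (ball x r)"
      unfolding restricted_maximal_def less_SUP_iff by blast
    have "ennreal T * emeasure M (ball x r)
        \<le> (\<integral>\<^sup>+y\<in>ball x r. epowr (G y) p \<partial>M) / emeasure M (ball x r) * emeasure M (ball x r)"
      using r by (intro mult_right_mono) auto
    also have "\<dots> = (\<integral>\<^sup>+y\<in>ball x r. epowr (G y) p \<partial>M)"
      using ball_pos[of r x] ball_finite[of x r] r
      by (subst ennreal_divide_times) (simp add: ennreal_divide_self)
    finally show "\<exists>r. 0 < r \<and> r \<le> L * t \<and> ennreal T * emeasure M (ball x r)
        \<le> (\<integral>\<^sup>+y\<in>ball x r. epowr (G y) p \<partial>M)"
      using r x L by (intro exI[of _ r]) (auto intro: order_trans mult_left_mono)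
  qed (use E N in auto)
  moreover have "emeasure M (E - N) = emeasure M E"
    using E N by (intro emeasure_Diff_null_set) (auto simp: null_sets_def)
  ultimately have "ennreal T * emeasure M E \<le> ennreal (c\<^sub>D ^ 3) * (\<integral>\<^sup>+y\<in>?U. epowr (G y) p \<partial>M)" by simp
  then have "ennreal (2 * (c\<^sub>H * t) powr p) * (ennreal T * emeasure M E)
      \<le> ennreal (2 * (c\<^sub>H * t) powr p) * (ennreal (c\<^sub>D ^ 3) * (\<integral>\<^sup>+y\<in>?U. epowr (G y) p \<partial>M))"
    by (rule mult_left_mono) simp
  moreover have "2 * (c\<^sub>H * t) powr p * T = l powr p" using c_H t l by (simp add: T_def powr_divide)
  moreover have "2 * (c\<^sub>H * t) powr p * c\<^sub>D ^ 3 = 2 * c\<^sub>H powr p * c\<^sub>D ^ 3 * t powr p"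
    using c_H t by (simp add: powr_mult)
  ultimately show ?thesis
    using T c_D unfolding E_def by (simp add: mult.assoc[symmetric] ennreal_mult[symmetric])
qed

end

section \<open>Test functions for one dyadic band and one layer\<close>

context pointwise_hardy_domain
begin

text \<open>The minimum with \<open>a * \<eta>\<close> cuts off without multiplying functions: where
  \<open>\<eta> = 1\<close> it leaves the band truncation unchanged. The energy of \<open>g\<close>
  is restricted to \<open>\<Omega>\<close>, because it is only known to be finite there.\<close>

lemma truncation_newtonian:
  fixes u :: "'a \<Rightarrow> ereal" and \<eta> :: "'a \<Rightarrow> real" and e g :: "'a \<Rightarrow> ennreal" and a K :: real
  defines "v \<equiv> \<lambda>x. real_of_ereal \<bar>u x\<bar>"
  defines "h \<equiv> \<lambda>x. min (max a (min (2 * a) (v x)) - a) (a * \<eta> x)"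
  defines "G \<equiv> \<lambda>x. (g x * indicator {x. a < v x \<and> v x < 2 * a} x + ennreal a * e x) * indicator {x. 0 < h x \<and> h x < a} x"
  assumes u: "u \<in> newtonian0 M p \<Omega>" and g: "weak_upper_gradient M p u g"
    and fin: "(\<integral>\<^sup>+x\<in>\<Omega>. epowr (g x) p \<partial>M) < \<infinity>"
    and \<eta>: "\<And>x. 0 \<le> \<eta> x" "\<And>x. \<eta> x \<le> 1" "continuous_on UNIV \<eta>"
    and e: "weak_upper_gradient M p (\<lambda>x. ereal (\<eta> x)) e" "\<And>x. e x \<le> ennreal K" and K: "0 \<le> K"
    and a: "0 < a"
  shows "weak_upper_gradient M p (\<lambda>x. ereal (h x)) G"
    and "epowr (G x) p \<le> ennreal (2 powr p) * (epowr (g x) p * indicator (\<Omega> \<inter> {x. 0 < \<eta> x \<and> a < v x \<and> v x < 2 * a}) x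
       + ennreal (a powr p) * epowr (e x) p * indicator {x. 0 < \<eta> x \<and> a < v x} x)" (is "_ \<le> ?R x")
    and "(\<lambda>x. ereal (h x)) \<in> newtonian0 M p \<Omega>"
proof -
  have uN: "u \<in> newtonian M p" and u0: "\<And>x. x \<notin> \<Omega> \<Longrightarrow> u x = 0" using u by (auto simp: newtonian0_def)
  have um [measurable]: "u \<in> borel_measurable M" and up: "(\<integral>\<^sup>+x. epowr (eabs (u x)) p \<partial>M) < \<infinity>"
    using uN by (auto simp: newtonian_def Lp_space_def)
  have vm [measurable]: "v \<in> borel_measurable M" unfolding v_def by measurable
  have \<eta>m [measurable]: "\<eta> \<in> borel_measurable M"
    by (intro borel_measurable_M borel_measurable_continuous_onI \<eta>(3))
  have gm [measurable]: "g \<in> borel_measurable M" using g by (simp add: weak_upper_gradient_def)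
  have em [measurable]: "e \<in> borel_measurable M" using e by (simp add: weak_upper_gradient_def)
  have hm [measurable]: "h \<in> borel_measurable M" unfolding h_def by measurable
  have v0: "0 \<le> v x" for x by (simp add: v_def real_of_ereal_pos)
  have v\<Omega>: "x \<in> \<Omega>" if "0 < v x" for x using u0[of x] that by (cases "x \<in> \<Omega>") (auto simp: v_def)
  have vu: "ennreal (v x) \<le> eabs (u x)" for x
    unfolding v_def eabs_def by (cases "u x") auto
  have cv: "curve_continuous M p v" unfolding v_def by (rule newtonian_curve_continuous[OF p0 uN])
  have wv: "weak_upper_gradient M p (\<lambda>x. ereal (v x)) g"
    unfolding v_def by (rule newtonian_weak_upper_gradient_abs[OF p0 uN g])
  have h0: "0 \<le> h x" "h x \<le> a" for x unfolding h_def using a \<eta>(1,2)[of x] by (auto simp: min_def max_def)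
  have hpos: "0 < h x \<Longrightarrow> 0 < \<eta> x \<and> a < v x" for x
    unfolding h_def using a by (auto simp: zero_less_mult_iff less_max_iff_disj)
  have w1: "weak_upper_gradient M p (\<lambda>x. ereal (max a (min (2 * a) (v x)))) (\<lambda>x. g x * indicator {x. a < v x \<and> v x < 2 * a} x)"
    using a by (intro weak_upper_gradient_clamp[OF p0 cv vm wv]) auto
  have "\<bar>h x - h y\<bar> \<le> 1 * \<bar>max a (min (2 * a) (v x)) - max a (min (2 * a) (v y))\<bar> + a * \<bar>\<eta> x - \<eta> y\<bar>" for x y
  proof -
    have "\<bar>min s s' - min t t'\<bar> \<le> \<bar>s - t\<bar> + \<bar>s' - t'\<bar>" for s t s' t' :: real by (auto simp: min_def)
    from this[of "max a (min (2 * a) (v x)) - a" "a * \<eta> x" "max a (min (2 * a) (v y)) - a" "a * \<eta> y"]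
    have "\<bar>h x - h y\<bar> \<le> \<bar>max a (min (2 * a) (v x)) - a - (max a (min (2 * a) (v y)) - a)\<bar> + \<bar>a * \<eta> x - a * \<eta> y\<bar>"
      unfolding h_def .
    also have "\<bar>a * \<eta> x - a * \<eta> y\<bar> = a * \<bar>\<eta> x - \<eta> y\<bar>"
      using a by (simp add: right_diff_distrib[symmetric] abs_mult)
    finally show ?thesis by simp
  qed
  from weak_upper_gradient_lipschitz2[OF p0 w1 e(1) _ _ this]
  have wh: "weak_upper_gradient M p (\<lambda>x. ereal (h x)) (\<lambda>x. g x * indicator {x. a < v x \<and> v x < 2 * a} x + ennreal a * e x)"
    using a by simp
  have ch: "curve_continuous M p h"
    unfolding h_def
  proof (rule curve_continuous_min[OF p0])
    show "curve_continuous M p (\<lambda>x. max a (min (2 * a) (v x)) - a)"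
      by (rule curve_continuous_compose[OF cv]) (intro continuous_intros)
    show "curve_continuous M p (\<lambda>x. a * \<eta> x)"
      by (intro curve_continuous_continuous continuous_intros \<eta>(3))
  qed
  \<comment> \<open>\<open>h\<close> already takes values between \<open>0\<close> and
    \<open>a\<close>, so this truncation changes only the gradient. On \<open>0 < h\<close> both
    \<open>\<eta> > 0\<close> and \<open>v > a\<close> hold, hence the cutoff is charged only above
    the level \<open>a\<close>; without this the sum over bands would diverge.\<close>
  have "weak_upper_gradient M p (\<lambda>x. ereal (max 0 (min a (h x)))) G"
    unfolding G_def using a by (intro weak_upper_gradient_clamp[OF p0 ch hm wh]) auto
  then show wG: "weak_upper_gradient M p (\<lambda>x. ereal (h x)) G"
    using h0 by (simp add: min_absorb2 max_absorb2)
  then have Gm: "G \<in> borel_measurable M" by (simp add: weak_upper_gradient_def)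
  show GR: "epowr (G x) p \<le> ?R x" for x
  proof (cases "0 < h x")
    case True
    then have pos: "0 < \<eta> x" "a < v x" "x \<in> \<Omega>" using hpos[of x] v\<Omega>[of x] a by auto
    have "epowr (G x) p \<le> epowr (g x * indicator {x. a < v x \<and> v x < 2 * a} x + ennreal a * e x) p"
      unfolding G_def using p0 by (intro epowr_mono) (auto simp: indicator_def)
    also have "\<dots> \<le> ennreal (2 powr p) * (epowr (g x * indicator {x. a < v x \<and> v x < 2 * a} x) p + epowr (ennreal a * e x) p)"
      by (rule epowr_add_le[OF p0])
    also have "epowr (g x * indicator {x. a < v x \<and> v x < 2 * a} x) p
       = epowr (g x) p * indicator (\<Omega> \<inter> {x. 0 < \<eta> x \<and> a < v x \<and> v x < 2 * a}) x"
      using pos by (auto simp: indicator_def)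
    also have "epowr (ennreal a * e x) p = ennreal (a powr p) * epowr (e x) p * indicator {x. 0 < \<eta> x \<and> a < v x} x"
      using a pos by (simp add: epowr_cmult[OF p0])
    finally show ?thesis .
  next
    case False
    then show ?thesis by (simp add: G_def)
  qed
  have "(\<integral>\<^sup>+x. epowr (G x) p \<partial>M) \<le> (\<integral>\<^sup>+x. ennreal (2 powr p) * (epowr (g x) p * indicator \<Omega> x
      + ennreal (K powr p) * epowr (eabs (u x)) p) \<partial>M)"
  proof (rule nn_integral_mono)
    fix x
    have 1: "epowr (g x) p * indicator (\<Omega> \<inter> {x. 0 < \<eta> x \<and> a < v x \<and> v x < 2 * a}) x \<le> epowr (g x) p * indicator \<Omega> x"
      by (auto simp: indicator_def)
    \<comment> \<open>Above the level \<open>a\<close>, the constant \<open>a\<close> is at most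
      \<open>eabs (u x)\<close>, so a bounded gradient of the cutoff costs only the
      \<open>p\<close>-norm of \<open>u\<close>.\<close>
    have 2: "ennreal (a powr p) * epowr (e x) p * indicator {x. 0 < \<eta> x \<and> a < v x} x
      \<le> ennreal (K powr p) * epowr (eabs (u x)) p"
    proof (cases "a < v x")
      case True
      have "ennreal (a powr p) = epowr (ennreal a) p" using a by (simp add: epowr_ennreal)
      also have "\<dots> \<le> epowr (eabs (u x)) p"
        using True p0 by (intro epowr_mono order_trans[OF ennreal_leI vu[of x]]) auto
      finally have "ennreal (a powr p) \<le> epowr (eabs (u x)) p" .
      moreover have "epowr (e x) p \<le> ennreal (K powr p)"
        using epowr_mono[OF p0 e(2)[of x]] K by (simp add: epowr_ennreal)
      ultimately have "ennreal (a powr p) * epowr (e x) p \<le> epowr (eabs (u x)) p * ennreal (K powr p)"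
        by (intro mult_mono) auto
      then show ?thesis by (auto simp: indicator_def mult.commute)
    qed simp
    show "epowr (G x) p \<le> ennreal (2 powr p) * (epowr (g x) p * indicator \<Omega> x + ennreal (K powr p) * epowr (eabs (u x)) p)"
      by (rule order_trans[OF GR]) (intro mult_left_mono add_mono 1 2, simp)
  qed
  also have "\<dots> = ennreal (2 powr p) * ((\<integral>\<^sup>+x\<in>\<Omega>. epowr (g x) p \<partial>M)
      + ennreal (K powr p) * (\<integral>\<^sup>+x. epowr (eabs (u x)) p \<partial>M))"
    unfolding eabs_def by (simp add: nn_integral_cmult nn_integral_add)
  also have "\<dots> < \<infinity>" using fin up by (simp add: ennreal_mult_less_top)
  finally have Gfin: "(\<integral>\<^sup>+x. epowr (G x) p \<partial>M) < \<infinity>" .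
  have "(\<integral>\<^sup>+x. epowr (eabs (ereal (h x))) p \<partial>M) \<le> (\<integral>\<^sup>+x. epowr (eabs (u x)) p \<partial>M)"
  proof (intro nn_integral_mono epowr_mono p0)
    fix x
    have "h x \<le> max a (min (2 * a) (v x)) - a" by (simp add: h_def)
    also have "\<dots> \<le> v x" using a v0[of x] by (auto simp: min_def max_def)
    finally have "h x \<le> v x" .
    then have "eabs (ereal (h x)) \<le> ennreal (v x)" using h0[of x] by (simp add: ennreal_leI)
    then show "eabs (ereal (h x)) \<le> eabs (u x)" using vu order_trans by blast
  qed
  then have "(\<lambda>x. ereal (h x)) \<in> Lp_space M p"
    using up unfolding Lp_space_def by (auto intro: le_less_trans)
  moreover have "h x = 0" if "x \<notin> \<Omega>" for x
    using hpos[of x] h0(1)[of x] v\<Omega>[of x] that a by (cases "0 < h x") auto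
  ultimately show "(\<lambda>x. ereal (h x)) \<in> newtonian0 M p \<Omega>"
    using wG Gfin by (auto simp: newtonian0_def newtonian_def)
qed

end

lemma sum_at_most_one_le:
  fixes c :: ennreal
  assumes "finite S" "\<And>k l. k \<in> S \<Longrightarrow> l \<in> S \<Longrightarrow> P k \<Longrightarrow> P l \<Longrightarrow> k = l"
  shows "(\<Sum>k\<in>S. if P k then c else 0) \<le> c"
proof (cases "\<exists>k\<in>S. P k")
  case True
  then obtain k where k: "k \<in> S" "P k" by blast
  have "(\<Sum>l\<in>S. if P l then c else 0) = (\<Sum>l\<in>S. if l = k then c else 0)"
    using assms(2) k by (intro sum.cong) auto
  also have "\<dots> = c" using assms(1) k by simp
  finally show ?thesis by simp
next
  case False
  then have "(\<Sum>l\<in>S. if P l then c else 0) = 0" by (intro sum.neutral) auto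
  then show ?thesis by simp
qed

context pointwise_hardy_domain
begin

text \<open>Weak type estimates for the truncations of \<open>u\<close> to the dyadic bands of its values sum up to a
  strong type estimate, since the bands carry disjoint parts of the gradient.\<close>
lemma layer_strong_type:
  fixes u :: "'a \<Rightarrow> ereal" and \<eta> :: "'a \<Rightarrow> real" and e :: "'a \<Rightarrow> ennreal" and K t :: real
  defines "v \<equiv> \<lambda>x. real_of_ereal \<bar>u x\<bar>"
  assumes u: "u \<in> newtonian0 M p \<Omega>" and g: "weak_upper_gradient M p u g"
    and fin: "(\<integral>\<^sup>+x\<in>\<Omega>. epowr (g x) p \<partial>M) < \<infinity>"
    and \<eta>: "\<And>x. 0 \<le> \<eta> x" "\<And>x. \<eta> x \<le> 1" "continuous_on UNIV \<eta>"
    and e: "weak_upper_gradient M p (\<lambda>x. ereal (\<eta> x)) e" "\<And>x. e x \<le> ennreal K" and K: "0 \<le> K"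
    and t: "0 < t" and \<eta>1: "\<And>x. x \<in> layer t \<Longrightarrow> \<eta> x = 1"
  shows "(\<integral>\<^sup>+x\<in>layer t. ennreal (v x powr p) \<partial>M)
     \<le> ennreal (4 * 8 powr p * c\<^sub>H powr p * c\<^sub>D ^ 3 * t powr p) *
       (\<integral>\<^sup>+x\<in>{x. d x < (1 + L) * t \<and> 0 < \<eta> x}. (epowr (g x) p * indicator \<Omega> x + epowr (e x) p * ennreal (v x powr p)) \<partial>M)"
    (is "_ \<le> ?C * ?I")
proof -
  define a where "a k = 2 powr real_of_int k" for k :: int
  define h where "h k x = min (max (a k) (min (2 * a k) (v x)) - a k) (a k * \<eta> x)" for k x
  define G where "G k x = (g x * indicator {x. a k < v x \<and> v x < 2 * a k} x + ennreal (a k) * e x) * indicator {x. 0 < h k x \<and> h k x < a k} x" for k x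
  define C0 where "C0 = 2 * c\<^sub>H powr p * c\<^sub>D ^ 3 * t powr p"
  have C0: "0 \<le> C0" using c_D by (simp add: C0_def)
  have a: "0 < a k" for k by (simp add: a_def)
  have v_eq: "real_of_ereal \<bar>u x\<bar> = v x" for x by (simp add: v_def)
  note tr = truncation_newtonian[OF u g fin \<eta> e K a, unfolded v_eq, folded h_def, folded G_def]
  have um [measurable]: "u \<in> borel_measurable M"
    using u by (auto simp: newtonian0_def newtonian_def Lp_space_def)
  have vm [measurable]: "v \<in> borel_measurable M" unfolding v_def by measurable
  have \<eta>m [measurable]: "\<eta> \<in> borel_measurable M"
    by (intro borel_measurable_M borel_measurable_continuous_onI \<eta>(3))
  have gm [measurable]: "g \<in> borel_measurable M" using g by (simp add: weak_upper_gradient_def)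
  have em [measurable]: "e \<in> borel_measurable M" using e by (simp add: weak_upper_gradient_def)
  have v0: "0 \<le> v x" for x by (simp add: v_def real_of_ereal_pos)
  let ?U = "{x. d x < (1 + L) * t}"
  let ?V = "{x. d x < (1 + L) * t \<and> 0 < \<eta> x}"
  have sets [measurable]: "{x. s \<le> v x} \<in> sets M" "{x. s < v x} \<in> sets M" "{x. 0 < \<eta> x} \<in> sets M"
    "{x. s \<le> v x \<and> v x < s'} \<in> sets M" "{x. 0 < \<eta> x \<and> s < v x} \<in> sets M"
    "{x. 0 < \<eta> x \<and> s < v x \<and> v x < s'} \<in> sets M" for s s'
  proof -
    have "{x \<in> space M. s \<le> v x} \<in> sets M" "{x \<in> space M. s < v x} \<in> sets M" "{x \<in> space M. 0 < \<eta> x} \<in> sets M"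
      "{x \<in> space M. s \<le> v x \<and> v x < s'} \<in> sets M" "{x \<in> space M. 0 < \<eta> x \<and> s < v x} \<in> sets M"
      "{x \<in> space M. 0 < \<eta> x \<and> s < v x \<and> v x < s'} \<in> sets M"
      by measurable
    then show "{x. s \<le> v x} \<in> sets M" "{x. s < v x} \<in> sets M" "{x. 0 < \<eta> x} \<in> sets M"
      "{x. s \<le> v x \<and> v x < s'} \<in> sets M" "{x. 0 < \<eta> x \<and> s < v x} \<in> sets M"
      "{x. 0 < \<eta> x \<and> s < v x \<and> v x < s'} \<in> sets M"
      by (simp_all add: space_M)
  qed
  define R where "R k x = epowr (g x) p * indicator (\<Omega> \<inter> {x. 0 < \<eta> x \<and> a k < v x \<and> v x < 2 * a k}) x
       + ennreal (a k powr p) * epowr (e x) p * indicator {x. 0 < \<eta> x \<and> a k < v x} x" for k x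
  have Rm [measurable]: "R k \<in> borel_measurable M" for k unfolding R_def by measurable
  \<comment> \<open>On the layer \<open>\<eta> = 1\<close>, so \<open>h k\<close> attains its
    maximum \<open>a k\<close> wherever \<open>v\<close> exceeds the band.\<close>
  have weak: "ennreal (a k powr p) * emeasure M (layer t \<inter> {x. 2 * a k \<le> v x})
      \<le> ennreal C0 * (\<integral>\<^sup>+x\<in>?U. ennreal (2 powr p) * R k x \<partial>M)" for k
  proof -
    have "(\<lambda>x. h k x) \<in> borel_measurable M" unfolding h_def by measurable
    then have "{x \<in> space M. a k \<le> h k x} \<in> sets M" by measurable
    then have "{x. a k \<le> h k x} \<in> sets M" by (simp add: space_M)
    moreover have "a k \<le> h k x" if "x \<in> layer t" "2 * a k \<le> v x" for x
      using that \<eta>1[of x] a[of k] by (simp add: h_def min_def max_def)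
    ultimately have "emeasure M (layer t \<inter> {x. 2 * a k \<le> v x}) \<le> emeasure M (layer t \<inter> {x. a k \<le> h k x})"
      by (intro emeasure_mono) auto
    then have "ennreal (a k powr p) * emeasure M (layer t \<inter> {x. 2 * a k \<le> v x})
      \<le> ennreal (a k powr p) * emeasure M (layer t \<inter> {x. a k \<le> h k x})" by (rule mult_left_mono) simp
    also have "\<dots> \<le> ennreal C0 * (\<integral>\<^sup>+x\<in>?U. epowr (G k x) p \<partial>M)"
      unfolding C0_def by (rule layer_weak_type[OF tr(3) tr(1) t a])
    also have "\<dots> \<le> ennreal C0 * (\<integral>\<^sup>+x\<in>?U. ennreal (2 powr p) * R k x \<partial>M)"
      using tr(2) by (intro mult_left_mono nn_integral_mono mult_right_mono) (auto simp: R_def)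
    finally show ?thesis .
  qed
  \<comment> \<open>Values are first restricted to a compact range, so that finitely many bands
    suffice; monotone convergence removes the restriction.\<close>
  define f where "f N x = ennreal (v x powr p) * indicator (layer t \<inter> {x. 2 powr (1 - real N) \<le> v x \<and> v x < 2 powr real N}) x" for N :: nat and x
  have fm: "f N \<in> borel_measurable M" for N unfolding f_def by measurable
  have bound: "(\<integral>\<^sup>+x. f N x \<partial>M) \<le> ?C * ?I" for N
  proof -
    let ?S = "{- int N..int N}"
    have "(\<integral>\<^sup>+x. f N x \<partial>M) \<le> (\<integral>\<^sup>+x. ennreal (4 powr p) * (\<Sum>k\<in>?S. ennreal (a k powr p) * indicator (layer t \<inter> {x. 2 * a k \<le> v x}) x) \<partial>M)"
    proof (rule nn_integral_mono)
      fix x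
      show "f N x \<le> ennreal (4 powr p) * (\<Sum>k\<in>?S. ennreal (a k powr p) * indicator (layer t \<inter> {x. 2 * a k \<le> v x}) x)"
      proof (cases "x \<in> layer t \<and> 2 powr (1 - real N) \<le> v x \<and> v x < 2 powr real N")
        case True
        then have vpos: "0 < v x" using less_le_trans[of 0 "2 powr (1 - real N)" "v x"] by simp
        \<comment> \<open>The shift by one gives \<open>2 * a k \<le> v x \<le> 4 * a k\<close>:
          \<open>v x\<close> lies above the band, and the upper bound is the origin of
          \<open>4 powr p\<close>.\<close>
        define k where "k = \<lfloor>log 2 (v x)\<rfloor> - 1"
        have lv: "2 powr log 2 (v x) = v x" using vpos by simp
        have "2 * a k = 2 powr (real_of_int \<lfloor>log 2 (v x)\<rfloor>)" by (simp add: a_def k_def powr_diff)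
        also have "\<dots> \<le> 2 powr log 2 (v x)" by (intro powr_mono) auto
        finally have k1: "2 * a k \<le> v x" using lv by simp
        have "2 powr log 2 (v x) \<le> 2 powr (real_of_int \<lfloor>log 2 (v x)\<rfloor> + 1)" by (intro powr_mono) linarith+
        also have "\<dots> = 4 * a k" by (simp add: a_def k_def powr_diff powr_add)
        finally have k2: "v x \<le> 4 * a k" using lv by simp
        have "1 - real N \<le> log 2 (v x)" "log 2 (v x) < real N"
          using True vpos by (simp_all add: le_log_iff log_less_iff)
        then have kS: "k \<in> ?S" unfolding k_def by (simp add: le_floor_iff floor_less_iff) linarith
        have "f N x \<le> ennreal (v x powr p)" by (auto simp: f_def indicator_def)
        also have "\<dots> \<le> ennreal ((4 * a k) powr p)"
          using k2 p0 v0 by (intro ennreal_leI powr_mono2) auto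
        also have "\<dots> = ennreal (4 powr p) * (ennreal (a k powr p) * indicator (layer t \<inter> {x. 2 * a k \<le> v x}) x)"
          using True k1 a[of k] by (simp add: powr_mult ennreal_mult)
        also have "\<dots> \<le> ennreal (4 powr p) * (\<Sum>k\<in>?S. ennreal (a k powr p) * indicator (layer t \<inter> {x. 2 * a k \<le> v x}) x)"
          using kS by (intro mult_left_mono member_le_sum) auto
        finally show ?thesis .
      next
        case False
        then show ?thesis by (auto simp: f_def indicator_def)
      qed
    qed
    also have "\<dots> = ennreal (4 powr p) * (\<Sum>k\<in>?S. ennreal (a k powr p) * emeasure M (layer t \<inter> {x. 2 * a k \<le> v x}))"
    proof -
      let ?q = "\<lambda>k x. ennreal (a k powr p) * indicator (layer t \<inter> {x. 2 * a k \<le> v x}) x"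
      have m: "?q k \<in> borel_measurable M" for k by measurable
      have i: "(\<integral>\<^sup>+x. ?q k x \<partial>M) = ennreal (a k powr p) * emeasure M (layer t \<inter> {x. 2 * a k \<le> v x})" for k
        by (rule nn_integral_cmult_indicator) measurable
      have "(\<integral>\<^sup>+x. ennreal (4 powr p) * (\<Sum>k\<in>?S. ?q k x) \<partial>M) = ennreal (4 powr p) * (\<integral>\<^sup>+x. (\<Sum>k\<in>?S. ?q k x) \<partial>M)"
        using m by (intro nn_integral_cmult borel_measurable_sum) auto
      also have "(\<integral>\<^sup>+x. (\<Sum>k\<in>?S. ?q k x) \<partial>M) = (\<Sum>k\<in>?S. \<integral>\<^sup>+x. ?q k x \<partial>M)"
        using m by (intro nn_integral_sum) auto
      finally show ?thesis by (simp only: i)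
    qed
    also have "\<dots> \<le> ennreal (4 powr p) * (\<Sum>k\<in>?S. ennreal C0 * (\<integral>\<^sup>+x\<in>?U. ennreal (2 powr p) * R k x \<partial>M))"
      by (intro mult_left_mono sum_mono weak) simp
    also have "\<dots> = ennreal (4 powr p) * (ennreal C0 * (\<integral>\<^sup>+x. (\<Sum>k\<in>?S. ennreal (2 powr p) * R k x * indicator ?U x) \<partial>M))"
    proof -
      have "(\<integral>\<^sup>+x. (\<Sum>k\<in>?S. ennreal (2 powr p) * R k x * indicator ?U x) \<partial>M)
          = (\<Sum>k\<in>?S. \<integral>\<^sup>+x\<in>?U. ennreal (2 powr p) * R k x \<partial>M)"
        by (rule nn_integral_sum) measurable
      then show ?thesis by (simp only: sum_distrib_left)
    qed
    also have "\<dots> \<le> ennreal (4 powr p) * (ennreal C0 * (\<integral>\<^sup>+x. ennreal (2 * 2 powr p) *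
        ((epowr (g x) p * indicator \<Omega> x + epowr (e x) p * ennreal (v x powr p)) * indicator ?V x) \<partial>M))"
    proof (intro mult_left_mono nn_integral_mono)
      fix x
      have "(\<Sum>k\<in>?S. R k x) \<le> 2 * ((epowr (g x) p * indicator \<Omega> x + epowr (e x) p * ennreal (v x powr p)) * indicator {x. 0 < \<eta> x} x)"
      proof (cases "0 < \<eta> x")
        case True
        have "(\<Sum>k\<in>?S. R k x) = (\<Sum>k\<in>?S. if a k < v x \<and> v x < 2 * a k then epowr (g x) p * indicator \<Omega> x else 0)
            + (\<Sum>k\<in>?S. epowr (e x) p * ennreal (if a k < v x then a k powr p else 0))"
          unfolding sum.distrib[symmetric] R_def using True
          by (intro sum.cong) (auto simp: indicator_def mult.commute)
        \<comment> \<open>The open bands are disjoint, so \<open>g\<close> is charged at most once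
          however many bands are summed.\<close>
        also have "(\<Sum>k\<in>?S. if a k < v x \<and> v x < 2 * a k then epowr (g x) p * indicator \<Omega> x else 0) \<le> epowr (g x) p * indicator \<Omega> x"
        proof (rule sum_at_most_one_le)
          have less: "k < l + 1" if "a k < v x" "v x < 2 * a l" for k l
          proof -
            have "2 powr real_of_int k < 2 powr (real_of_int l + 1)"
              using that by (simp add: a_def powr_add)
            then have "real_of_int k < real_of_int l + 1" by simp
            then show ?thesis by linarith
          qed
          show "k = l" if "a k < v x \<and> v x < 2 * a k" "a l < v x \<and> v x < 2 * a l" for k l
            using less[of k l] less[of l k] that by auto
        qed simp
        also have "(\<Sum>k\<in>?S. epowr (e x) p * ennreal (if a k < v x then a k powr p else 0))
           = epowr (e x) p * ennreal (\<Sum>k\<in>?S. if a k < v x then a k powr p else 0)"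
          unfolding sum_distrib_left[symmetric] by (subst sum_ennreal) auto
        \<comment> \<open>The levels below \<open>v x\<close> form a geometric progression dominated
          by its last term.\<close>
        also have "\<dots> \<le> epowr (e x) p * ennreal (2 * v x powr p)"
        proof (intro mult_left_mono ennreal_leI)
          have "(\<Sum>k\<in>?S. if a k < v x then a k powr p else 0) \<le> 2 * min (v x) (2 powr (int N)) powr p"
            unfolding a_def using p v0 by (intro dyadic_sum_le) auto
          also have "\<dots> \<le> 2 * v x powr p" using p0 v0 by (intro mult_left_mono powr_mono2) auto
          finally show "(\<Sum>k\<in>?S. if a k < v x then a k powr p else 0) \<le> 2 * v x powr p" .
        qed simp
        also have "epowr (g x) p * indicator \<Omega> x + epowr (e x) p * ennreal (2 * v x powr p)
          \<le> 2 * (epowr (g x) p * indicator \<Omega> x) + 2 * (epowr (e x) p * ennreal (v x powr p))"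
        proof (rule add_mono)
          show "epowr (g x) p * indicator \<Omega> x \<le> 2 * (epowr (g x) p * indicator \<Omega> x)"
            unfolding mult_2 by simp
          show "epowr (e x) p * ennreal (2 * v x powr p) \<le> 2 * (epowr (e x) p * ennreal (v x powr p))"
            by (simp add: ennreal_mult ac_simps)
        qed
        finally show ?thesis using True by (simp add: distrib_left add_mono)
      next
        case False
        then have "R k x = 0" for k by (simp add: R_def)
        then show ?thesis by simp
      qed
      then have "ennreal (2 powr p) * (\<Sum>k\<in>?S. R k x) * indicator ?U x \<le> ennreal (2 powr p) * (2 * ((epowr (g x) p * indicator \<Omega> x + epowr (e x) p * ennreal (v x powr p)) * indicator {x. 0 < \<eta> x} x)) * indicator ?U x"
        by (intro mult_right_mono mult_left_mono) auto
      also have "\<dots> = ennreal (2 * 2 powr p) * ((epowr (g x) p * indicator \<Omega> x + epowr (e x) p * ennreal (v x powr p)) * indicator ?V x)"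
        by (simp add: ennreal_mult indicator_def ac_simps)
      finally show "(\<Sum>k\<in>?S. ennreal (2 powr p) * R k x * indicator ?U x) \<le> ennreal (2 * 2 powr p) *
        ((epowr (g x) p * indicator \<Omega> x + epowr (e x) p * ennreal (v x powr p)) * indicator ?V x)"
        by (simp add: sum_distrib_left sum_distrib_right)
    qed auto
    also have "\<dots> = ennreal (4 powr p) * (ennreal C0 * (ennreal (2 * 2 powr p) * ?I))"
    proof -
      have "{x. d x < (1 + L) * t \<and> 0 < \<eta> x} = {x. d x < (1 + L) * t} \<inter> {x. 0 < \<eta> x}" by auto
      then have [measurable]: "?V \<in> sets M" by simp
      show ?thesis by (simp add: nn_integral_cmult)
    qed
    also have "\<dots> = ?C * ?I"
    proof -
      \<comment> \<open>Here \<open>4 powr p\<close> comes from comparing values with levels and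
        \<open>2 powr p\<close> from \<open>epowr_add_le\<close>; the factor \<open>4\<close>
        combines the \<open>2\<close> of the weak estimate with that of the geometric sum.\<close>
      have "(4::real) powr p * 2 powr p = 8 powr p" by (simp add: powr_mult[symmetric])
      then have eq: "4 powr p * (C0 * (2 * 2 powr p)) = 4 * 8 powr p * c\<^sub>H powr p * c\<^sub>D ^ 3 * t powr p"
        unfolding C0_def by (simp add: algebra_simps)
      have "ennreal (4 powr p) * (ennreal C0 * (ennreal (2 * 2 powr p) * ?I))
          = ennreal (4 powr p * (C0 * (2 * 2 powr p))) * ?I"
        using C0 by (simp add: mult.assoc ennreal_mult)
      then show ?thesis by (simp only: eq)
    qed
    finally show ?thesis .
  qed
  have "(\<integral>\<^sup>+x\<in>layer t. ennreal (v x powr p) \<partial>M) = (\<integral>\<^sup>+x. (SUP N. f N x) \<partial>M)"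
  proof (rule nn_integral_cong)
    fix x
    show "ennreal (v x powr p) * indicator (layer t) x = (SUP N. f N x)"
    proof (rule antisym)
      show "(SUP N. f N x) \<le> ennreal (v x powr p) * indicator (layer t) x"
        by (intro SUP_least) (auto simp: f_def indicator_def)
      show "ennreal (v x powr p) * indicator (layer t) x \<le> (SUP N. f N x)"
      proof (cases "x \<in> layer t \<and> 0 < v x")
        case True
        obtain N where N: "\<bar>log 2 (v x)\<bar> + 1 < real N" using reals_Archimedean2 by blast
        then have "1 - real N \<le> log 2 (v x)" "log 2 (v x) < real N" by linarith+
        then have "2 powr (1 - real N) \<le> v x" "v x < 2 powr real N"
          using True by (simp_all add: le_log_iff log_less_iff)
        then have "ennreal (v x powr p) * indicator (layer t) x \<le> f N x" using True by (simp add: f_def)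
        also have "\<dots> \<le> (SUP N. f N x)" by (rule SUP_upper) simp
        finally show ?thesis .
      next
        case False
        then show ?thesis using v0[of x] by (auto simp: indicator_def)
      qed
    qed
  qed
  also have "\<dots> = (SUP N. \<integral>\<^sup>+x. f N x \<partial>M)"
  proof (rule nn_integral_monotone_convergence_SUP)
    show "incseq f"
    proof (intro incseq_SucI le_funI)
      fix N x
      have i: "2 powr (1 - real (Suc N)) \<le> (2::real) powr (1 - real N)" "2 powr real N \<le> (2::real) powr real (Suc N)"
        by (intro powr_mono; simp)+
      have "layer t \<inter> {x. 2 powr (1 - real N) \<le> v x \<and> v x < 2 powr real N}
        \<subseteq> layer t \<inter> {x. 2 powr (1 - real (Suc N)) \<le> v x \<and> v x < 2 powr real (Suc N)}"
        using order_trans[OF i(1)] less_le_trans[OF _ i(2)] by blast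
      then show "f N x \<le> f (Suc N) x"
        unfolding f_def by (intro mult_left_mono indicator_leI) auto
    qed
  qed (rule fm)
  also have "\<dots> \<le> ?C * ?I" by (intro SUP_least bound)
  finally show ?thesis .
qed

end

section \<open>Logarithmic cutoffs\<close>

context metric_measure
begin

lemma weak_upper_gradient_sum:
  assumes "0 < p" "finite S" "\<And>j. j \<in> S \<Longrightarrow> weak_upper_gradient M p (\<lambda>x. ereal (f j x)) (g j)"
  shows "weak_upper_gradient M p (\<lambda>x. ereal (\<Sum>j\<in>S. f j x)) (\<lambda>x. \<Sum>j\<in>S. g j x)"
  using assms(2,3)
proof (induction S rule: finite_induct)
  case empty
  then show ?case using weak_upper_gradient_const[of p 0] by simp
next
  case (insert j S)
  have "weak_upper_gradient M p (\<lambda>x. ereal (\<Sum>j\<in>insert j S. f j x)) (\<lambda>x. ennreal 1 * g j x + ennreal 1 * (\<Sum>j\<in>S. g j x))"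
  proof (rule weak_upper_gradient_lipschitz2[OF assms(1)])
    show "weak_upper_gradient M p (\<lambda>x. ereal (f j x)) (g j)" using insert.prems by simp
    show "weak_upper_gradient M p (\<lambda>x. ereal (\<Sum>j\<in>S. f j x)) (\<lambda>x. \<Sum>j\<in>S. g j x)"
      using insert.prems by (intro insert.IH) simp
  qed (use insert.hyps in auto)
  then show ?case using insert.hyps by simp
qed

end

section \<open>Dyadic layers and cutoffs descending through them\<close>

context pointwise_hardy_domain
begin

definition width :: "int \<Rightarrow> real" where "width n = 2 powr (- real_of_int n)"

abbreviation dlayer :: "int \<Rightarrow> 'a set" where "dlayer n \<equiv> layer (width n)"

lemma width_pos: "0 < width n"
  by (simp add: width_def)

lemma width_Suc: "width (n + 1) = width n / 2"
  by (simp add: width_def powr_diff powr_minus divide_simps)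

lemma width_antimono: "n \<le> m \<Longrightarrow> width m \<le> width n"
  by (simp add: width_def)

lemma dlayer_unique:
  assumes "x \<in> dlayer n" "x \<in> dlayer m"
  shows "n = m"
proof -
  have "\<not> n < m" if "x \<in> dlayer n" "x \<in> dlayer m" for n m
    using that width_antimono[of "n + 1" m] by (auto simp: layer_def width_Suc)
  then show ?thesis using assms by (meson linorder_neqE)
qed

lemma dlayer_exists:
  assumes "0 < d x"
  obtains n where "x \<in> dlayer n"
proof
  define s where "s = - log 2 (d x)"
  have "d x = 2 powr (- s)" using assms by (simp add: s_def)
  moreover have "2 powr (- s) < width (\<lceil>s\<rceil> - 1)" unfolding width_def by simp linarith
  moreover have "width \<lceil>s\<rceil> \<le> 2 powr (- s)" unfolding width_def by simp
  moreover have "width \<lceil>s\<rceil> = width (\<lceil>s\<rceil> - 1) / 2" using width_Suc[of "\<lceil>s\<rceil> - 1"] by simp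
  ultimately show "x \<in> dlayer (\<lceil>s\<rceil> - 1)" by (simp add: layer_def)
qed

text \<open>A piecewise linear logarithm of the distance: each of the \<open>N\<close> layers below
  layer \<open>n\<close> contributes a ramp of height \<open>1 / N\<close>, climbed over half the
  width of that layer.\<close>

definition cutoff :: "nat \<Rightarrow> int \<Rightarrow> 'a \<Rightarrow> real" where
  "cutoff N n x = (\<Sum>j\<in>{1..int N}. (max (width (n + j) / 2) (min (width (n + j)) (d x)) - width (n + j) / 2)
     * (2 / (N * width (n + j))))"

definition cutoff_grad :: "nat \<Rightarrow> int \<Rightarrow> 'a \<Rightarrow> ennreal" where
  "cutoff_grad N n x = (\<Sum>j\<in>{1..int N}. ennreal (2 / (N * width (n + j))) * indicator (dlayer (n + j)) x)"

lemma cutoff_term_bounds: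
  fixes N :: nat
  assumes "0 < N"
  shows "0 \<le> (max (width j / 2) (min (width j) s) - width j / 2) * (2 / (N * width j))"
    and "(max (width j / 2) (min (width j) s) - width j / 2) * (2 / (N * width j)) \<le> 1 / N"
    and "width j \<le> s \<Longrightarrow> (max (width j / 2) (min (width j) s) - width j / 2) * (2 / (N * width j)) = 1 / N"
    and "s \<le> width j / 2 \<Longrightarrow> (max (width j / 2) (min (width j) s) - width j / 2) * (2 / (N * width j)) = 0"
proof -
  let ?c = "2 / (N * width j)"
  have c: "0 \<le> ?c" "width j / 2 * ?c = 1 / N" using width_pos[of j] assms by (auto simp: field_simps)
  show "0 \<le> (max (width j / 2) (min (width j) s) - width j / 2) * ?c"
    using c(1) by (intro mult_nonneg_nonneg) auto
  have "max (width j / 2) (min (width j) s) - width j / 2 \<le> width j / 2"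
    using width_pos[of j] by auto
  from mult_right_mono[OF this c(1)] show "(max (width j / 2) (min (width j) s) - width j / 2) * ?c \<le> 1 / N"
    unfolding c(2) .
  show "(max (width j / 2) (min (width j) s) - width j / 2) * ?c = 1 / N" if "width j \<le> s"
  proof -
    have "max (width j / 2) (min (width j) s) - width j / 2 = width j / 2"
      using that width_pos[of j] by auto
    then show ?thesis unfolding c(2)[symmetric] by simp
  qed
  show "(max (width j / 2) (min (width j) s) - width j / 2) * ?c = 0" if "s \<le> width j / 2"
    using that by (simp add: max_def)
qed

lemma cutoff_bounds:
  assumes N: "0 < N"
  shows "0 \<le> cutoff N n x" "cutoff N n x \<le> 1" "x \<in> dlayer n \<Longrightarrow> cutoff N n x = 1"
    "0 < cutoff N n x \<Longrightarrow> width (n + int N + 1) < d x"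
proof -
  show "0 \<le> cutoff N n x" unfolding cutoff_def by (intro sum_nonneg cutoff_term_bounds(1) N)
  have "cutoff N n x \<le> (\<Sum>j\<in>{1..int N}. 1 / real N)"
    unfolding cutoff_def by (intro sum_mono cutoff_term_bounds(2) N)
  then show "cutoff N n x \<le> 1" using N by simp
  show "cutoff N n x = 1" if "x \<in> dlayer n"
  proof -
    have "cutoff N n x = (\<Sum>j\<in>{1..int N}. 1 / real N)"
      unfolding cutoff_def
    proof (intro sum.cong refl cutoff_term_bounds(3) N)
      fix j assume "j \<in> {1..int N}"
      then show "width (n + j) \<le> d x"
        using that width_antimono[of "n + 1" "n + j"] by (auto simp: layer_def width_Suc)
    qed
    then show ?thesis using N by simp
  qed
  show "width (n + int N + 1) < d x" if pos: "0 < cutoff N n x"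
  proof (rule ccontr)
    assume "\<not> width (n + int N + 1) < d x"
    \<comment> \<open>\<open>width (n + int N + 1)\<close> is the lower edge of the lowest ramp,
      hence of all ramps.\<close>
    then have le: "d x \<le> width (n + int N) / 2" by (simp add: width_Suc)
    have "cutoff N n x = 0"
      unfolding cutoff_def
    proof (intro sum.neutral ballI cutoff_term_bounds(4) N)
      fix j assume "j \<in> {1..int N}"
      then show "d x \<le> width (n + j) / 2"
        using le width_antimono[of "n + j" "n + int N"] by auto
    qed
    then show False using pos by simp
  qed
qed

lemma continuous_cutoff: "continuous_on UNIV (cutoff N n)"
  unfolding cutoff_def by (intro continuous_intros continuous_d)

lemma weak_upper_gradient_cutoff:
  assumes N: "0 < N"
  shows "weak_upper_gradient M p (\<lambda>x. ereal (cutoff N n x)) (cutoff_grad N n)"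
  unfolding cutoff_def cutoff_grad_def
proof (intro weak_upper_gradient_sum p0)
  fix j
  let ?t = "width (n + j)" and ?c = "2 / (N * width (n + j))"
  have c: "0 \<le> ?c" using width_pos[of "n + j"] by simp
  have wd: "weak_upper_gradient M p (\<lambda>x. ereal (d x)) (\<lambda>x. 1)"
    unfolding dist_compl_def by (rule weak_upper_gradient_infdist)
  have w: "weak_upper_gradient M p (\<lambda>x. ereal (max (?t / 2) (min ?t (d x)))) (\<lambda>x. 1 * indicator {x. ?t / 2 < d x \<and> d x < ?t} x)"
    using width_pos[of "n + j"]
    by (intro weak_upper_gradient_clamp[OF p0 curve_continuous_continuous[OF continuous_d] d_measurable wd]) simp
  have "weak_upper_gradient M p (\<lambda>x. ereal ((max (?t / 2) (min ?t (d x)) - ?t / 2) * ?c))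
      (\<lambda>x. ennreal ?c * (1 * indicator {x. ?t / 2 < d x \<and> d x < ?t} x) + ennreal 0 * 0)"
  proof (rule weak_upper_gradient_lipschitz2[OF p0 w weak_upper_gradient_const[of p 0] c])
    fix x y
    have "(max (?t / 2) (min ?t (d x)) - ?t / 2) * ?c - (max (?t / 2) (min ?t (d y)) - ?t / 2) * ?c
       = ?c * (max (?t / 2) (min ?t (d x)) - max (?t / 2) (min ?t (d y)))" by (simp add: algebra_simps)
    then show "\<bar>(max (?t / 2) (min ?t (d x)) - ?t / 2) * ?c - (max (?t / 2) (min ?t (d y)) - ?t / 2) * ?c\<bar>
        \<le> ?c * \<bar>max (?t / 2) (min ?t (d x)) - max (?t / 2) (min ?t (d y))\<bar> + 0 * \<bar>0 - 0\<bar>"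
      using c by (simp only: abs_mult) simp
  qed simp
  then show "weak_upper_gradient M p (\<lambda>x. ereal ((max (?t / 2) (min ?t (d x)) - ?t / 2) * ?c))
      (\<lambda>x. ennreal ?c * indicator (dlayer (n + j)) x)"
    \<comment> \<open>The open band is enlarged to the half-open layer, so that the supports of the
      terms partition the range of descent.\<close>
    by (rule weak_upper_gradient_mono) (auto simp: indicator_def layer_def)
qed simp

lemma cutoff_grad_le:
  assumes "0 < N"
  shows "cutoff_grad N n x \<le> ennreal (\<Sum>j\<in>{1..int N}. 2 / (N * width (n + j)))"
proof -
  have "cutoff_grad N n x \<le> (\<Sum>j\<in>{1..int N}. ennreal (2 / (N * width (n + j))))"
    unfolding cutoff_grad_def by (intro sum_mono) (auto simp: indicator_def)
  also have "\<dots> = ennreal (\<Sum>j\<in>{1..int N}. 2 / (N * width (n + j)))"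
    by (intro sum_ennreal) (simp add: width_pos less_imp_le)
  finally show ?thesis .
qed

text \<open>At most one term of the gradient is nonzero at a point, so the power passes through the
  sum. Since \<open>d\<close> is below the width of its layer, the slope is at most
  \<open>2 / (N * d)\<close>, and the weight \<open>1 / d powr p\<close> of the Hardy integral
  appears.\<close>

lemma epowr_cutoff_grad_le:
  assumes N: "0 < N" and s: "0 \<le> s"
  shows "epowr (cutoff_grad N n x) p * ennreal (s powr p)
    \<le> ennreal ((2 / N) powr p) * (\<Sum>j\<in>{1..int N}. ennreal (s powr p / d x powr p) * indicator (dlayer (n + j)) x)"
proof (cases "\<exists>j\<in>{1..int N}. x \<in> dlayer (n + j)")
  case True
  then obtain j where j: "j \<in> {1..int N}" "x \<in> dlayer (n + j)" by blast
  have dx: "0 < d x" using j(2) width_pos[of "n + j"] by (auto simp: layer_def)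
  have uniq: "x \<in> dlayer (n + i) \<longleftrightarrow> i = j" for i
    using dlayer_unique[OF j(2), of "n + i"] j(2) by auto
  have "cutoff_grad N n x = (\<Sum>i\<in>{1..int N}. if i = j then ennreal (2 / (N * width (n + j))) else 0)"
    unfolding cutoff_grad_def by (intro sum.cong) (auto simp: indicator_def uniq)
  also have "\<dots> = ennreal (2 / (N * width (n + j)))" using j(1) by simp
  also have "\<dots> \<le> ennreal ((2 / N) / d x)"
  proof (rule ennreal_leI)
    have "d x \<le> width (n + j)" using j(2) by (simp add: layer_def)
    then have "(2 / N) / width (n + j) \<le> (2 / N) / d x" using dx by (intro divide_left_mono) (auto simp: width_pos)
    then show "2 / (N * width (n + j)) \<le> (2 / N) / d x" by simp
  qed
  finally have "epowr (cutoff_grad N n x) p \<le> epowr (ennreal ((2 / N) / d x)) p"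
    by (rule epowr_mono[OF p0])
  also have "\<dots> = ennreal ((2 / N) powr p / d x powr p)"
    using dx N by (simp add: epowr_ennreal powr_divide powr_mult)
  finally have "epowr (cutoff_grad N n x) p * ennreal (s powr p) \<le> ennreal ((2 / N) powr p / d x powr p) * ennreal (s powr p)"
    by (rule mult_right_mono) simp
  also have "\<dots> = ennreal ((2 / N) powr p) * ennreal (s powr p / d x powr p)"
    by (simp add: ennreal_mult[symmetric])
  also have "ennreal (s powr p / d x powr p) = (\<Sum>i\<in>{1..int N}. if i = j then ennreal (s powr p / d x powr p) else 0)"
    using j(1) by simp
  also have "\<dots> = (\<Sum>i\<in>{1..int N}. ennreal (s powr p / d x powr p) * indicator (dlayer (n + i)) x)"
    by (intro sum.cong) (auto simp: indicator_def uniq)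
  finally show ?thesis .
next
  case False
  then have "cutoff_grad N n x = 0" unfolding cutoff_grad_def by (intro sum.neutral) auto
  then show ?thesis by simp
qed

text \<open>On a logarithmic scale the two inequalities confine \<open>n\<close> to
  \<open>N + c + 1\<close> consecutive integers. The lower cutoff thus gives finite overlap, where
  an uncut gradient would be seen by every layer above it.\<close>

lemma card_layers_le:
  assumes c: "1 + L \<le> 2 ^ c" and "finite S"
  shows "(\<Sum>n\<in>S. indicator {x. width (n + int N + 1) < d x \<and> d x < (1 + L) * width n} x) \<le> (of_nat (N + c + 1) :: ennreal)"
proof -
  \<comment> \<open>For \<open>d x = 0\<close> this value is irrelevant, since no \<open>n\<close>
    satisfies the condition then.\<close>
  define k where "k = \<lfloor>- log 2 (d x)\<rfloor>"
  let ?P = "\<lambda>n. width (n + int N + 1) < d x \<and> d x < (1 + L) * width n"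
  have "{n \<in> S. ?P n} \<subseteq> {k - int N..k + int c}"
  proof
    fix n assume "n \<in> {n \<in> S. ?P n}"
    then have n: "width (n + int N + 1) < d x" "d x < (1 + L) * width n" by auto
    have dx: "0 < d x" using n(1) width_pos[of "n + int N + 1"] by simp
    then have d: "d x = 2 powr (log 2 (d x))" by simp
    have "2 powr (- real_of_int (n + int N + 1)) < 2 powr (log 2 (d x))"
      using n(1) d by (simp add: width_def)
    then have 1: "- real_of_int (n + int N + 1) < log 2 (d x)" by simp
    have "d x < 2 ^ c * width n"
      using width_pos[of n] by (intro less_le_trans[OF n(2)] mult_right_mono c) simp
    also have "\<dots> = 2 powr (real c - real_of_int n)"
      by (simp add: width_def powr_diff powr_minus powr_realpow divide_simps)
    finally have "2 powr (log 2 (d x)) < 2 powr (real c - real_of_int n)" using d by simp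
    then have 2: "log 2 (d x) < real c - real_of_int n" by simp
    show "n \<in> {k - int N..k + int c}"
      using 1 2 unfolding k_def by simp linarith
  qed
  then have "card {n \<in> S. ?P n} \<le> card {k - int N..k + int c}" by (intro card_mono) auto
  then have card: "card {n \<in> S. ?P n} \<le> N + c + 1" by simp
  have "(\<Sum>n\<in>S. indicator {x. width (n + int N + 1) < d x \<and> d x < (1 + L) * width n} x) = (of_nat (card {n \<in> S. ?P n}) :: ennreal)"
  proof -
    have "(\<Sum>n\<in>S. indicator {x. width (n + int N + 1) < d x \<and> d x < (1 + L) * width n} x) = (\<Sum>n\<in>S. if ?P n then 1 else (0 :: ennreal))"
      by (intro sum.cong) (auto simp: indicator_def)
    also have "\<dots> = (\<Sum>n\<in>{n \<in> S. ?P n}. 1)" by (rule sum.inter_filter[OF \<open>finite S\<close>, symmetric])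
    finally show ?thesis by simp
  qed
  also have "\<dots> \<le> of_nat (N + c + 1)" using card by (rule of_nat_mono)
  finally show ?thesis .
qed

end

section \<open>Absorption\<close>

lemma ennreal_absorb:
  fixes X Y :: ennreal
  assumes "X \<le> Y + ennreal (1 / 2) * X" "X < \<infinity>"
  shows "X \<le> 2 * Y"
proof (cases Y)
  case (real y)
  obtain x where x: "X = ennreal x" "0 \<le> x" using assms(2) by (cases X) auto
  have "ennreal x \<le> ennreal (y + 1 / 2 * x)"
    using assms(1) x real by (simp add: ennreal_mult[symmetric] ennreal_plus[symmetric] del: ennreal_plus ennreal_half)
  then have "x \<le> y + 1 / 2 * x" using x real by (subst (asm) ennreal_le_iff) auto
  then have "ennreal x \<le> ennreal (2 * y)" by (intro ennreal_leI) simp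
  then show ?thesis using x real by (simp add: ennreal_mult)
next
  case top
  then show ?thesis by (simp add: ennreal_mult_top)
qed

context pointwise_hardy_domain
begin

text \<open>A finite quotient, equal to \<open>0\<close> by convention where \<open>u\<close> is
  infinite or \<open>d\<close> vanishes; it agrees with the Hardy integrand almost everywhere in
  \<open>\<Omega>\<close>.\<close>

definition hardy_density :: "('a \<Rightarrow> ereal) \<Rightarrow> 'a \<Rightarrow> ennreal" where
  "hardy_density u x = ennreal (real_of_ereal \<bar>u x\<bar> powr p / d x powr p)"

text \<open>\<open>16 powr p\<close> is the \<open>8 powr p\<close> of
  \<open>layer_strong_type\<close> times \<open>2 powr p\<close>, since in a layer \<open>d\<close>
  is at least half the width.\<close>

definition layer_const :: real where
  "layer_const = 4 * 16 powr p * c\<^sub>H powr p * c\<^sub>D ^ 3"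

lemma layer_const_nonneg: "0 \<le> layer_const"
  using c_D by (simp add: layer_const_def)

section \<open>Hardy integrals over the layers of one function\<close>

context
  fixes u :: "'a \<Rightarrow> ereal" and g :: "'a \<Rightarrow> ennreal"
  assumes u: "u \<in> newtonian0 M p \<Omega>" and g: "weak_upper_gradient M p u g"
    and fin: "(\<integral>\<^sup>+x\<in>\<Omega>. epowr (g x) p \<partial>M) < \<infinity>"
begin

abbreviation (input) "v \<equiv> \<lambda>x. real_of_ereal \<bar>u x\<bar>"
abbreviation (input) "energy \<equiv> \<integral>\<^sup>+x\<in>\<Omega>. epowr (g x) p \<partial>M"
abbreviation (input) "J n \<equiv> \<integral>\<^sup>+x\<in>dlayer n. hardy_density u x \<partial>M"

lemma u_measurable [measurable]: "u \<in> borel_measurable M"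
  using u by (auto simp: newtonian0_def newtonian_def Lp_space_def)

lemma g_measurable [measurable]: "g \<in> borel_measurable M"
  using g by (simp add: weak_upper_gradient_def)

lemma hardy_density_measurable [measurable]: "hardy_density u \<in> borel_measurable M"
  unfolding hardy_density_def by measurable

lemma J_le: "J n \<le> ennreal ((2 / width n) powr p) * (\<integral>\<^sup>+x\<in>dlayer n. ennreal (v x powr p) \<partial>M)"
proof -
  have "J n \<le> (\<integral>\<^sup>+x. ennreal ((2 / width n) powr p) * (ennreal (v x powr p) * indicator (dlayer n) x) \<partial>M)"
  proof (rule nn_integral_mono)
    fix x
    show "hardy_density u x * indicator (dlayer n) x
      \<le> ennreal ((2 / width n) powr p) * (ennreal (v x powr p) * indicator (dlayer n) x)"
    proof (cases "x \<in> dlayer n")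
      case True
      then have dx: "width n / 2 \<le> d x" by (simp add: layer_def)
      have "v x powr p / d x powr p \<le> v x powr p / (width n / 2) powr p"
        using dx width_pos[of n] p0 by (intro divide_left_mono powr_mono2 mult_pos_pos) auto
      also have "\<dots> = (2 / width n) powr p * v x powr p"
        using width_pos[of n] by (simp add: powr_divide)
      finally show ?thesis using True by (simp add: hardy_density_def ennreal_mult[symmetric] ennreal_leI)
    qed simp
  qed
  also have "\<dots> = ennreal ((2 / width n) powr p) * (\<integral>\<^sup>+x\<in>dlayer n. ennreal (v x powr p) \<partial>M)"
    by (rule nn_integral_cmult) measurable
  finally show ?thesis .
qed

text \<open>In one layer the distance is bounded below, so \<open>p\<close>-integrability of
  \<open>u\<close> suffices. This finiteness legitimizes the absorption.\<close>

lemma J_finite: "J n < \<infinity>"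
proof -
  have "(\<integral>\<^sup>+x\<in>dlayer n. ennreal (v x powr p) \<partial>M) \<le> (\<integral>\<^sup>+x. epowr (eabs (u x)) p \<partial>M)"
  proof (rule nn_integral_mono)
    fix x
    have "ennreal (v x powr p) = epowr (ennreal (v x)) p" by (simp add: epowr_ennreal real_of_ereal_pos)
    also have "\<dots> \<le> epowr (eabs (u x)) p"
      unfolding eabs_def by (intro epowr_mono p0) (cases "u x"; simp)
    finally show "ennreal (v x powr p) * indicator (dlayer n) x \<le> epowr (eabs (u x)) p"
      by (auto simp: indicator_def)
  qed
  also have "\<dots> < \<infinity>" using u by (auto simp: newtonian0_def newtonian_def Lp_space_def)
  finally show ?thesis by (intro le_less_trans[OF J_le]) (simp add: ennreal_mult_less_top)
qed

text \<open>Division by the distance cancels \<open>width n powr p\<close>, so the constant is the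
  same for all layers.\<close>

lemma J_cutoff_le:
  assumes \<eta>: "\<And>x. 0 \<le> \<eta> x" "\<And>x. \<eta> x \<le> 1" "continuous_on UNIV \<eta>"
    and e: "weak_upper_gradient M p (\<lambda>x. ereal (\<eta> x)) e" "\<And>x. e x \<le> ennreal K" and K: "0 \<le> K"
    and \<eta>1: "\<And>x. x \<in> dlayer n \<Longrightarrow> \<eta> x = 1"
  shows "J n \<le> ennreal layer_const *
    (\<integral>\<^sup>+x\<in>{x. d x < (1 + L) * width n \<and> 0 < \<eta> x}. (epowr (g x) p * indicator \<Omega> x + epowr (e x) p * ennreal (v x powr p)) \<partial>M)"
    (is "_ \<le> _ * ?I")
proof -
  let ?C = "4 * 8 powr p * c\<^sub>H powr p * c\<^sub>D ^ 3 * width n powr p"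
  have C: "0 \<le> ?C" using c_D by simp
  have "J n \<le> ennreal ((2 / width n) powr p) * (\<integral>\<^sup>+x\<in>dlayer n. ennreal (v x powr p) \<partial>M)" by (rule J_le)
  also have "\<dots> \<le> ennreal ((2 / width n) powr p) * (ennreal ?C * ?I)"
    by (intro mult_left_mono layer_strong_type[OF u g fin \<eta> e K width_pos \<eta>1]) auto
  also have "\<dots> = ennreal ((2 / width n) powr p * ?C) * ?I"
    using C by (simp add: ennreal_mult mult.assoc)
  also have "(2 / width n) powr p * ?C = layer_const"
  proof -
    have "(16 :: real) powr p = 2 powr p * 8 powr p" by (simp add: powr_mult[symmetric])
    then show ?thesis using width_pos[of n] by (simp add: layer_const_def powr_divide)
  qed
  finally show ?thesis .
qed

text \<open>The constant cutoff \<open>1\<close>: the gradient is seen all the way down. Summing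
  this over all layers is the lossy route, so it serves only the bottom \<open>N\<close> layers of a
  finite range.\<close>

lemma J_le_energy: "J n \<le> ennreal layer_const * energy"
proof -
  have "J n \<le> ennreal layer_const * (\<integral>\<^sup>+x\<in>{x. d x < (1 + L) * width n \<and> (0::real) < 1}.
      (epowr (g x) p * indicator \<Omega> x + epowr 0 p * ennreal (v x powr p)) \<partial>M)"
    using weak_upper_gradient_const[of p 1] by (intro J_cutoff_le[where \<eta> = "\<lambda>_. 1" and e = "\<lambda>_. 0" and K = 0]) auto
  also have "\<dots> \<le> ennreal layer_const * energy"
    by (intro mult_left_mono nn_integral_mono) (auto simp: indicator_def)
  finally show ?thesis .
qed

text \<open>Descending by \<open>cutoff N n\<close> hides the gradient of \<open>u\<close> below the
  last ramp. The price is the gradient of the cutoff, which \<open>epowr_cutoff_grad_le\<close>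
  turns into Hardy integrals of the next \<open>N\<close> layers.\<close>

lemma J_le_neighbours:
  fixes N :: nat
  assumes N: "0 < N"
  shows "J n \<le> ennreal layer_const *
    ((\<integral>\<^sup>+x\<in>\<Omega>. epowr (g x) p * indicator {x. width (n + int N + 1) < d x \<and> d x < (1 + L) * width n} x \<partial>M)
     + ennreal ((2 / N) powr p) * (\<Sum>j\<in>{1..int N}. J (n + j)))"
proof -
  let ?A = "{x. width (n + int N + 1) < d x \<and> d x < (1 + L) * width n}"
  have "{x \<in> space M. width (n + int N + 1) < d x \<and> d x < (1 + L) * width n} \<in> sets M" by measurable
  then have [measurable]: "?A \<in> sets M" by (simp add: space_M)
  have "J n \<le> ennreal layer_const *
    (\<integral>\<^sup>+x\<in>{x. d x < (1 + L) * width n \<and> 0 < cutoff N n x}. (epowr (g x) p * indicator \<Omega> x + epowr (cutoff_grad N n x) p * ennreal (v x powr p)) \<partial>M)"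
    using cutoff_bounds[OF N] width_pos
    by (intro J_cutoff_le[OF _ _ continuous_cutoff weak_upper_gradient_cutoff[OF N] cutoff_grad_le[OF N]])
       (auto intro!: sum_nonneg simp: less_imp_le)
  also have "\<dots> \<le> ennreal layer_const * (\<integral>\<^sup>+x. epowr (g x) p * indicator ?A x * indicator \<Omega> x
      + ennreal ((2 / N) powr p) * (\<Sum>j\<in>{1..int N}. hardy_density u x * indicator (dlayer (n + j)) x) \<partial>M)"
  proof (intro mult_left_mono nn_integral_mono)
    fix x
    have "epowr (cutoff_grad N n x) p * ennreal (v x powr p)
      \<le> ennreal ((2 / N) powr p) * (\<Sum>j\<in>{1..int N}. hardy_density u x * indicator (dlayer (n + j)) x)"
      unfolding hardy_density_def by (rule epowr_cutoff_grad_le[OF N]) (simp add: real_of_ereal_pos)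
    then show "(epowr (g x) p * indicator \<Omega> x + epowr (cutoff_grad N n x) p * ennreal (v x powr p))
        * indicator {x. d x < (1 + L) * width n \<and> 0 < cutoff N n x} x
      \<le> epowr (g x) p * indicator ?A x * indicator \<Omega> x
      + ennreal ((2 / N) powr p) * (\<Sum>j\<in>{1..int N}. hardy_density u x * indicator (dlayer (n + j)) x)"
      using cutoff_bounds(4)[OF N, of n x]
      by (cases "d x < (1 + L) * width n \<and> 0 < cutoff N n x") (simp_all add: add_left_mono)
  qed simp
  also have "(\<integral>\<^sup>+x. epowr (g x) p * indicator ?A x * indicator \<Omega> x
      + ennreal ((2 / N) powr p) * (\<Sum>j\<in>{1..int N}. hardy_density u x * indicator (dlayer (n + j)) x) \<partial>M)
    = (\<integral>\<^sup>+x\<in>\<Omega>. epowr (g x) p * indicator ?A x \<partial>M)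
      + ennreal ((2 / N) powr p) * (\<Sum>j\<in>{1..int N}. J (n + j))"
  proof -
    have 1: "(\<integral>\<^sup>+x. (\<Sum>j\<in>{1..int N}. hardy_density u x * indicator (dlayer (n + j)) x) \<partial>M) = (\<Sum>j\<in>{1..int N}. J (n + j))"
      by (rule nn_integral_sum) measurable
    have 2: "(\<integral>\<^sup>+x. ennreal ((2 / N) powr p) * (\<Sum>j\<in>{1..int N}. hardy_density u x * indicator (dlayer (n + j)) x) \<partial>M)
      = ennreal ((2 / N) powr p) * (\<integral>\<^sup>+x. (\<Sum>j\<in>{1..int N}. hardy_density u x * indicator (dlayer (n + j)) x) \<partial>M)"
      by (rule nn_integral_cmult) measurable
    show ?thesis
      unfolding 1[symmetric] 2[symmetric] by (rule nn_integral_add) measurable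
  qed
  finally show ?thesis .
qed

text \<open>The factor \<open>(2 / N) powr p * N\<close> of the sum on the right-hand side of the preceding estimate
  is small for large \<open>N\<close>, because \<open>p > 1\<close>; the sum is then absorbed by the left-hand side. Near the
  bottom of the range the cutoff would leave the range, so it is omitted there.\<close>
lemma sum_J_le:
  fixes N c m :: nat
  assumes N: "0 < N" and small: "layer_const * (2 powr p * N powr (1 - p)) \<le> 1 / 2"
    and c: "1 + L \<le> 2 ^ c"
  shows "(\<Sum>n\<in>{- int m..int m}. J n) \<le> ennreal (2 * layer_const * (2 * N + c + 1)) * energy"
proof -
  let ?S = "{- int m..int m}" and ?S1 = "{- int m..int m - int N}" and ?S2 = "{int m - int N + 1..int m}"
  define X where "X = (\<Sum>n\<in>?S. J n)"
  have Xfin: "X < \<infinity>" unfolding X_def using J_finite by (simp add: less_top)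
  let ?A = "\<lambda>n. {x. width (n + int N + 1) < d x \<and> d x < (1 + L) * width n}"
  let ?E = "\<lambda>n. \<integral>\<^sup>+x\<in>\<Omega>. epowr (g x) p * indicator (?A n) x \<partial>M"
  have [measurable]: "?A n \<in> sets M" for n
  proof -
    have "{x \<in> space M. width (n + int N + 1) < d x \<and> d x < (1 + L) * width n} \<in> sets M" by measurable
    then show ?thesis by (simp add: space_M)
  qed
  have E: "(\<Sum>n\<in>?S1. ?E n) \<le> of_nat (N + c + 1) * energy"
  proof -
    have "(\<Sum>n\<in>?S1. ?E n) = (\<integral>\<^sup>+x. (\<Sum>n\<in>?S1. epowr (g x) p * indicator (?A n) x * indicator \<Omega> x) \<partial>M)"
      by (rule nn_integral_sum[symmetric]) measurable
    also have "\<dots> \<le> (\<integral>\<^sup>+x. of_nat (N + c + 1) * (epowr (g x) p * indicator \<Omega> x) \<partial>M)"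
    proof (rule nn_integral_mono)
      fix x
      have "(\<Sum>n\<in>?S1. epowr (g x) p * indicator (?A n) x * indicator \<Omega> x)
         = (\<Sum>n\<in>?S1. indicator (?A n) x) * (epowr (g x) p * indicator \<Omega> x)"
        unfolding sum_distrib_right by (intro sum.cong refl) (simp only: mult_ac)
      also have "\<dots> \<le> of_nat (N + c + 1) * (epowr (g x) p * indicator \<Omega> x)"
        by (intro mult_right_mono card_layers_le[OF c]) auto
      finally show "(\<Sum>n\<in>?S1. epowr (g x) p * indicator (?A n) x * indicator \<Omega> x)
         \<le> of_nat (N + c + 1) * (epowr (g x) p * indicator \<Omega> x)" .
    qed
    also have "\<dots> = of_nat (N + c + 1) * energy" by (rule nn_integral_cmult) measurable
    finally show ?thesis .
  qed
  \<comment> \<open>For each of the \<open>N\<close> shifts, the translated range stays inside the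
    full range, so its sum is at most \<open>X\<close>.\<close>
  have shift: "(\<Sum>n\<in>?S1. \<Sum>j\<in>{1..int N}. J (n + j)) \<le> of_nat N * X"
  proof -
    have "(\<Sum>n\<in>?S1. \<Sum>j\<in>{1..int N}. J (n + j)) = (\<Sum>j\<in>{1..int N}. \<Sum>n\<in>?S1. J (n + j))"
      by (rule sum.swap)
    also have "\<dots> \<le> (\<Sum>j\<in>{1..int N}. X)"
    proof (rule sum_mono)
      fix j assume j: "j \<in> {1..int N}"
      have "(\<Sum>n\<in>?S1. J (n + j)) = (\<Sum>n\<in>(\<lambda>n. n + j) ` ?S1. J n)"
        by (subst sum.reindex) (auto simp: inj_on_def)
      also have "\<dots> \<le> X" unfolding X_def using j by (intro sum_mono2) auto
      finally show "(\<Sum>n\<in>?S1. J (n + j)) \<le> X" .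
    qed
    finally show ?thesis by simp
  qed
  \<comment> \<open>Only an inequality, because \<open>?S2\<close> always has \<open>N\<close>
    elements and extends beyond the range when \<open>N\<close> is large compared with
    \<open>m\<close>.\<close>
  have "X \<le> (\<Sum>n\<in>?S1 \<union> ?S2. J n)" unfolding X_def by (intro sum_mono2) auto
  also have "\<dots> = (\<Sum>n\<in>?S1. J n) + (\<Sum>n\<in>?S2. J n)" by (intro sum.union_disjoint) auto
  also have "(\<Sum>n\<in>?S2. J n) \<le> (\<Sum>n\<in>?S2. ennreal layer_const * energy)" by (intro sum_mono J_le_energy)
  also have "\<dots> = of_nat N * (ennreal layer_const * energy)" by simp
  also have "(\<Sum>n\<in>?S1. J n) \<le> (\<Sum>n\<in>?S1. ennreal layer_const * (?E n + ennreal ((2 / N) powr p) * (\<Sum>j\<in>{1..int N}. J (n + j))))"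
    by (intro sum_mono J_le_neighbours N)
  also have "\<dots> = ennreal layer_const * ((\<Sum>n\<in>?S1. ?E n) + ennreal ((2 / N) powr p) * (\<Sum>n\<in>?S1. \<Sum>j\<in>{1..int N}. J (n + j)))"
    by (simp only: sum_distrib_left[symmetric] sum.distrib)
  also have "\<dots> \<le> ennreal layer_const * (of_nat (N + c + 1) * energy + ennreal ((2 / N) powr p) * (of_nat N * X))"
    by (intro mult_left_mono add_mono E shift) auto
  finally have "X \<le> ennreal layer_const * (of_nat (N + c + 1) * energy + ennreal ((2 / N) powr p) * (of_nat N * X))
      + of_nat N * (ennreal layer_const * energy)" by (simp add: add_right_mono)
  also have "\<dots> = ennreal (layer_const * (2 * N + c + 1)) * energy + ennreal (layer_const * ((2 / N) powr p * N)) * X"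
  proof -
    have 1: "ennreal layer_const * of_nat (N + c + 1) + of_nat N * ennreal layer_const = ennreal (layer_const * (2 * N + c + 1))"
      unfolding ennreal_of_nat_eq_real_of_nat using layer_const_nonneg
      by (simp add: ennreal_mult[symmetric] ennreal_plus[symmetric] algebra_simps del: ennreal_plus)
    have 2: "ennreal (layer_const * ((2 / N) powr p * N)) = ennreal layer_const * (ennreal ((2 / N) powr p) * of_nat N)"
      unfolding ennreal_of_nat_eq_real_of_nat using layer_const_nonneg by (simp add: ennreal_mult)
    show ?thesis unfolding 1[symmetric] 2 by (simp only: distrib_left distrib_right mult_ac add_ac)
  qed
  also have "\<dots> \<le> ennreal (layer_const * (2 * N + c + 1)) * energy + ennreal (1 / 2) * X"
  proof (intro add_left_mono mult_right_mono ennreal_leI)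
    \<comment> \<open>Here \<open>p > 1\<close> becomes effective: the exponent \<open>1 - p\<close>
      of \<open>N\<close> is negative.\<close>
    have "(2 / N) powr p * N = 2 powr p * N powr (1 - p)"
      using N by (simp add: powr_divide powr_diff)
    then show "layer_const * ((2 / N) powr p * N) \<le> 1 / 2" using small by simp
  qed simp
  finally have "X \<le> 2 * (ennreal (layer_const * (2 * N + c + 1)) * energy)"
    using Xfin by (rule ennreal_absorb)
  also have "\<dots> = ennreal (2 * layer_const * (2 * N + c + 1)) * energy"
    using layer_const_nonneg by (simp add: ennreal_mult mult.assoc)
  finally show ?thesis unfolding X_def .
qed

lemma hardy_density_le:
  fixes N c :: nat
  assumes N: "0 < N" and small: "layer_const * (2 powr p * N powr (1 - p)) \<le> 1 / 2"
    and c: "1 + L \<le> 2 ^ c"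
  shows "(\<integral>\<^sup>+x\<in>\<Omega>. epowr (eabs (u x)) p / ennreal (d x powr p) \<partial>M)
    \<le> ennreal (2 * layer_const * (2 * N + c + 1)) * energy"
proof -
  have uLp: "(\<integral>\<^sup>+x. epowr (eabs (u x)) p \<partial>M) < \<infinity>"
    using u by (auto simp: newtonian0_def newtonian_def Lp_space_def)
  have m: "(\<lambda>x. epowr (eabs (u x)) p) \<in> borel_measurable M" unfolding eabs_def by measurable
  \<comment> \<open>Integrability makes \<open>u\<close> finite almost everywhere, which permits the
    passage to the real-valued density.\<close>
  have "AE x in M. epowr (eabs (u x)) p \<noteq> \<infinity>"
    using uLp by (intro nn_integral_PInf_AE m) auto
  then have "(\<integral>\<^sup>+x\<in>\<Omega>. epowr (eabs (u x)) p / ennreal (d x powr p) \<partial>M) = (\<integral>\<^sup>+x\<in>\<Omega>. hardy_density u x \<partial>M)"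
  proof (intro nn_integral_cong_AE, eventually_elim)
    case (elim x)
    then have "\<bar>u x\<bar> \<noteq> \<infinity>" by (auto simp: eabs_def)
    then have "eabs (u x) = ennreal (v x)" by (cases "u x") auto
    then have "epowr (eabs (u x)) p = ennreal (v x powr p)" by (simp add: epowr_ennreal real_of_ereal_pos)
    moreover have "0 < d x powr p" if "x \<in> \<Omega>" using that d_pos_iff[of x] by simp
    ultimately show ?case by (auto simp: indicator_def hardy_density_def divide_ennreal)
  qed
  \<comment> \<open>Ranges of layers symmetric about index \<open>0\<close> exhaust
    \<open>\<Omega>\<close>, and the bound for each of them is independent of
    \<open>m\<close>.\<close>
  also have "\<dots> \<le> (\<integral>\<^sup>+x. (SUP m :: nat. \<Sum>n\<in>{- int m..int m}. hardy_density u x * indicator (dlayer n) x) \<partial>M)"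
  proof (rule nn_integral_mono)
    fix x
    show "hardy_density u x * indicator \<Omega> x \<le> (SUP m :: nat. \<Sum>n\<in>{- int m..int m}. hardy_density u x * indicator (dlayer n) x)"
    proof (cases "x \<in> \<Omega>")
      case True
      then obtain n where n: "x \<in> dlayer n" using dlayer_exists d_pos_iff by blast
      have "hardy_density u x * indicator \<Omega> x = hardy_density u x * indicator (dlayer n) x" using True n by simp
      also have "\<dots> \<le> (\<Sum>n\<in>{- int (nat \<bar>n\<bar>)..int (nat \<bar>n\<bar>)}. hardy_density u x * indicator (dlayer n) x)"
        by (rule member_le_sum) auto
      also have "\<dots> \<le> (SUP m :: nat. \<Sum>n\<in>{- int m..int m}. hardy_density u x * indicator (dlayer n) x)"
        by (rule SUP_upper) simp
      finally show ?thesis .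
    qed simp
  qed
  also have "\<dots> = (SUP m :: nat. \<integral>\<^sup>+x. (\<Sum>n\<in>{- int m..int m}. hardy_density u x * indicator (dlayer n) x) \<partial>M)"
  proof (rule nn_integral_monotone_convergence_SUP)
    show "incseq (\<lambda>(m :: nat) x. \<Sum>n\<in>{- int m..int m}. hardy_density u x * indicator (dlayer n) x)"
      by (intro incseq_SucI le_funI sum_mono2) simp_all
  qed measurable
  also have "\<dots> \<le> ennreal (2 * layer_const * (2 * N + c + 1)) * energy"
  proof (rule SUP_least)
    fix m :: nat
    have "(\<integral>\<^sup>+x. (\<Sum>n\<in>{- int m..int m}. hardy_density u x * indicator (dlayer n) x) \<partial>M) = (\<Sum>n\<in>{- int m..int m}. J n)"
      by (rule nn_integral_sum) measurable
    then show "(\<integral>\<^sup>+x. (\<Sum>n\<in>{- int m..int m}. hardy_density u x * indicator (dlayer n) x) \<partial>M)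
      \<le> ennreal (2 * layer_const * (2 * N + c + 1)) * energy"
      using sum_J_le[OF N small c] by simp
  qed
  finally show ?thesis .
qed

end

lemma hardy: "hardy M p \<Omega>"
proof -
  obtain c :: nat where c: "1 + L \<le> 2 ^ c"
    using real_arch_pow[of 2 "1 + L"] by (auto intro: less_imp_le)
  \<comment> \<open>The choice of \<open>N\<close> depends only on \<open>p\<close> and the
    structural constants, so the final constant serves all \<open>u\<close> and
    \<open>g\<close>.\<close>
  have "(\<lambda>N. layer_const * (2 powr p * real N powr (1 - p))) \<longlonglongrightarrow> layer_const * (2 powr p * 0)"
    using p by (intro tendsto_intros tendsto_neg_powr filterlim_real_sequentially) auto
  then have "\<forall>\<^sub>F N in sequentially. layer_const * (2 powr p * real N powr (1 - p)) < 1 / 2"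
    by (rule order_tendstoD(2)) simp
  then have "\<forall>\<^sub>F N in sequentially. 0 < N \<and> layer_const * (2 powr p * real N powr (1 - p)) \<le> 1 / 2"
    using eventually_gt_at_top[of 0] by eventually_elim simp
  then obtain N where N: "0 < N" "layer_const * (2 powr p * real N powr (1 - p)) \<le> 1 / 2"
    unfolding eventually_sequentially by blast
  \<comment> \<open>The summand \<open>1\<close> makes \<open>C\<close> positive; positivity also
    settles the case of infinite energy, where the right-hand side is then infinite.\<close>
  define C where "C = 2 * layer_const * (2 * N + c + 1) + 1"
  have C: "2 * layer_const * (2 * N + c + 1) \<le> C" "0 < C"
    using layer_const_nonneg by (auto simp: C_def intro!: add_nonneg_pos mult_nonneg_nonneg)
  show ?thesis
    unfolding hardy_def
  proof (intro exI[of _ C] conjI ballI allI impI C(2))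
    fix u g assume u: "u \<in> newtonian0 M p \<Omega>" and g: "weak_upper_gradient M p u g"
    show "(\<integral>\<^sup>+x\<in>\<Omega>. epowr (eabs (u x)) p / ennreal (d x powr p) \<partial>M) \<le> ennreal C * (\<integral>\<^sup>+x\<in>\<Omega>. epowr (g x) p \<partial>M)"
    proof (cases "(\<integral>\<^sup>+x\<in>\<Omega>. epowr (g x) p \<partial>M) < \<infinity>")
      case True
      show ?thesis
        using C(1) by (intro order_trans[OF hardy_density_le[OF u g True N c]] mult_right_mono ennreal_leI) auto
    next
      case False
      then have "(\<integral>\<^sup>+x\<in>\<Omega>. epowr (g x) p \<partial>M) = \<infinity>" by (metis less_top infinity_ennreal_def)
      then show ?thesis using C(2) by (simp add: ennreal_mult_top)
    qed
  qed
qed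

end

theorem corollary2p5:
  fixes \<mu> :: "'a::complete_space set \<Rightarrow> ennreal" and p :: real and \<Omega> :: "'a set"
  assumes "1 < p"
    and "metric_measure_space \<mu>"
    and "doubling \<mu>"
    and "supports_poincare (caratheodory \<mu>) p"
    and "open \<Omega>" and "\<Omega> \<noteq> UNIV"
    and "pointwise_hardy (caratheodory \<mu>) p \<Omega>"
  shows "hardy (caratheodory \<mu>) p \<Omega>"
proof -
  obtain c\<^sub>D where c\<^sub>D: "1 \<le> c\<^sub>D" "\<And>x r. 0 < r \<Longrightarrow> \<mu> (ball x (2 * r)) \<le> ennreal c\<^sub>D * \<mu> (ball x r)"
    using assms(3) by (auto simp: doubling_def)
  obtain c\<^sub>H L where H: "0 < c\<^sub>H" "1 \<le> L" "\<And>u g. u \<in> newtonian0 (caratheodory \<mu>) p \<Omega> \<Longrightarrow>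
      weak_upper_gradient (caratheodory \<mu>) p u g \<Longrightarrow>
      AE x in caratheodory \<mu>. x \<in> \<Omega> \<longrightarrow> eabs (u x) \<le> ennreal (c\<^sub>H * dist_compl \<Omega> x) *
        epowr (restricted_maximal (caratheodory \<mu>) (L * dist_compl \<Omega> x) (\<lambda>y. epowr (g y) p) x) (1 / p)"
    using assms(7) unfolding pointwise_hardy_def by blast
  interpret metric_measure "caratheodory \<mu>" by (rule metric_measure_caratheodory(1)[OF assms(2)])
  \<comment> \<open>Balls have the same outer measure and measure, so the doubling condition carries
    over.\<close>
  interpret pointwise_hardy_domain "caratheodory \<mu>" c\<^sub>D p \<Omega> c\<^sub>H L
    by unfold_locales
       (use c\<^sub>D H assms(1,5,6) in \<open>auto simp: metric_measure_caratheodory(2)[OF assms(2)]\<close>)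
  show ?thesis by (rule hardy)
qed

end
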